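(* Let $p=p_n\gg n$ and let $\delta>0$. Suppose the parameter space condition (A), the wedge condition (B) and the sparsity condition (C) of the context hold. Let $(\hat\alpha,\hat\beta,\hat d)$ be the two-shot penalized least squares estimator defined in the context, with penalty $$\operatorname{pen}(m)=\frac{V_m(\log p)^\delta\|\xi\|_{n,2}}{n}\log\frac n{V_m},\qquad \|\xi\|_{n,2}=\sqrt{\mathbb E\big[\max_{1\le i\le n}\xi_i^2\big]} .$$ Put $$r_n=\frac{n}{s(\log p)^{1+\delta}\|\xi\|_{n,2}}\Big(\log\frac{n}{s\log p}\Big)^{-1}.$$ Then $$(\sqrt n\wedge r_n)(\hat\alpha-\alpha_0)=O_p(1),\qquad (\sqrt n\wedge r_n)(\hat\beta-\beta_0)=O_p(1),\qquad r_n\big\|\hat d-d_0\big\|_2=O_p(1).$$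
   Context: Model: $(X_i,\xi_i)_{1\le i\le n}$ i.i.d. copies of $(X,\xi)$ with $X\in\mathbb R^p$, $\xi$ real, independent of $X$, symmetric about $0$, with $\mathbb E[\xi^2]<\infty$. One observes $(X_i,Y_i)$ with $Y_i=\alpha_0\mathbf 1_{X_i^\top d_0\le0}+\beta_0\mathbf 1_{X_i^\top d_0>0}+\xi_i$. Convention: $\operatorname{sign}(x)=1$ if $x>0$, $-1$ if $x\le0$. (A) $(\alpha_0,\beta_0)\in\Omega$, where $\Omega\subset\mathbb R^2$ is compact and $\alpha>\beta$ for every $(\alpha,\beta)\in\Omega$; and $d_0\in S^{p-1}$. (B) There is $\eta>0$ such that for all $d\in S^{p-1}$ with $\|d-d_0\|_2\le\eta$: $\mathbb P(\operatorname{sign}(X^\top d)\ne\operatorname{sign}(X^\top d_0))\ge c\|d-d_0\|_2$, $\mathbb P(X^\top d\wedge X^\top d_0\ge0)\ge C_1$, and $\mathbb P(X^\top d\vee X^\top d_0\le0)\ge C_2$, where the positive constants $c,C_1,C_2,\eta$ do not depend on $n$. (C) There is $s$ (possibly growing with $n$) with $\|d_0\|_0\le s$ and $\frac{s(\log p)^{1+\delta}\|\xi\|_{n,2}}{n}\to0$, where $\|\cdot\|_0$ counts nonzero coordinates. Estimator: for $\theta=(\alpha,\beta,d)$ let $f_\theta(x)=\alpha\mathbf 1_{x^\top d\le0}+\beta\mathbf 1_{x^\top d>0}$, and for $1\le m\le p$ let $\mathcal F_m=\{f_\theta:(\alpha,\beta)\in\Omega,\ d\in S^{p-1},\ \|d\|_0\le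 m\}$, with VC dimension $V_m=VC(\mathcal F_m)\asymp m\log(ep/m)$. Let $\tilde H_\infty(x)=x^2/2$, and let $\hat\theta_m$ minimize $\frac1n\sum_{i=1}^n\tilde H_\infty(Y_i-f_\theta(X_i))$ over $f_\theta\in\mathcal F_m$. Let $\hat m$ minimize over $1\le m\le p$ the quantity $\frac1n\sum_{i=1}^n[\tilde H_\infty(Y_i-f_{\hat\theta_m}(X_i))-\tilde H_\infty(\xi_i)]+\operatorname{pen}(m)$, and let $\hat d$ be the $d$-component of $\hat\theta_{\hat m}$. Finally $(\hat\alpha,\hat\beta)$ minimizes $\sum_i(Y_i-\alpha\mathbf 1_{X_i^\top\hat d\le0}-\beta\mathbf 1_{X_i^\top\hat d>0})^2$ over $(\alpha,\beta)\in\Omega$.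
   Formalization: In pen(m), log(n/V_m) is read as log(max(e, n/V_m)), since the plain logarithm would select the largest models when p ≫ n; in (B) the first wedge probability uses X^T d ∧ X^T d_0 > 0 instead of ≥ 0, since ≥ 0 admits designs where d_0 and −d_0 coincide. *)

theory Defs
  imports "HOL-Probability.Probability" "HOL-Library.Landau_Symbols"
begin

text \<open>The dimension \<open>p\<close> grows with the sample size, so vectors of \<open>\<real>\<^sup>p\<close> are functions on
  \<open>{..<p}\<close>, that is, points of the product space below (value \<^term>\<open>undefined\<close> outside the
  index set), with the product Borel sigma-algebra.\<close>

definition Rn :: "nat \<Rightarrow> (nat \<Rightarrow> real) measure" where
  "Rn p = PiM {..<p} (\<lambda>_. borel)"

definition dot :: "nat \<Rightarrow> (nat \<Rightarrow> real) \<Rightarrow> (nat \<Rightarrow> real) \<Rightarrow> real" where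
  "dot p x d = (\<Sum>j<p. x j * d j)"

definition dist2 :: "nat \<Rightarrow> (nat \<Rightarrow> real) \<Rightarrow> (nat \<Rightarrow> real) \<Rightarrow> real" where
  "dist2 p d d' = L2_set (\<lambda>j. d j - d' j) {..<p}"

definition usphere :: "nat \<Rightarrow> (nat \<Rightarrow> real) set" where
  "usphere p = {d \<in> space (Rn p). L2_set d {..<p} = 1}"

definition l0norm :: "nat \<Rightarrow> (nat \<Rightarrow> real) \<Rightarrow> nat" where
  "l0norm p d = card {j. j < p \<and> d j \<noteq> 0}"

text \<open>Unlike \<^const>\<open>sgn\<close>, the sign of 0 is -1.\<close>

definition sign_pm :: "real \<Rightarrow> real" where
  "sign_pm x = (if x > 0 then 1 else -1)"


type_synonym param = "real \<times> real \<times> (nat \<Rightarrow> real)"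

definition f_theta :: "nat \<Rightarrow> param \<Rightarrow> (nat \<Rightarrow> real) \<Rightarrow> real" where
  "f_theta p = (\<lambda>(\<alpha>, \<beta>, d) x.
     \<alpha> * of_bool (dot p x d \<le> 0) + \<beta> * of_bool (dot p x d > 0))"

definition Theta :: "nat \<Rightarrow> (real \<times> real) set \<Rightarrow> nat \<Rightarrow> param set" where
  "Theta p \<Omega> m = {(\<alpha>, \<beta>, d). (\<alpha>, \<beta>) \<in> \<Omega> \<and> d \<in> usphere p \<and> l0norm p d \<le> m}"

definition F_class :: "nat \<Rightarrow> (real \<times> real) set \<Rightarrow> nat \<Rightarrow> ((nat \<Rightarrow> real) \<Rightarrow> real) set" where
  "F_class p \<Omega> m = f_theta p ` Theta p \<Omega> m"


definition shatters :: "'a set set \<Rightarrow> 'a set \<Rightarrow> bool" where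
  "shatters \<C> S \<longleftrightarrow> (\<forall>T\<subseteq>S. \<exists>A\<in>\<C>. S \<inter> A = T)"

text \<open>The supremum is taken in \<^typ>\<open>nat\<close>; it is meaningful for collections of finite VC
  dimension, which includes the subgraphs of \<^const>\<open>F_class\<close>.\<close>

definition vc_dim :: "'a set set \<Rightarrow> nat" where
  "vc_dim \<C> = Sup {card S | S. finite S \<and> shatters \<C> S}"

text \<open>The VC dimension of a class of real functions is that of its subgraphs.\<close>

definition subgraph_on :: "'b set \<Rightarrow> ('b \<Rightarrow> real) \<Rightarrow> ('b \<times> real) set" where
  "subgraph_on D f = {(x, t). x \<in> D \<and> t < f x}"

definition VC_class :: "'b set \<Rightarrow> ('b \<Rightarrow> real) set \<Rightarrow> nat" where
  "VC_class D \<F> = vc_dim (subgraph_on D ` \<F>)"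

definition V_model :: "nat \<Rightarrow> (real \<times> real) set \<Rightarrow> nat \<Rightarrow> nat" where
  "V_model p \<Omega> m = VC_class (space (Rn p)) (F_class p \<Omega> m)"


text \<open>\<open>\<mu>\<close> is the law of \<open>X\<close> and \<open>\<nu>\<close> the law of \<open>\<xi>\<close>; the product form of the law of
  \<open>(X, \<xi>)\<close> is their independence.\<close>

definition iid_sample ::
  "'a measure \<Rightarrow> nat \<Rightarrow> nat \<Rightarrow> (nat \<Rightarrow> real) measure \<Rightarrow> real measure \<Rightarrow>
   (nat \<Rightarrow> 'a \<Rightarrow> nat \<Rightarrow> real) \<Rightarrow> (nat \<Rightarrow> 'a \<Rightarrow> real) \<Rightarrow> bool" where
  "iid_sample M n p \<mu> \<nu> X \<xi> \<longleftrightarrow>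
     prob_space M \<and>
     prob_space.indep_vars M (\<lambda>_. Rn p \<Otimes>\<^sub>M borel) (\<lambda>i \<omega>. (X i \<omega>, \<xi> i \<omega>)) {..<n} \<and>
     (\<forall>i<n. distr M (Rn p \<Otimes>\<^sub>M borel) (\<lambda>\<omega>. (X i \<omega>, \<xi> i \<omega>)) = \<mu> \<Otimes>\<^sub>M \<nu>)"

definition envelope2 :: "'a measure \<Rightarrow> nat \<Rightarrow> (nat \<Rightarrow> 'a \<Rightarrow> real) \<Rightarrow> real" where
  "envelope2 M n \<xi> = sqrt (LINT \<omega>|M. Max ((\<lambda>i. (\<xi> i \<omega>)\<^sup>2) ` {..<n}))"

text \<open>The two wedge probabilities concern the events that \<open>d\<close> and \<open>d0\<close> both give \<open>x\<close> the sign 1,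
  respectively both the sign -1. As \<^const>\<open>sign_pm\<close> puts the hyperplane on the negative side, the
  first inequality is strict. With \<open>\<ge>\<close> instead (the same thing if hyperplanes have no mass), a
  law of \<open>X\<close> carried by the hyperplane orthogonal to \<open>d0\<close> would be admitted, and then
  \<open>d0\<close> and \<open>- d0\<close> define the same model.\<close>

definition wedge_condition ::
  "real \<Rightarrow> real \<Rightarrow> real \<Rightarrow> real \<Rightarrow> nat \<Rightarrow> (nat \<Rightarrow> real) measure \<Rightarrow> (nat \<Rightarrow> real) \<Rightarrow> bool" where
  "wedge_condition c C1 C2 \<eta> p \<mu> d0 \<longleftrightarrow>
     (\<forall>d\<in>usphere p. dist2 p d d0 \<le> \<eta> \<longrightarrow>
        measure \<mu> {x \<in> space \<mu>. sign_pm (dot p x d) \<noteq> sign_pm (dot p x d0)} \<ge> c * dist2 p d d0 \<and>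
        measure \<mu> {x \<in> space \<mu>. min (dot p x d) (dot p x d0) > 0} \<ge> C1 \<and>
        measure \<mu> {x \<in> space \<mu>. max (dot p x d) (dot p x d0) \<le> 0} \<ge> C2)"


definition H_inf :: "real \<Rightarrow> real" where
  "H_inf x = x\<^sup>2 / 2"

definition emp_loss ::
  "nat \<Rightarrow> nat \<Rightarrow> (nat \<Rightarrow> nat \<Rightarrow> real) \<Rightarrow> (nat \<Rightarrow> real) \<Rightarrow> param \<Rightarrow> real" where
  "emp_loss n p x y \<theta> = (\<Sum>i<n. H_inf (y i - f_theta p \<theta> (x i))) / real n"

text \<open>\<open>V\<close> is a VC dimension and \<open>E\<close> the envelope norm. The logarithm of \<open>n / V\<close> is
  read with the usual convention \<open>log u = log (max e u)\<close>, which matters only for \<open>V > n / e\<close>: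
  there the plain logarithm would make the penalty vanish and then tend to minus infinity,
  so that the largest models would always be selected when \<open>p\<close> is much larger than \<open>n\<close>.\<close>

definition pen :: "nat \<Rightarrow> nat \<Rightarrow> real \<Rightarrow> real \<Rightarrow> nat \<Rightarrow> real" where
  "pen n p \<delta> E V =
     real V * (ln (real p)) powr \<delta> * E / real n * ln (max (exp 1) (real n / real V))"

text \<open>For one realisation \<open>x, e, y\<close> of covariates, noise and responses: \<open>th m\<close> is a least
  squares fit in the \<open>m\<close>-th model, \<open>mh\<close> a selected model, and \<open>ab\<close> the second-stage fit
  given the direction selected in the first stage. Minimizers need not be unique, and any may be
  chosen.\<close>

definition two_shot ::
  "nat \<Rightarrow> nat \<Rightarrow> (real \<times> real) set \<Rightarrow> real \<Rightarrow> real \<Rightarrow>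
   (nat \<Rightarrow> nat \<Rightarrow> real) \<Rightarrow> (nat \<Rightarrow> real) \<Rightarrow> (nat \<Rightarrow> real) \<Rightarrow>
   (nat \<Rightarrow> param) \<Rightarrow> nat \<Rightarrow> real \<times> real \<Rightarrow> bool" where
  "two_shot n p \<Omega> \<delta> E x e y th mh ab \<longleftrightarrow>
     (\<forall>m\<in>{1..p}. is_arg_min (emp_loss n p x y) (\<lambda>\<theta>. \<theta> \<in> Theta p \<Omega> m) (th m)) \<and>
     is_arg_min
       (\<lambda>m. (\<Sum>i<n. H_inf (y i - f_theta p (th m) (x i)) - H_inf (e i)) / real n
            + pen n p \<delta> E (V_model p \<Omega> m))
       (\<lambda>m. m \<in> {1..p}) mh \<and>
     is_arg_min
       (\<lambda>(\<alpha>, \<beta>). \<Sum>i<n. (y i - f_theta p (\<alpha>, \<beta>, snd (snd (th mh))) (x i))\<^sup>2)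
       (\<lambda>\<theta>. \<theta> \<in> \<Omega>) ab"

definition rate :: "nat \<Rightarrow> nat \<Rightarrow> nat \<Rightarrow> real \<Rightarrow> real \<Rightarrow> real" where
  "rate n p s \<delta> E =
     real n / (real s * (ln (real p)) powr (1 + \<delta>) * E) * inverse (ln (real n / (real s * ln (real p))))"


text \<open>\<open>Z n = O\<^sub>p(1)\<close>, where each \<open>Z n\<close> lives on its own probability space.\<close>

definition Op1 :: "(nat \<Rightarrow> 'a measure) \<Rightarrow> (nat \<Rightarrow> 'a \<Rightarrow> real) \<Rightarrow> bool" where
  "Op1 M Z \<longleftrightarrow>
     (\<forall>\<^sub>F n in sequentially. Z n \<in> borel_measurable (M n)) \<and>
     (\<forall>\<epsilon>>0. \<exists>K. \<forall>\<^sub>F n in sequentially. measure (M n) {\<omega> \<in> space (M n). \<bar>Z n \<omega>\<bar> > K} \<le> \<epsilon>)"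

end

theory Submission
  imports Defs
begin

text \<open>Conditionally on the covariates a model only sees the patterns that its half-spaces cut out of
  the sample, and by Sauer's lemma there are at most \<open>exp (3 L\<^sub>m)\<close> of them, where
  \<open>L\<^sub>m = V\<^sub>m log (n / V\<^sub>m)\<close>. On the event that all errors are at most a multiple of their envelope norm
  the errors are bounded and symmetric, so Bernstein's inequality and a union bound control
  the sum of the errors over every pattern of every model at the scale \<open>L\<^sub>m\<close>. The factor
  \<open>(log p)\<^sup>\<delta>\<close> in the penalty dominates all constants, and the basic inequality gives that the
  empirical squared error of the first stage and the penalty of the selected model are both of the order of
  the penalty of the true model, which is at most \<open>40 / r\<^sub>n\<close>. A lower bound for the relative
  frequency of wedges, from a ghost sample, and the wedge condition turn this into a bound for the direction;
  the second stage is then least squares with few misclassified observations. If \<open>r\<^sub>n\<close> stays bounded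
  there is nothing to prove, since the parameter sets are bounded.\<close>

section \<open>Patterns cut out by sparse half-spaces\<close>

text \<open>The errors have only two moments, too few for a union bound over exponentially many
  patterns. Cutting them at a multiple of the envelope norm E supplies exponential moments; symmetry
  keeps the mean at zero, so no bias has to be controlled, and the price is a linear term of size E
  times the complexity, which is why E multiplies the penalty. Conditioning on the covariates is
  replaced by a product formula for covariate and error events. Comparing all models at once costs
  nothing because every VC dimension is at least of order log p. For the wedges only a one-sided,
  multiplicative comparison of frequency and probability is used; an additive deviation bound would
  lose a square root in the rate of the direction. Relabelling is another obstacle: a direction near
  -d0 with exchanged levels would fit equally well, and the uniform gap alpha - beta on the compact
  set Omega excludes it. Finally, condition (C) does not contain the last logarithm of r_n and so
  does not force r_n to grow; bounded r_n is a genuine case.\<close>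

text \<open>Induction on a point \<open>a\<close>. Deleting \<open>a\<close> from all sets merges
  those that differ only in \<open>a\<close>; \<open>F1\<close> collects the results and
  \<open>F2\<close> the merged ones, so the cardinalities add up. What \<open>F1\<close> shatters is
  shattered by \<open>\<F>\<close>, and what \<open>F2\<close> shatters can be enlarged by
  \<open>a\<close>; the two kinds of shattered sets differ in whether they contain
  \<open>a\<close>.\<close>

lemma pajor:
  assumes "finite S" "\<F> \<subseteq> Pow S"
  shows "card \<F> \<le> card {J. J \<subseteq> S \<and> shatters \<F> J}"
  using assms
proof (induction S arbitrary: \<F> rule: finite_induct)
  case empty
  then have "\<F> = {} \<or> \<F> = {{}}" by (simp add: subset_singleton_iff)
  then show ?case
  proof
    assume "\<F> = {{}}"
    then have "{J. J \<subseteq> {} \<and> shatters \<F> J} = {{}}"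
      by (auto simp: shatters_def)
    then show ?thesis using \<open>\<F> = {{}}\<close> by simp
  qed simp
next
  case (insert a S)
  define F1 where "F1 = (\<lambda>A. A - {a}) ` \<F>"
  define F2 where "F2 = {A. A \<subseteq> S \<and> A \<in> \<F> \<and> insert a A \<in> \<F>}"
  have finF: "finite \<F>" using insert.prems insert.hyps finite_subset by fastforce
  have F1S: "F1 \<subseteq> Pow S" and F2S: "F2 \<subseteq> Pow S"
    using insert.prems by (auto simp: F1_def F2_def)
  define P where "P = {A \<in> \<F>. a \<notin> A}"
  define Q where "Q = {A \<in> \<F>. a \<in> A}"
  have cF: "card \<F> = card P + card Q"
    unfolding P_def Q_def using finF
    by (subst card_Un_disjoint[symmetric]) (auto intro!: arg_cong[where f = card])
  have injQ: "inj_on (\<lambda>A. A - {a}) Q"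
    unfolding Q_def inj_on_def by (metis (mono_tags, lifting) insert_Diff mem_Collect_eq)
  have F1eq: "F1 = P \<union> (\<lambda>A. A - {a}) ` Q"
  proof -
    have "P = (\<lambda>A. A - {a}) ` P" unfolding P_def by (auto simp: image_iff)
    moreover have "\<F> = P \<union> Q" unfolding P_def Q_def by auto
    ultimately show ?thesis unfolding F1_def by (metis image_Un)
  qed
  have F2eq: "F2 = P \<inter> (\<lambda>A. A - {a}) ` Q"
  proof (intro set_eqI iffI)
    fix A assume "A \<in> F2"
    then have A: "A \<subseteq> S" "A \<in> \<F>" "insert a A \<in> \<F>" by (auto simp: F2_def)
    then have "a \<notin> A" using insert.hyps by auto
    then have "A = insert a A - {a}" "A \<in> P" "insert a A \<in> Q"
      using A by (auto simp: P_def Q_def)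
    then show "A \<in> P \<inter> (\<lambda>A. A - {a}) ` Q" by blast
  next
    fix A assume A: "A \<in> P \<inter> (\<lambda>A. A - {a}) ` Q"
    then obtain B where B: "B \<in> \<F>" "a \<in> B" "A = B - {a}" by (auto simp: Q_def)
    then have "insert a A = B" by auto
    then show "A \<in> F2" using A B insert.prems by (auto simp: F2_def P_def)
  qed
  have finPQ: "finite P" "finite Q" using finF by (auto simp: P_def Q_def)
  have "card \<F> = card F1 + card F2"
    unfolding cF F1eq F2eq using finPQ card_image[OF injQ]
    by (metis card_Un_Int finite_imageI)
  also have "\<dots> \<le> card {J. J \<subseteq> S \<and> shatters F1 J} + card {J. J \<subseteq> S \<and> shatters F2 J}"
    using insert.IH[OF F1S] insert.IH[OF F2S] by simp
  also have "\<dots> = card {J. J \<subseteq> S \<and> shatters F1 J} + card (insert a ` {J. J \<subseteq> S \<and> shatters F2 J})"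
    using insert.hyps by (subst card_image) (auto simp: inj_on_def)
  also have "\<dots> = card ({J. J \<subseteq> S \<and> shatters F1 J} \<union> insert a ` {J. J \<subseteq> S \<and> shatters F2 J})"
    using insert.hyps by (subst card_Un_disjoint) auto
  also have "\<dots> \<le> card {J. J \<subseteq> insert a S \<and> shatters \<F> J}"
  proof (rule card_mono)
    show "finite {J. J \<subseteq> insert a S \<and> shatters \<F> J}" using insert.hyps by simp
    have 1: "shatters \<F> J" if J: "J \<subseteq> S" "shatters F1 J" for J
      unfolding shatters_def
    proof (intro allI impI)
      fix T assume "T \<subseteq> J"
      then obtain A where "A \<in> F1" "J \<inter> A = T" using J unfolding shatters_def by metis
      then obtain B where B: "B \<in> \<F>" "A = B - {a}" by (auto simp: F1_def)
      moreover have "J \<inter> B = T"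
        unfolding \<open>J \<inter> A = T\<close>[symmetric] B(2) using J(1) insert.hyps by blast
      ultimately show "\<exists>A\<in>\<F>. J \<inter> A = T" by blast
    qed
    have 2: "shatters \<F> (insert a J)" if J: "J \<subseteq> S" "shatters F2 J" for J
      unfolding shatters_def
    proof (intro allI impI)
      fix T assume T: "T \<subseteq> insert a J"
      then have "T - {a} \<subseteq> J" by auto
      then obtain A where A: "A \<in> F2" "J \<inter> A = T - {a}" using J unfolding shatters_def by metis
      have aA: "a \<notin> A" "a \<notin> J" using A J insert.hyps by (auto simp: F2_def)
      show "\<exists>A\<in>\<F>. insert a J \<inter> A = T"
      \<comment> \<open>Both \<open>A\<close> and \<open>insert a A\<close> lie in
        \<open>\<F>\<close>, so the membership of \<open>a\<close> can be prescribed freely.\<close>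
      proof (cases "a \<in> T")
        case True
        have "insert a J \<inter> insert a A = insert a (J \<inter> A)" by blast
        also have "\<dots> = T" using A(2) True by (simp add: insert_absorb)
        finally show ?thesis using A(1) unfolding F2_def by blast
      next
        case False
        have "insert a J \<inter> A = J \<inter> A" using aA by blast
        also have "\<dots> = T" using A(2) False by simp
        finally show ?thesis using A(1) unfolding F2_def by blast
      qed
    qed
    show "{J. J \<subseteq> S \<and> shatters F1 J} \<union> insert a ` {J. J \<subseteq> S \<and> shatters F2 J}
      \<subseteq> {J. J \<subseteq> insert a S \<and> shatters \<F> J}"
      using 1 2 by auto
  qed
  finally show ?case .
qed

lemma sauer_shelah:
  assumes S: "finite S" "\<F> \<subseteq> Pow S"
    and V: "\<And>J. J \<subseteq> S \<Longrightarrow> shatters \<F> J \<Longrightarrow> card J \<le> V"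
  shows "card \<F> \<le> (\<Sum>i\<le>V. card S choose i)"
proof -
  have "card \<F> \<le> card {J. J \<subseteq> S \<and> shatters \<F> J}" by (rule pajor[OF S])
  also have "\<dots> \<le> card (\<Union>i\<le>V. {J. J \<subseteq> S \<and> card J = i})"
    using V S by (intro card_mono) auto
  also have "\<dots> \<le> (\<Sum>i\<le>V. card {J. J \<subseteq> S \<and> card J = i})"
    by (rule card_UN_le) simp
  also have "\<dots> = (\<Sum>i\<le>V. card S choose i)" by (simp add: n_subsets[OF S(1)])
  finally show ?thesis .
qed

text \<open>Term by term against the binomial expansion of \<open>(N + 1) ^ m\<close>. Crude, but
  enough where only the logarithm of the count matters.\<close>

lemma sum_choose_le_pow: "(\<Sum>i\<le>m. N choose i) \<le> (N + 1) ^ m"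
proof -
  have "(\<Sum>i\<le>m. N choose i) \<le> (\<Sum>i\<le>m. (m choose i) * N ^ i * 1 ^ (m - i))"
  proof (rule sum_mono)
    fix i assume "i \<in> {..m}"
    then have m: "1 \<le> m choose i" by (simp add: Suc_leI)
    have "N choose i \<le> N ^ i"
      by (cases "i \<le> N") (auto simp: binomial_le_pow binomial_eq_0)
    also have "\<dots> \<le> (m choose i) * N ^ i" using m by simp
    finally show "N choose i \<le> (m choose i) * N ^ i * 1 ^ (m - i)" by simp
  qed
  also have "\<dots> = (N + 1) ^ m" using binomial[of N 1 m] by simp
  finally show ?thesis .
qed

text \<open>The complexity scale of the overview, with the same truncated logarithm as in
  \<open>pen\<close>, so that \<open>pen\<close> is \<open>vc_log\<close> times a factor common to
  all models (\<open>pen_eq\<close>). The truncation keeps it above \<open>V\<close> even when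
  \<open>V\<close> exceeds \<open>n\<close>.\<close>

definition vc_log :: "nat \<Rightarrow> nat \<Rightarrow> real" where
  "vc_log n V = real V * ln (max (exp 1) (real n / real V))"

lemma vc_log_ge: "real V \<le> vc_log n V"
proof -
  have "1 \<le> ln (max (exp 1) (real n / real V))"
    by (subst ln_ge_iff) (auto simp: less_max_iff_disj)
  then show ?thesis unfolding vc_log_def by (simp add: mult_le_cancel_left1)
qed

text \<open>\<open>N\<close> may be \<open>2 * n\<close> because the bound also serves the sample
  together with its ghost. For the terms that occur, the weight \<open>q ^ V\<close> is at most
  \<open>q ^ i\<close>, and the weighted sum is a binomial expansion bounded by
  \<open>exp (N * q)\<close>.\<close>

lemma sum_choose_le_vc_log:
  assumes V: "1 \<le> V" and n: "1 \<le> n" and N: "N \<le> 2 * n"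
  shows "real (\<Sum>i\<le>V. N choose i) \<le> exp (3 * vc_log n V)"
proof (cases "V \<le> 2 * n")
  case True
  \<comment> \<open>The weight is chosen such that \<open>N * q\<close> is at most
    \<open>V\<close>.\<close>
  define q where "q = real V / real (2 * n)"
  have q: "0 < q" "q \<le> 1" using V n True by (auto simp: q_def)
  have "real (\<Sum>i\<le>V. N choose i) * q ^ V = (\<Sum>i\<le>V. real (N choose i) * q ^ V)"
    by (simp add: sum_distrib_right)
  also have "\<dots> \<le> (\<Sum>i\<le>V. real (N choose i) * q ^ i)"
    using q by (intro sum_mono mult_left_mono power_decreasing) auto
  also have "\<dots> \<le> (\<Sum>i\<le>max V N. real (N choose i) * q ^ i)"
    using q by (intro sum_mono2) auto
  also have "\<dots> = (\<Sum>i\<le>N. real (N choose i) * q ^ i)"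
    by (intro sum.mono_neutral_right) (auto simp: binomial_eq_0)
  also have "\<dots> = (q + 1) ^ N" by (simp add: binomial_ring)
  also have "\<dots> \<le> exp q ^ N" using q exp_ge_add_one_self[of q]
    by (intro power_mono) (auto simp: add.commute)
  also have "\<dots> = exp (real N * q)" by (simp add: exp_of_nat_mult)
  also have "\<dots> \<le> exp (real V)"
  proof -
    have "real N * q \<le> real (2*n) * q" using N q by (intro mult_right_mono) auto
    also have "\<dots> = real V" using n by (simp add: q_def)
    finally show ?thesis by simp
  qed
  finally have "real (\<Sum>i\<le>V. N choose i) \<le> exp (real V) / q ^ V"
    using q by (simp add: field_simps)
  also have "\<dots> = exp (real V * (1 - ln q))"
  proof -
    have "q ^ V = exp (real V * ln q)" using q by (simp add: exp_of_nat_mult)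
    then show ?thesis by (simp add: exp_diff[symmetric] algebra_simps)
  qed
  also have "\<dots> \<le> exp (3 * vc_log n V)"
  proof -
    let ?l = "ln (max (exp 1) (real n / real V))"
    have l1: "1 \<le> ?l" by (subst ln_ge_iff) (auto simp: less_max_iff_disj)
    have "ln (real n / real V) \<le> ?l"
      using V n by (subst ln_le_cancel_iff) (auto simp: less_max_iff_disj)
    moreover have "ln q = ln (real V / real n) - ln 2"
      using V n by (simp add: q_def ln_div ln_mult)
    moreover have "ln (real V / real n) = - ln (real n / real V)"
      using V n by (simp add: ln_div)
    moreover have "ln (2::real) \<le> 1" using ln_le_minus_one[of "2::real"] by simp
    \<comment> \<open>The left side is the sum of 1, \<open>ln 2\<close> and
      \<open>ln (n / V)\<close>, each at most the truncated logarithm: the origin of the factor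
      3.\<close>
    ultimately have "1 - ln q \<le> 3 * ?l" using l1 by linarith
    then have "real V * (1 - ln q) \<le> real V * (3 * ?l)" by (intro mult_left_mono) auto
    then show ?thesis by (simp add: vc_log_def)
  qed
  finally show ?thesis .
next
  \<comment> \<open>For \<open>V > 2 * n\<close> all subsets may occur, and their number
    \<open>2 ^ N\<close> is already below \<open>exp V\<close>.\<close>
  case False
  have "(\<Sum>i\<le>V. N choose i) \<le> (\<Sum>i\<le>max V N. N choose i)" by (intro sum_mono2) auto
  also have "\<dots> = (\<Sum>i\<le>N. N choose i)"
    by (intro sum.mono_neutral_right) (auto simp: binomial_eq_0)
  also have "\<dots> = 2 ^ N" by (rule choose_row_sum)
  finally have "real (\<Sum>i\<le>V. N choose i) \<le> 2 ^ N" by (metis of_nat_le_iff of_nat_numeral of_nat_power)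
  also have "(2::real) ^ N \<le> exp 1 ^ N"
    using exp_ge_add_one_self[of "1::real"] by (intro power_mono) auto
  also have "\<dots> = exp (real N)" by (simp add: exp_of_nat_mult[symmetric])
  also have "\<dots> \<le> exp (3 * vc_log n V)" using vc_log_ge[of V n] N False by simp
  finally show ?thesis .
qed

section \<open>Upper bound for the VC dimension of the models\<close>

text \<open>Gaussian elimination, by induction on the set \<open>D\<close> of coordinates and for
  bare coefficient families, so that no vector space of dimension \<open>card D\<close> has to be
  set up.\<close>

lemma linear_dependence:
  fixes a :: "'i \<Rightarrow> 'j \<Rightarrow> real"
  assumes "finite D" "finite I" "card D < card I"
  shows "\<exists>l. (\<exists>i\<in>I. l i \<noteq> 0) \<and> (\<forall>j\<in>D. (\<Sum>i\<in>I. l i * a i j) = 0)"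
  using assms
proof (induction D arbitrary: I a rule: finite_induct)
  case empty
  then obtain i where "i \<in> I" by fastforce
  then show ?case by (intro exI[of _ "\<lambda>_. 1"]) auto
next
  case (insert j D)
  show ?case
  proof (cases "\<forall>i\<in>I. a i j = 0")
    case True
    obtain l where "\<exists>i\<in>I. l i \<noteq> 0" "\<forall>k\<in>D. (\<Sum>i\<in>I. l i * a i k) = 0"
      using insert.IH[of I a] insert.prems insert.hyps by auto
    then show ?thesis using True by (intro exI[of _ l]) (auto intro!: sum.neutral)
  next
    case False
    then obtain i0 where i0: "i0 \<in> I" "a i0 j \<noteq> 0" by blast
    define I' where "I' = I - {i0}"
    \<comment> \<open>Row \<open>i0\<close> is the pivot: subtracting a multiple of it makes
      coordinate \<open>j\<close> vanish in every other row.\<close>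
    define b where "b = (\<lambda>i k. a i k - a i j / a i0 j * a i0 k)"
    have "card D < card I'" "finite I'" using insert i0 by (auto simp: I'_def)
    then obtain l where l: "\<exists>i\<in>I'. l i \<noteq> 0" "\<forall>k\<in>D. (\<Sum>i\<in>I'. l i * b i k) = 0"
      using insert.IH[of I' b] by blast
    \<comment> \<open>The pivot receives the coefficient that turns a relation between the reduced
      rows into one between the original rows.\<close>
    define l' where "l' = (\<lambda>i. if i = i0 then - (\<Sum>i\<in>I'. l i * a i j / a i0 j) else l i)"
    have s: "(\<Sum>i\<in>I. l' i * a i k) = (\<Sum>i\<in>I'. l i * b i k)" for k
    proof -
      have "(\<Sum>i\<in>I. l' i * a i k) = l' i0 * a i0 k + (\<Sum>i\<in>I'. l' i * a i k)"
        using i0 insert.prems by (simp add: I'_def sum.remove)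
      also have "(\<Sum>i\<in>I'. l' i * a i k) = (\<Sum>i\<in>I'. l i * a i k)"
        by (intro sum.cong) (auto simp: l'_def I'_def)
      also have "l' i0 * a i0 k + \<dots> = (\<Sum>i\<in>I'. l i * b i k)"
        by (simp add: l'_def b_def sum_distrib_right right_diff_distrib sum_subtractf mult.assoc)
      finally show ?thesis .
    qed
    have "b i j = 0" for i using i0 by (simp add: b_def)
    then have "\<forall>k\<in>insert j D. (\<Sum>i\<in>I. l' i * a i k) = 0"
      using l(2) by (auto simp: s)
    moreover have "\<exists>i\<in>I. l' i \<noteq> 0" using l(1) by (auto simp: l'_def I'_def)
    ultimately show ?thesis by blast
  qed
qed

text \<open>A Radon-type argument. More points than coordinates are linearly dependent; a half-space
  containing exactly the points with nonpositive coefficient would make all terms of the relation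
  nonnegative and at least one positive, although they sum to zero.\<close>

lemma halfspaces_shatter_le:
  fixes a :: "'i \<Rightarrow> 'j \<Rightarrow> real"
  assumes D: "finite D" and J: "finite J"
    and sh: "shatters (range (\<lambda>d. {i\<in>S. (\<Sum>j\<in>D. a i j * d j) \<le> 0})) J"
  shows "card J \<le> card D"
proof (rule ccontr)
  assume "\<not> card J \<le> card D"
  then obtain l where l: "\<exists>i\<in>J. l i \<noteq> 0" "\<forall>j\<in>D. (\<Sum>i\<in>J. l i * a i j) = 0"
    using linear_dependence[OF D J, of a] by auto
  \<comment> \<open>A positive coefficient is needed, since the linear form has a strict sign only
    outside the closed half-space.\<close>
  have pos: False if l: "\<exists>i\<in>J. l i > 0" "\<forall>j\<in>D. (\<Sum>i\<in>J. l i * a i j) = 0" for l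
  proof -
    have JS: "J \<subseteq> S" using sh unfolding shatters_def by blast
    from sh have "\<exists>A\<in>range (\<lambda>d. {i\<in>S. (\<Sum>j\<in>D. a i j * d j) \<le> 0}). J \<inter> A = {i\<in>J. l i \<le> 0}"
      unfolding shatters_def by (elim allE[of _ "{i\<in>J. l i \<le> 0}"]) auto
    then obtain d where d: "J \<inter> {i\<in>S. (\<Sum>j\<in>D. a i j * d j) \<le> 0} = {i\<in>J. l i \<le> 0}" by blast
    then have d': "(\<Sum>j\<in>D. a i j * d j) \<le> 0 \<longleftrightarrow> l i \<le> 0" if "i \<in> J" for i
      using that JS unfolding set_eq_iff by blast
    have "(\<Sum>i\<in>J. l i * (\<Sum>j\<in>D. a i j * d j)) = (\<Sum>j\<in>D. (\<Sum>i\<in>J. l i * a i j) * d j)"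
      by (simp add: sum_distrib_left sum_distrib_right mult.assoc) (rule sum.swap)
    also have "\<dots> = 0" using l by simp
    finally have 0: "(\<Sum>i\<in>J. l i * (\<Sum>j\<in>D. a i j * d j)) = 0" .
    have nn: "0 \<le> l i * (\<Sum>j\<in>D. a i j * d j)" if "i \<in> J" for i
    proof (cases "l i \<le> 0")
      case True
      then show ?thesis using d'[OF that] by (simp only: mult_nonpos_nonpos)
    next
      case False
      then have "\<not> (\<Sum>j\<in>D. a i j * d j) \<le> 0" using d'[OF that] by blast
      then show ?thesis using False by (intro mult_nonneg_nonneg) linarith+
    qed
    obtain i where i: "i \<in> J" "l i > 0" using l by blast
    then have "0 < l i * (\<Sum>j\<in>D. a i j * d j)" using d'[OF i(1)] by (intro mult_pos_pos) linarith+
    moreover have "l i * (\<Sum>j\<in>D. a i j * d j) = 0"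
      by (rule sum_nonneg_0[OF J nn 0 i(1)])
    ultimately show False by simp
  qed
  show False
  proof (cases "\<exists>i\<in>J. l i > 0")
    case True then show False using pos l by blast
  next
    \<comment> \<open>All coefficients are nonpositive and one is nonzero, so the negated relation
      has a positive one.\<close>
    case False
    then have "\<exists>i\<in>J. - l i > 0" using l(1) by force
    moreover have "\<forall>j\<in>D. (\<Sum>i\<in>J. - l i * a i j) = 0" using l(2) by (simp add: sum_negf)
    ultimately show False using pos[of "\<lambda>i. - l i"] by blast
  qed
qed

lemma dot_support:
  "D = {j. j < p \<and> d j \<noteq> 0} \<Longrightarrow> dot p x d = (\<Sum>j\<in>D. x j * d j)"
  unfolding dot_def by (intro sum.mono_neutral_right) auto

text \<open>Sparse normals form a union over their supports, of which there are at most
  \<open>(p + 1) ^ m\<close>; with the support fixed, the half-spaces live in dimension at most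
  \<open>m\<close> and Sauer's lemma applies.\<close>

lemma card_sparse_halfspaces_le:
  assumes S: "finite S"
  shows "card ((\<lambda>d. {z\<in>S. dot p (a z) d \<le> 0}) ` {d. l0norm p d \<le> m})
    \<le> (p + 1) ^ m * (card S + 1) ^ m" (is "card ?H \<le> _")
proof -
  define DD where "DD = {D. D \<subseteq> {..<p} \<and> card D \<le> m}"
  define HD where "HD = (\<lambda>D. range (\<lambda>d. {z\<in>S. (\<Sum>j\<in>D. a z j * d j) \<le> (0::real)}))"
  have finDD: "finite DD" unfolding DD_def by simp
  have finHD: "finite (HD D)" for D
    by (rule finite_subset[of _ "Pow S"]) (use S in \<open>auto simp: HD_def\<close>)
  have "?H \<subseteq> (\<Union>D\<in>DD. HD D)"
  proof
    fix h assume "h \<in> ?H"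
    then obtain d where d: "l0norm p d \<le> m" "h = {z\<in>S. dot p (a z) d \<le> 0}" by auto
    define D where "D = {j. j < p \<and> d j \<noteq> 0}"
    have "h = {z\<in>S. (\<Sum>j\<in>D. a z j * d j) \<le> 0}" using d dot_support[OF D_def] by simp
    moreover have "D \<in> DD" using d(1) by (auto simp: DD_def D_def l0norm_def)
    ultimately show "h \<in> (\<Union>D\<in>DD. HD D)" by (auto simp: HD_def)
  qed
  then have "card ?H \<le> card (\<Union>D\<in>DD. HD D)" using finDD finHD by (intro card_mono) auto
  also have "\<dots> \<le> (\<Sum>D\<in>DD. card (HD D))" by (rule card_UN_le[OF finDD])
  also have "\<dots> \<le> (\<Sum>D\<in>DD. (card S + 1) ^ m)"
  proof (rule sum_mono)
    fix D assume D: "D \<in> DD"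
    then have fD: "finite D" by (auto simp: DD_def finite_subset)
    have "card (HD D) \<le> (\<Sum>i\<le>m. card S choose i)"
    proof (rule sauer_shelah[OF S])
      show "HD D \<subseteq> Pow S" by (auto simp: HD_def)
      fix J assume "J \<subseteq> S" "shatters (HD D) J"
      then have "card J \<le> card D"
        using halfspaces_shatter_le[OF fD, of J S a] S finite_subset by (auto simp: HD_def)
      then show "card J \<le> m" using D by (simp add: DD_def)
    qed
    also have "\<dots> \<le> (card S + 1) ^ m" by (rule sum_choose_le_pow)
    finally show "card (HD D) \<le> (card S + 1) ^ m" .
  qed
  also have "\<dots> = card DD * (card S + 1) ^ m" by simp
  also have "card DD \<le> (p + 1) ^ m"
  proof -
    have "card DD \<le> card (\<Union>i\<le>m. {D. D \<subseteq> {..<p} \<and> card D = i})"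
      by (intro card_mono) (auto simp: DD_def)
    also have "\<dots> \<le> (\<Sum>i\<le>m. card {D. D \<subseteq> {..<p} \<and> card D = i})" by (rule card_UN_le) simp
    also have "\<dots> = (\<Sum>i\<le>m. p choose i)" by (simp add: n_subsets)
    also have "\<dots> \<le> (p + 1) ^ m" by (rule sum_choose_le_pow)
    finally show ?thesis .
  qed
  finally show ?thesis by simp
qed

text \<open>The sets are nested, hence distinguished by their cardinalities.\<close>

lemma card_thresholds_le:
  fixes g :: "'b \<Rightarrow> real"
  assumes S: "finite S"
  shows "card (range (\<lambda>t. {z\<in>S. g z < t})) \<le> card S + 1"
proof -
  let ?T = "range (\<lambda>t. {z\<in>S. g z < t})"
  have "inj_on card ?T"
  proof (rule inj_onI)
    fix A B assume AB: "A \<in> ?T" "B \<in> ?T" "card A = card B"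
    then obtain s t where st: "A = {z\<in>S. g z < s}" "B = {z\<in>S. g z < t}" by auto
    have fin: "finite A" "finite B" using S st by auto
    have "A \<subseteq> B \<or> B \<subseteq> A" unfolding st by (cases "s \<le> t") auto
    then show "A = B" using AB(3) fin card_subset_eq by metis
  qed
  then have "card ?T = card (card ` ?T)" by (simp add: card_image)
  also have "\<dots> \<le> card {..card S}" by (intro card_mono) (auto intro!: card_mono S)
  finally show ?thesis by simp
qed

text \<open>Tangent line of the logarithm at \<open>a\<close>. A large \<open>a\<close> gives a
  small slope, so that the logarithm of an unknown can be absorbed on the other side of an
  inequality.\<close>

lemma ln_le_linear: "0 < a \<Longrightarrow> 0 < y \<Longrightarrow> ln y \<le> y / a + ln a - (1::real)"
  using ln_le_minus_one[of "y / a"] by (simp add: ln_div)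

text \<open>On a finite set the subgraph of a step function is assembled from two threshold sets,
  one for each level, and one sparse half-space. Shattering therefore forces
  \<open>2 ^ card S\<close> below a polynomial in \<open>card S\<close>, and logarithms solve for
  \<open>card S\<close>.\<close>

lemma subgraph_shatter_card_le:
  assumes S: "finite S" and sh: "shatters (subgraph_on B ` F_class p \<Omega> m) S"
    and m: "1 \<le> m" "m \<le> p" and p: "3 \<le> p"
  shows "real (card S) \<le> 40 * real m * ln (real p)"
proof -
  let ?N = "card S"
  define TT where "TT = range (\<lambda>t. {z\<in>S. snd z < (t::real)})"
  define HH where "HH = (\<lambda>d. {z\<in>S. dot p (fst z) d \<le> 0}) ` {d. l0norm p d \<le> m}"
  have finT: "finite TT" and finH: "finite HH"
    using S by (auto simp: TT_def HH_def intro: finite_subset[of _ "Pow S"])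
  define g where "g = (\<lambda>(A, B, H). (A \<inter> H) \<union> (B - H :: ((nat \<Rightarrow> real) \<times> real) set))"
  have "Pow S \<subseteq> g ` (TT \<times> TT \<times> HH)"
  proof
    fix T assume "T \<in> Pow S"
    then have "T \<subseteq> S" by simp
    then obtain A where A: "A \<in> subgraph_on B ` F_class p \<Omega> m" "S \<inter> A = T"
      using sh unfolding shatters_def by blast
    then obtain \<alpha> \<beta> d where d: "l0norm p d \<le> m" "A = subgraph_on B (f_theta p (\<alpha>, \<beta>, d))"
      by (auto simp: F_class_def Theta_def)
    \<comment> \<open>The subset \<open>S\<close> itself must be cut out as well, and subgraphs live
      over \<open>B\<close>.\<close>
    have "S \<subseteq> B \<times> UNIV"
    proof -
      obtain A' where "A' \<in> subgraph_on B ` F_class p \<Omega> m" "S \<inter> A' = S"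
        using sh unfolding shatters_def by blast
      then show ?thesis by (auto simp: subgraph_on_def)
    qed
    then have "T = g ({z\<in>S. snd z < \<alpha>}, {z\<in>S. snd z < \<beta>}, {z\<in>S. dot p (fst z) d \<le> 0})"
      unfolding A(2)[symmetric] d(2) g_def
      by (auto simp: subgraph_on_def f_theta_def of_bool_def not_le split: if_splits)
    then show "T \<in> g ` (TT \<times> TT \<times> HH)" using d(1) unfolding TT_def HH_def by blast
  qed
  then have "card (Pow S) \<le> card (TT \<times> TT \<times> HH)"
    using finT finH by (intro surj_card_le) auto
  also have "\<dots> = card TT * (card TT * card HH)" by (simp add: card_cartesian_product)
  also have "\<dots> \<le> (?N + 1) * ((?N + 1) * ((p + 1) ^ m * (?N + 1) ^ m))"
    unfolding TT_def HH_def
    by (intro mult_mono card_thresholds_le card_sparse_halfspaces_le S) auto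
  finally have "2 ^ ?N \<le> (?N + 1) ^ (m + 2) * (p + 1) ^ m"
    using S by (simp add: card_Pow power_add power2_eq_square algebra_simps)
  then have "(2::real) ^ ?N \<le> (real ?N + 1) ^ (m + 2) * (real p + 1) ^ m"
    unfolding of_nat_le_iff[where 'a = real, symmetric] by (simp del: power_Suc power_add_numeral2 add_2_eq_Suc' add: add.commute)
  then have "ln ((2::real) ^ ?N) \<le> ln ((real ?N + 1) ^ (m + 2) * (real p + 1) ^ m)"
    by (subst ln_le_cancel_iff) auto
  also have "\<dots> = real (m + 2) * ln (real ?N + 1) + real m * ln (real p + 1)"
    by (subst ln_mult) (auto simp: ln_realpow simp del: power_Suc power_add_numeral2 add_2_eq_Suc')
  finally have 1: "real ?N * ln 2 \<le> real (m + 2) * ln (real ?N + 1) + real m * ln (real p + 1)"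
    by (simp add: ln_realpow)
  have lnp: "1 \<le> ln (real p)"
    using p exp_le by (subst ln_ge_iff) auto
  have l2: "ln (real p + 1) \<le> 2 * ln (real p)"
  proof -
    have "3 * real p \<le> real p * real p" using p by (intro mult_right_mono) auto
    moreover have "3 \<le> real p" using p by simp
    ultimately have "real p + 1 \<le> real p ^ 2" unfolding power2_eq_square by linarith
    then have "ln (real p + 1) \<le> ln (real p ^ 2)" using p by (subst ln_le_cancel_iff) auto
    then show ?thesis using p by (simp add: ln_realpow)
  qed
  \<comment> \<open>With tangent point \<open>12 * m\<close> the slope \<open>1 / (12 * m)\<close>
    times the prefactor \<open>3 * m\<close> is 1/4. Since \<open>ln 2\<close> is at least 2/3, a
    multiple 5/12 of \<open>card S\<close> remains on the left.\<close>
  have m': "0 < 12 * real m" using m by simp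
  have l3: "ln (real ?N + 1) \<le> (real ?N + 1) / (12 * real m) + ln (12 * real m) - 1"
    using ln_le_linear[OF m', of "real ?N + 1"] by simp
  have l4: "ln (12 * real m) \<le> 2 + 1 + ln (real p)"
  proof -
    have "ln (12 * real m) = ln 12 + ln (real m)" using m by (simp add: ln_mult)
    moreover have "ln (real m) \<le> ln (real p)" using m by simp
    moreover have "ln (12::real) \<le> 3"
    proof -
      have "(12::real) \<le> (5/2)^3" by (simp add: power3_eq_cube)
      also have "\<dots> \<le> exp 1 ^ 3"
        using e_approx_32 by (intro power_mono) (auto simp: abs_if split: if_splits)
      also have "\<dots> = exp 3" by (simp add: exp_of_nat_mult[symmetric])
      finally have "ln (12::real) \<le> ln (exp 3)" by (subst ln_le_cancel_iff) auto
      then show ?thesis by simp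
    qed
    ultimately show ?thesis by simp
  qed
  have "real (m + 2) * ln (real ?N + 1) \<le> 3 * real m * ln (real ?N + 1)"
    using m by (intro mult_right_mono) auto
  also have "\<dots> \<le> 3 * real m * ((real ?N + 1) / (12 * real m) + 2 + ln (real p))"
    using l3 l4 by (intro mult_left_mono) auto
  also have "\<dots> = (real ?N + 1) / 4 + 6 * real m + 3 * (real m * ln (real p))"
    using m by (simp add: field_simps)
  finally have 2: "real (m + 2) * ln (real ?N + 1) \<le> (real ?N + 1) / 4 + 6 * real m + 3 * (real m * ln (real p))" .
  have 3: "real m * ln (real p + 1) \<le> 2 * (real m * ln (real p))"
    using mult_left_mono[OF l2, of "real m"] by simp
  have mm: "real m * 1 \<le> real m * ln (real p)" using lnp by (intro mult_left_mono) auto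
  have "(2::real)/3 \<le> ln 2" using ln2_ge_two_thirds by simp
  then have "real ?N * (2/3) \<le> real ?N * ln 2" by (intro mult_left_mono) auto
  moreover have "real ?N * (2/3) - real ?N / 4 = real ?N * (5/12)" by simp
  moreover have "1 \<le> real m" using m by simp
  ultimately have "real ?N * (5/12) \<le> 1/4 + 6 * real m + 5 * (real m * ln (real p))"
    using order_trans[OF 1 add_mono[OF 2 3]] by argo
  then show ?thesis using mm \<open>1 \<le> real m\<close> by linarith
qed

text \<open>\<open>vc_dim\<close> is a supremum of natural numbers, which dominates its elements
  only if they are bounded; the preceding estimate provides the bound.\<close>

lemma V_model_ge_card:
  assumes "finite S" "shatters (subgraph_on (space (Rn p)) ` F_class p \<Omega> m) S"
    and "1 \<le> m" "m \<le> p" "3 \<le> p"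
  shows "card S \<le> V_model p \<Omega> m"
  unfolding V_model_def VC_class_def vc_dim_def
proof (rule cSup_upper)
  show "card S \<in> {card S |S. finite S \<and> shatters (subgraph_on (space (Rn p)) ` F_class p \<Omega> m) S}"
    using assms by blast
  show "bdd_above {card S |S. finite S \<and> shatters (subgraph_on (space (Rn p)) ` F_class p \<Omega> m) S}"
  proof (rule bdd_aboveI[of _ "nat \<lfloor>40 * real m * ln (real p)\<rfloor>"])
    fix x assume "x \<in> {card S |S. finite S \<and> shatters (subgraph_on (space (Rn p)) ` F_class p \<Omega> m) S}"
    then show "x \<le> nat \<lfloor>40 * real m * ln (real p)\<rfloor>"
      using subgraph_shatter_card_le[OF _ _ assms(3-5)] by (auto intro!: le_nat_floor)
  qed
qed

lemma real_nat_Sup_le: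
  fixes A :: "nat set"
  assumes "A \<noteq> {}" "\<And>x. x \<in> A \<Longrightarrow> real x \<le> c"
  shows "real (Sup A) \<le> c"
proof -
  have "\<forall>x\<in>A. x \<le> nat \<lfloor>c\<rfloor>" using assms(2) by (simp add: le_nat_floor)
  then have "finite A" by (meson finite_nat_set_iff_bounded_le)
  then show ?thesis using assms Max_in[of A] by (simp add: Sup_nat_def)
qed

lemma V_model_le:
  assumes "Theta p \<Omega> m \<noteq> {}" "1 \<le> m" "m \<le> p" "3 \<le> p"
  shows "real (V_model p \<Omega> m) \<le> 40 * real m * ln (real p)"
proof -
  let ?C = "subgraph_on (space (Rn p)) ` F_class p \<Omega> m"
  \<comment> \<open>With no parameter at all not even the empty set would be shattered, and the
    supremum would range over nothing.\<close>
  have ne: "?C \<noteq> {}" using assms(1) by (simp add: F_class_def)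
  then have "shatters ?C {}" by (auto simp: shatters_def)
  then have "0 \<in> {card S |S. finite S \<and> shatters ?C S}" by (metis (mono_tags, lifting) card.empty finite.emptyI mem_Collect_eq)
  then have ne': "{card S |S. finite S \<and> shatters ?C S} \<noteq> {}" by blast
  show ?thesis
    using subgraph_shatter_card_le[OF _ _ assms(2-4)] ne'
    unfolding V_model_def VC_class_def vc_dim_def
    by (intro real_nat_Sup_le) auto
qed

section \<open>Patterns of sparse unit directions and their relation to the VC dimension\<close>

definition sparse_dirs :: "nat \<Rightarrow> nat \<Rightarrow> (nat \<Rightarrow> real) set" where
  "sparse_dirs p m = {d \<in> usphere p. l0norm p d \<le> m}"

text \<open>The number of points is a parameter because patterns are taken both on the
  \<open>n\<close> observations and on \<open>2 * n\<close> points including the ghost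
  sample.\<close>

definition hs_pattern :: "nat \<Rightarrow> nat \<Rightarrow> (nat \<Rightarrow> nat \<Rightarrow> real) \<Rightarrow> (nat \<Rightarrow> real) \<Rightarrow> nat set" where
  "hs_pattern N p x d = {i\<in>{..<N}. dot p (x i) d \<le> 0}"

text \<open>Patterns of half-spaces are no richer than subgraphs: at height \<open>\<beta>0\<close>
  a point lies strictly under the step function with levels \<open>\<alpha>0 > \<beta>0\<close>
  exactly on its negative side. A shattered index set thus gives a shattered set of points at that
  height, and \<open>V_model\<close> bounds the VC dimension of the patterns.\<close>

lemma card_hs_patterns_le:
  assumes ab: "(\<alpha>0, \<beta>0) \<in> \<Omega>" "\<beta>0 < \<alpha>0" and m: "1 \<le> m" "m \<le> p" and p: "3 \<le> p"
    and x: "\<And>i. i < N \<Longrightarrow> x i \<in> space (Rn p)" and n: "1 \<le> n" "N \<le> 2 * n"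
    and V: "1 \<le> V_model p \<Omega> m"
  shows "real (card (hs_pattern N p x ` sparse_dirs p m)) \<le> exp (3 * vc_log n (V_model p \<Omega> m))"
proof -
  let ?F = "hs_pattern N p x ` sparse_dirs p m"
  have "card ?F \<le> (\<Sum>i\<le>V_model p \<Omega> m. card {..<N} choose i)"
  proof (rule sauer_shelah)
    show "?F \<subseteq> Pow {..<N}" by (auto simp: hs_pattern_def)
    fix J assume J: "J \<subseteq> {..<N}" "shatters ?F J"
    have fJ: "finite J" using J(1) finite_subset by blast
    define z where "z = (\<lambda>j. (x j, \<beta>0))"
    have sub: "z j \<in> subgraph_on (space (Rn p)) (f_theta p (\<alpha>0, \<beta>0, d)) \<longleftrightarrow> j \<in> hs_pattern N p x d"
      if "j \<in> J" for j d
      using that J(1) x ab by (auto simp: z_def subgraph_on_def f_theta_def hs_pattern_def of_bool_def)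
    have ex: "\<exists>d\<in>sparse_dirs p m. \<forall>j\<in>J. j \<in> hs_pattern N p x d \<longleftrightarrow> j \<in> T" if T: "T \<subseteq> J" for T
    proof -
      obtain A where "A \<in> ?F" "J \<inter> A = T" using J(2) T unfolding shatters_def by metis
      then obtain d where "d \<in> sparse_dirs p m" "J \<inter> hs_pattern N p x d = T" by blast
      then show ?thesis by blast
    qed
    \<comment> \<open>Coinciding sample points could not be separated, so shattered indices carry
      distinct points and the cardinality survives the transfer.\<close>
    have inj: "inj_on z J"
    proof (rule inj_onI)
      fix i j assume ij: "i \<in> J" "j \<in> J" "z i = z j"
      obtain d where "\<forall>k\<in>J. k \<in> hs_pattern N p x d \<longleftrightarrow> k \<in> {i}"
        using ex[of "{i}"] ij by blast
      then show "i = j" using sub[OF ij(1), of d] sub[OF ij(2), of d] ij by (metis singletonD singletonI)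
    qed
    have "shatters (subgraph_on (space (Rn p)) ` F_class p \<Omega> m) (z ` J)"
      unfolding shatters_def
    proof (intro allI impI)
      fix T assume T: "T \<subseteq> z ` J"
      obtain d where d: "d \<in> sparse_dirs p m"
          "\<forall>j\<in>J. j \<in> hs_pattern N p x d \<longleftrightarrow> j \<in> {j\<in>J. z j \<in> T}"
        using ex[of "{j\<in>J. z j \<in> T}"] by blast
      have "f_theta p (\<alpha>0, \<beta>0, d) \<in> F_class p \<Omega> m"
        using d(1) ab(1) unfolding F_class_def Theta_def sparse_dirs_def by blast
      moreover have "z ` J \<inter> subgraph_on (space (Rn p)) (f_theta p (\<alpha>0, \<beta>0, d)) = T"
      proof
        show "z ` J \<inter> subgraph_on (space (Rn p)) (f_theta p (\<alpha>0, \<beta>0, d)) \<subseteq> T"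
          using sub[of _ d] d(2) by blast
        show "T \<subseteq> z ` J \<inter> subgraph_on (space (Rn p)) (f_theta p (\<alpha>0, \<beta>0, d))"
          using sub[of _ d] d(2) T by blast
      qed
      ultimately show "\<exists>A\<in>subgraph_on (space (Rn p)) ` F_class p \<Omega> m. z ` J \<inter> A = T" by blast
    qed
    then have "card (z ` J) \<le> V_model p \<Omega> m"
      using fJ m p by (intro V_model_ge_card) auto
    then show "card J \<le> V_model p \<Omega> m" by (simp add: card_image[OF inj])
  qed simp
  then have "real (card ?F) \<le> real (\<Sum>i\<le>V_model p \<Omega> m. N choose i)"
    unfolding of_nat_le_iff by simp
  also have "\<dots> \<le> exp (3 * vc_log n (V_model p \<Omega> m))"
    by (rule sum_choose_le_vc_log[OF V n])
  finally show ?thesis .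
qed

text \<open>The \<open>p\<close> coordinate directions alone realise all patterns on \<open>log\<^sub>2 p\<close> suitable points.\<close>

lemma V_model_lower:
  assumes ab: "(\<alpha>0, \<beta>0) \<in> \<Omega>" "\<beta>0 < \<alpha>0" and m: "1 \<le> m" "m \<le> p" and p: "3 \<le> p"
    and N: "2 ^ N \<le> p"
  shows "N \<le> V_model p \<Omega> m"
proof -
  \<comment> \<open>The first \<open>2 ^ N\<close> coordinates are labelled by the subsets of the
    \<open>N\<close> points. Point \<open>i\<close> has the entry -1 in the coordinates whose label
    contains \<open>i\<close>, so the unit vector \<open>e j\<close> cuts out
    \<open>g j\<close>.\<close>
  obtain g where g: "bij_betw g {..<2 ^ N :: nat} (Pow {..<N})"
    using finite_same_card_bij[of "{..<2 ^ N :: nat}" "Pow {..<N}"] by (auto simp: card_Pow)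
  define x where "x = (\<lambda>i. \<lambda>j\<in>{..<p}. if j < 2 ^ N \<and> i \<in> g j then -1 else (1::real))"
  define e where "e = (\<lambda>j. \<lambda>j'\<in>{..<p}. if j' = j then 1 else (0::real))"
  have xs: "x i \<in> space (Rn p)" for i by (simp add: x_def Rn_def space_PiM)
  have dot_e: "dot p y (e j) = y j" if "j < p" for y j
  proof -
    have "dot p y (e j) = (\<Sum>j'<p. if j' = j then y j' else 0)"
      unfolding dot_def by (intro sum.cong) (auto simp: e_def)
    also have "\<dots> = y j" using that by (simp add: sum.delta)
    finally show ?thesis .
  qed
  have e_sparse: "e j \<in> usphere p" "l0norm p (e j) \<le> m" if "j < p" for j
  proof -
    have "L2_set (e j) {..<p} = sqrt (\<Sum>j'<p. if j' = j then 1 else 0)"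
      unfolding L2_set_def by (intro arg_cong[where f = sqrt] sum.cong) (auto simp: e_def)
    also have "\<dots> = 1" using that by (simp add: sum.delta)
    finally show "e j \<in> usphere p" by (simp add: usphere_def e_def Rn_def space_PiM)
    have "{j'. j' < p \<and> e j j' \<noteq> 0} = {j}" using that by (auto simp: e_def)
    then show "l0norm p (e j) \<le> m" using m by (simp add: l0norm_def)
  qed
  define z where "z = (\<lambda>i. (x i, \<beta>0))"
  have sub: "z i \<in> subgraph_on (space (Rn p)) (f_theta p (\<alpha>0, \<beta>0, e j)) \<longleftrightarrow> i \<in> g j"
    if "j < 2 ^ N" for i j
    using that xs ab N dot_e[of j] by (auto simp: z_def subgraph_on_def f_theta_def of_bool_def x_def)
  have surj: "\<exists>j<2^N. g j = T" if "T \<subseteq> {..<N}" for T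
    using g that unfolding bij_betw_def by (metis PowI imageE lessThan_iff)
  have inj: "inj_on z {..<N}"
  proof (rule inj_onI)
    fix i j assume ij: "i \<in> {..<N}" "j \<in> {..<N}" "z i = z j"
    obtain k where "k < 2 ^ N" "g k = {i}" using surj[of "{i}"] ij by auto
    then show "i = j" using sub[of k i] sub[of k j] ij(3) by (metis singletonD singletonI)
  qed
  have "shatters (subgraph_on (space (Rn p)) ` F_class p \<Omega> m) (z ` {..<N})"
    unfolding shatters_def
  proof (intro allI impI)
    fix T assume T: "T \<subseteq> z ` {..<N}"
    obtain j where j: "j < 2 ^ N" "g j = {i\<in>{..<N}. z i \<in> T}"
      using surj[of "{i\<in>{..<N}. z i \<in> T}"] by auto
    have "f_theta p (\<alpha>0, \<beta>0, e j) \<in> F_class p \<Omega> m"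
      using e_sparse[of j] j N ab(1) unfolding F_class_def Theta_def by auto
    moreover have "z ` {..<N} \<inter> subgraph_on (space (Rn p)) (f_theta p (\<alpha>0, \<beta>0, e j)) = T"
    proof
      show "z ` {..<N} \<inter> subgraph_on (space (Rn p)) (f_theta p (\<alpha>0, \<beta>0, e j)) \<subseteq> T"
        using sub[OF j(1)] j(2) by blast
      show "T \<subseteq> z ` {..<N} \<inter> subgraph_on (space (Rn p)) (f_theta p (\<alpha>0, \<beta>0, e j))"
        using sub[OF j(1)] j(2) T by blast
    qed
    ultimately show "\<exists>A\<in>subgraph_on (space (Rn p)) ` F_class p \<Omega> m. z ` {..<N} \<inter> A = T" by blast
  qed
  then have "card (z ` {..<N}) \<le> V_model p \<Omega> m"
    using m p by (intro V_model_ge_card) auto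
  then show ?thesis by (simp add: card_image[OF inj])
qed

text \<open>This makes the union over the \<open>p\<close> models free: a failure probability of
  order \<open>exp (- 2 * V)\<close> in each model is already of order
  \<open>1 / p ^ 2\<close>.\<close>

lemma le_exp_V_model:
  assumes ab: "(\<alpha>0, \<beta>0) \<in> \<Omega>" "\<beta>0 < \<alpha>0" and m: "1 \<le> m" "m \<le> p" and p: "3 \<le> p"
  shows "1 \<le> V_model p \<Omega> m" "real p \<le> 2 * exp (real (V_model p \<Omega> m))"
proof -
  note low = V_model_lower[OF ab m p]
  show "1 \<le> V_model p \<Omega> m" using low[of 1] p by simp
  have "\<not> 2 ^ (Suc (V_model p \<Omega> m)) \<le> p" using low[of "Suc (V_model p \<Omega> m)"] by auto
  then have "p \<le> 2 * 2 ^ V_model p \<Omega> m" by simp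
  then have "real p \<le> 2 * 2 ^ V_model p \<Omega> m"
    unfolding of_nat_le_iff[where 'a = real, symmetric] by simp
  also have "(2::real) ^ V_model p \<Omega> m \<le> exp 1 ^ V_model p \<Omega> m"
    using exp_ge_add_one_self[of "1::real"] by (intro power_mono) auto
  also have "exp 1 ^ V_model p \<Omega> m = exp (real (V_model p \<Omega> m))"
    by (simp add: exp_of_nat_mult[symmetric])
  finally show "real p \<le> 2 * exp (real (V_model p \<Omega> m))" by simp
qed

section \<open>Measurability of the event that a pattern is realised\<close>

text \<open>A convergent sequence in the projection lifts to pairs whose first components have a
  convergent subsequence in \<open>K\<close>. An uncountable union over directions thereby becomes a
  closed, hence Borel, set.\<close>

lemma closed_projection_along_compact:
  fixes K :: "'a::metric_space set" and T :: "('a \<times> 'b::metric_space) set"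
  assumes "compact K" "closed T"
  shows "closed {y. \<exists>x\<in>K. (x, y) \<in> T}"
  unfolding closed_sequential_limits
proof (intro allI impI)
  fix y l assume y: "(\<forall>n. y n \<in> {y. \<exists>x\<in>K. (x, y) \<in> T}) \<and> y \<longlonglongrightarrow> l"
  then obtain x where x: "\<And>n. x n \<in> K" "\<And>n. (x n, y n) \<in> T" by (simp add: Bex_def) metis
  obtain a r where a: "a \<in> K" "strict_mono r" "(x \<circ> r) \<longlonglongrightarrow> a"
    using assms(1) x(1) unfolding compact_def by metis
  have "(y \<circ> r) \<longlonglongrightarrow> l" using y a(2) LIMSEQ_subseq_LIMSEQ by blast
  then have "(\<lambda>k. ((x \<circ> r) k, (y \<circ> r) k)) \<longlonglongrightarrow> (a, l)" using a(3) by (intro tendsto_Pair)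
  then have "(a, l) \<in> T"
    using assms(2) x(2) unfolding closed_sequential_limits
    by (elim allE[of _ "\<lambda>k. ((x \<circ> r) k, (y \<circ> r) k)"] allE[of _ "(a, l)"]) auto
  then show "l \<in> {y. \<exists>x\<in>K. (x, y) \<in> T}" using a(1) by blast
qed

lemma compact_coordinate_sphere:
  assumes D: "D \<subseteq> {..<p}"
  shows "compact {d :: nat \<Rightarrow> real. (\<forall>j. j \<notin> D \<longrightarrow> d j = 0) \<and> (\<Sum>j<p. (d j)\<^sup>2) = 1}" (is "compact ?K")
proof -
  \<comment> \<open>Vectors are functions on all of \<open>nat\<close> with the product topology, so
    compactness comes from Tychonoff's theorem for a cube, of which the sphere is a closed
    part.\<close>
  let ?B = "PiE UNIV (\<lambda>_::nat. {-1..1::real})"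
  have B: "compact ?B"
    using compactin_PiE[of "\<lambda>_. euclidean" UNIV "\<lambda>_::nat. {-1..1::real}"]
    by (simp add: euclidean_product_topology)
  have c: "continuous_on UNIV (\<lambda>d::nat \<Rightarrow> real. d j)" for j by simp
  have "closed ({d :: nat \<Rightarrow> real. \<forall>j. j \<notin> D \<longrightarrow> d j = 0} \<inter> {d. (\<Sum>j<p. (d j)\<^sup>2) = 1})"
    by (intro closed_Int closed_Collect_all closed_Collect_imp closed_Collect_eq open_Collect_const
        continuous_intros c)
  then have "compact (?B \<inter> ({d :: nat \<Rightarrow> real. \<forall>j. j \<notin> D \<longrightarrow> d j = 0} \<inter> {d. (\<Sum>j<p. (d j)\<^sup>2) = 1}))"
    by (rule compact_Int_closed[OF B])
  also have "?B \<inter> ({d :: nat \<Rightarrow> real. \<forall>j. j \<notin> D \<longrightarrow> d j = 0} \<inter> {d. (\<Sum>j<p. (d j)\<^sup>2) = 1}) = ?K"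
  proof -
    have "\<bar>d j\<bar> \<le> 1" if d: "\<forall>j. j \<notin> D \<longrightarrow> d j = 0" "(\<Sum>j<p. (d j)\<^sup>2) = 1" for d :: "nat \<Rightarrow> real" and j
    proof (cases "j \<in> D")
      case True
      then have "(d j)\<^sup>2 \<le> (\<Sum>j<p. (d j)\<^sup>2)" using D by (intro member_le_sum) auto
      then show ?thesis using d by (simp add: abs_square_le_1)
    qed (use d in auto)
    then show ?thesis by (fastforce simp: abs_le_iff minus_le_iff)
  qed
  finally show ?thesis .
qed

lemma dot_cong: "(\<And>j. j < p \<Longrightarrow> x j = x' j) \<Longrightarrow> (\<And>j. j < p \<Longrightarrow> d j = d' j) \<Longrightarrow> dot p x d = dot p x' d'"
  unfolding dot_def by (intro sum.cong) auto

text \<open>For a fixed margin \<open>1 / k\<close> the set of samples with a given pattern is the projection of a closed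
  set along the compact set of directions.\<close>

lemma hs_pattern_measurable:
  shows "{x \<in> space (PiM {..<N} (\<lambda>_. Rn p)). T \<in> hs_pattern N p x ` sparse_dirs p m}
    \<in> sets (PiM {..<N} (\<lambda>_. Rn p))"
proof -
  let ?M = "PiM {..<N} (\<lambda>_. Rn p)"
  \<comment> \<open>Points of the product space are \<open>undefined\<close> off the index set.
    Padding with zeros moves them into the full function space, where closedness can be
    discussed.\<close>
  define emb where "emb = (\<lambda>(x :: nat \<Rightarrow> nat \<Rightarrow> real) i j. if i < N \<and> j < p then x i j else 0)"
  have emb: "emb \<in> borel_measurable ?M"
  proof (intro measurable_coordinatewise_then_product)
    fix i j
    show "(\<lambda>x. emb x i j) \<in> borel_measurable ?M"
    proof (cases "i < N \<and> j < p")
      case True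
      have "(\<lambda>x. x i) \<in> ?M \<rightarrow>\<^sub>M Rn p" using True by (intro measurable_component_singleton) auto
      moreover have "(\<lambda>y. y j) \<in> Rn p \<rightarrow>\<^sub>M borel"
        unfolding Rn_def using True by (intro measurable_component_singleton) auto
      ultimately have "(\<lambda>x. x i j) \<in> borel_measurable ?M" by (rule measurable_compose)
      then show ?thesis using True by (simp add: emb_def)
    next
      case False
      then have "(\<lambda>x. emb x i j) = (\<lambda>_. 0)" by (auto simp: emb_def)
      then show ?thesis by simp
    qed
  qed
  define K where "K = (\<lambda>D. {d :: nat \<Rightarrow> real. (\<forall>j. j \<notin> D \<longrightarrow> d j = 0) \<and> (\<Sum>j<p. (d j)\<^sup>2) = 1})"
  define C where "C = (\<lambda>D k. {x. \<exists>d\<in>K D. (d, x) \<in> {(d, x). (\<forall>i\<in>T. dot p (x i) d \<le> 0) \<and>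
      (\<forall>i\<in>{..<N}-T. 1 / real (Suc k) \<le> dot p (x i) d)}})"
  define DD where "DD = {D. D \<subseteq> {..<p} \<and> card D \<le> m}"
  have cl: "closed (C D k)" if "D \<subseteq> {..<p}" for D k
    unfolding C_def
  proof (rule closed_projection_along_compact)
    show "compact (K D)" unfolding K_def by (rule compact_coordinate_sphere[OF that])
    have c1: "continuous_on UNIV (\<lambda>z :: (nat \<Rightarrow> real) \<times> (nat \<Rightarrow> nat \<Rightarrow> real). fst z j)" for j
      by (rule continuous_on_product_then_coordinatewise) (intro continuous_intros)
    have c2: "continuous_on UNIV (\<lambda>z :: (nat \<Rightarrow> real) \<times> (nat \<Rightarrow> nat \<Rightarrow> real). snd z i j)" for i j
      by (rule continuous_on_product_then_coordinatewise,
          rule continuous_on_product_then_coordinatewise) (intro continuous_intros)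
    have "closed ({z :: (nat \<Rightarrow> real) \<times> (nat \<Rightarrow> nat \<Rightarrow> real). \<forall>i\<in>T. dot p (snd z i) (fst z) \<le> 0} \<inter>
        {z. \<forall>i\<in>{..<N}-T. 1 / real (Suc k) \<le> dot p (snd z i) (fst z)})"
      unfolding dot_def Ball_def
      by (intro closed_Int closed_Collect_all closed_Collect_imp open_Collect_const closed_Collect_le
          continuous_intros c1 c2)
    then show "closed {(d :: nat \<Rightarrow> real, x :: nat \<Rightarrow> nat \<Rightarrow> real). (\<forall>i\<in>T. dot p (x i) d \<le> 0) \<and>
      (\<forall>i\<in>{..<N}-T. 1 / real (Suc k) \<le> dot p (x i) d)}"
      by (rule back_subst[where P = closed]) auto
  qed
  have eq: "T \<in> hs_pattern N p x ` sparse_dirs p m \<longleftrightarrow> T \<subseteq> {..<N} \<and> emb x \<in> (\<Union>D\<in>DD. \<Union>k. C D k)" for x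
  proof
    assume "T \<in> hs_pattern N p x ` sparse_dirs p m"
    then obtain d where d: "d \<in> usphere p" "l0norm p d \<le> m" "T = hs_pattern N p x d"
      by (auto simp: sparse_dirs_def)
    define D where "D = {j. j < p \<and> d j \<noteq> 0}"
    define d' where "d' = (\<lambda>j. if j < p then d j else 0)"
    have DD: "D \<in> DD" using d(2) by (auto simp: DD_def D_def l0norm_def)
    have "(\<Sum>j<p. (d' j)\<^sup>2) = (\<Sum>j<p. (d j)\<^sup>2)" by (intro sum.cong) (auto simp: d'_def)
    also have "\<dots> = 1" using d(1) by (simp add: usphere_def L2_set_def)
    finally have K: "d' \<in> K D" by (auto simp: K_def D_def d'_def)
    have TN: "T \<subseteq> {..<N}" using d by (auto simp: hs_pattern_def)
    have dot: "dot p (emb x i) d' = dot p (x i) d" if "i < N" for i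
      using that by (intro dot_cong) (auto simp: emb_def d'_def)
    \<comment> \<open>Finitely many strict inequalities have a common margin, so the union over
      \<open>k\<close> of the closed sets recovers the strict condition.\<close>
    have "\<exists>k. \<forall>i\<in>{..<N}-T. 1 / real (Suc k) \<le> dot p (x i) d"
    proof -
      have "\<forall>i\<in>{..<N}-T. \<exists>k. 1 / real (Suc k) < dot p (x i) d"
      proof
        fix i assume "i \<in> {..<N} - T"
        then have "0 < dot p (x i) d" using d(3) by (auto simp: hs_pattern_def)
        then show "\<exists>k. 1 / real (Suc k) < dot p (x i) d"
          using reals_Archimedean by (simp add: inverse_eq_divide)
      qed
      then obtain k where k: "\<forall>i\<in>{..<N}-T. 1 / real (Suc (k i)) < dot p (x i) d" by metis
      have "1 / real (Suc (Max (insert 0 (k ` ({..<N}-T))))) \<le> dot p (x i) d" if "i \<in> {..<N}-T" for i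
      proof -
        have "k i \<le> Max (insert 0 (k ` ({..<N}-T)))" using that by (intro Max_ge) auto
        then have "1 / real (Suc (Max (insert 0 (k ` ({..<N}-T))))) \<le> 1 / real (Suc (k i))"
          by (intro divide_left_mono) auto
        also have "\<dots> \<le> dot p (x i) d" by (rule less_imp_le, rule bspec[OF k that])
        finally show ?thesis .
      qed
      then show ?thesis by blast
    qed
    then obtain k where "\<forall>i\<in>{..<N}-T. 1 / real (Suc k) \<le> dot p (x i) d" by blast
    moreover have "\<forall>i\<in>T. dot p (x i) d \<le> 0" using d(3) by (simp add: hs_pattern_def)
    ultimately have "(\<forall>i\<in>T. dot p (emb x i) d' \<le> 0) \<and>
        (\<forall>i\<in>{..<N}-T. 1 / real (Suc k) \<le> dot p (emb x i) d')"
      using dot TN by (metis DiffD1 lessThan_iff subsetD)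
    then have "emb x \<in> C D k" unfolding C_def using K by blast
    then show "T \<subseteq> {..<N} \<and> emb x \<in> (\<Union>D\<in>DD. \<Union>k. C D k)" using TN DD by blast
  next
    assume "T \<subseteq> {..<N} \<and> emb x \<in> (\<Union>D\<in>DD. \<Union>k. C D k)"
    then obtain D k d where T: "T \<subseteq> {..<N}" and D: "D \<in> DD" and d: "d \<in> K D"
        "\<forall>i\<in>T. dot p (emb x i) d \<le> 0" "\<forall>i\<in>{..<N}-T. 1 / real (Suc k) \<le> dot p (emb x i) d"
      unfolding C_def by blast
    define d' where "d' = restrict d {..<p}"
    have dot: "dot p (emb x i) d = dot p (x i) d'" if "i < N" for i
      using that by (intro dot_cong) (auto simp: emb_def d'_def)
    have "(\<Sum>j<p. (d' j)\<^sup>2) = (\<Sum>j<p. (d j)\<^sup>2)" by (intro sum.cong) (auto simp: d'_def)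
    also have "\<dots> = 1" using d(1) by (simp add: K_def)
    finally have "d' \<in> usphere p" by (simp add: usphere_def L2_set_def d'_def Rn_def space_PiM)
    moreover have "l0norm p d' \<le> m"
    proof -
      have "{j. j < p \<and> d' j \<noteq> 0} \<subseteq> D" using d(1) by (auto simp: d'_def K_def)
      then have "card {j. j < p \<and> d' j \<noteq> 0} \<le> card D"
        using D by (intro card_mono) (auto simp: DD_def finite_subset)
      then show ?thesis using D by (simp add: l0norm_def DD_def)
    qed
    moreover have "hs_pattern N p x d' = T"
    proof -
      have "0 < dot p (x i) d'" if "i < N" "i \<notin> T" for i
        using d(3) that dot[OF that(1)] by (smt (verit) DiffI divide_pos_pos lessThan_iff of_nat_0_less_iff zero_less_Suc)
      moreover have "dot p (x i) d' \<le> 0" if "i \<in> T" for i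
        using that d(2) dot T by (metis lessThan_iff subsetD)
      ultimately show ?thesis using T unfolding hs_pattern_def by force
    qed
    ultimately show "T \<in> hs_pattern N p x ` sparse_dirs p m" by (auto simp: sparse_dirs_def)
  qed
  have "(\<Union>D\<in>DD. \<Union>k. C D k) \<in> sets borel"
    by (intro sets.finite_UN sets.countable_UN) (auto simp: DD_def intro!: borel_closed cl)
  then have "emb -` (\<Union>D\<in>DD. \<Union>k. C D k) \<inter> space ?M \<in> sets ?M"
    by (rule measurable_sets[OF emb])
  moreover have "{x \<in> space ?M. T \<in> hs_pattern N p x ` sparse_dirs p m} =
      (if T \<subseteq> {..<N} then emb -` (\<Union>D\<in>DD. \<Union>k. C D k) \<inter> space ?M else {})"
    using eq by auto
  ultimately show ?thesis by auto
qed

section \<open>Exponential inequalities\<close>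

text \<open>Chernoff's bound at tilt 1: any other tilt is put into \<open>Z\<close>, and
  independence factorises the exponential moment.\<close>

lemma (in prob_space) exponential_markov_indep:
  fixes Z :: "'i \<Rightarrow> 'a \<Rightarrow> real"
  assumes fin: "finite I" and ind: "indep_vars (\<lambda>_. borel) Z I"
    and int: "\<And>i. i \<in> I \<Longrightarrow> integrable M (\<lambda>\<omega>. exp (Z i \<omega>))"
    and g: "\<And>i. i \<in> I \<Longrightarrow> expectation (\<lambda>\<omega>. exp (Z i \<omega>)) \<le> g i"
  shows "prob {\<omega> \<in> space M. y \<le> (\<Sum>i\<in>I. Z i \<omega>)} \<le> exp (- y) * (\<Prod>i\<in>I. g i)"
proof -
  have ind': "indep_vars (\<lambda>_. borel) (\<lambda>i \<omega>. exp (Z i \<omega>)) I"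
    by (rule indep_vars_compose2[OF ind]) simp
  have 1: "integrable M (\<lambda>\<omega>. \<Prod>i\<in>I. exp (Z i \<omega>))"
    by (rule indep_vars_integrable[OF fin ind' int])
  have eq: "exp (\<Sum>i\<in>I. Z i \<omega>) = (\<Prod>i\<in>I. exp (Z i \<omega>))" for \<omega>
    by (rule exp_sum[OF fin])
  have "prob {\<omega> \<in> space M. 1 * (\<Sum>i\<in>I. Z i \<omega>) \<ge> y} \<le>
      exp (- 1 * y) * (\<integral>\<omega>\<in>space M. exp (1 * (\<Sum>i\<in>I. Z i \<omega>)) \<partial>M)"
    using Chernoff_ineq_ge[of 1 "space M" "\<lambda>\<omega>. \<Sum>i\<in>I. Z i \<omega>" y] 1
    by (simp add: set_integrable_def eq Bochner_Integration.integrable_cong[OF refl, of M "\<lambda>x. indicat_real (space M) x * (\<Prod>i\<in>I. exp (Z i x))" "\<lambda>x. \<Prod>i\<in>I. exp (Z i x)"])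
  also have "(\<integral>\<omega>\<in>space M. exp (1 * (\<Sum>i\<in>I. Z i \<omega>)) \<partial>M) = expectation (\<lambda>\<omega>. \<Prod>i\<in>I. exp (Z i \<omega>))"
    using set_integral_space[OF 1] by (simp add: eq)
  also have "\<dots> = (\<Prod>i\<in>I. expectation (\<lambda>\<omega>. exp (Z i \<omega>)))"
    by (rule indep_vars_lebesgue_integral[OF fin ind' int])
  also have "exp (- 1 * y) * \<dots> \<le> exp (- 1 * y) * (\<Prod>i\<in>I. g i)"
    using g by (intro mult_left_mono prod_mono) (auto intro!: Bochner_Integration.integral_nonneg)
  finally show ?thesis by simp
qed

lemma exp_le_quadratic: "\<bar>x\<bar> \<le> 1 \<Longrightarrow> exp x \<le> 1 + x + x\<^sup>2" for x :: real
  using exp_bound[of x]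
proof (cases "0 \<le> x")
  case False
  assume "\<bar>x\<bar> \<le> 1"
  then have x: "- 1 \<le> x" "x < 0" using False by auto
  define y where "y = - x"
  have y: "0 < y" "y \<le> 1" using x by (auto simp: y_def)
  have "1 + y + y\<^sup>2 / 2 \<le> exp y" using exp_lower_Taylor_quadratic[of y] y by simp
  \<comment> \<open>For negative arguments the claim bounds \<open>1 / exp y\<close>; it suffices
    that the claimed polynomial times the Taylor minorant of \<open>exp y\<close> is at least
    1.\<close>
  moreover have "1 \<le> (1 - y + y\<^sup>2) * (1 + y + y\<^sup>2 / 2)"
  proof -
    have "(1 - y + y\<^sup>2) * (1 + y + y\<^sup>2 / 2) = 1 + y\<^sup>2 / 2 + y ^ 3 / 2 + y ^ 4 / 2"
      by (simp add: field_simps power2_eq_square power3_eq_cube power4_eq_xxxx)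
    then show ?thesis using y by simp
  qed
  moreover have "0 < 1 - y + y\<^sup>2" using y
    by (smt (verit) zero_less_power)
  ultimately have "1 \<le> (1 - y + y\<^sup>2) * exp y"
    by (smt (verit) mult_left_mono)
  then have "exp (- y) \<le> 1 - y + y\<^sup>2"
    by (simp add: exp_minus field_simps)
  then show ?thesis by (simp add: y_def)
qed auto

text \<open>The map is odd, so it keeps a symmetric law centred, and it changes nothing on the event
  that all errors are at most \<open>c\<close>.\<close>

definition truncate :: "real \<Rightarrow> real \<Rightarrow> real" where
  "truncate c x = (if \<bar>x\<bar> \<le> c then x else 0)"

lemma truncate_measurable [measurable]: "truncate c \<in> borel_measurable borel"
  unfolding truncate_def by measurable

lemma abs_truncate_le: "0 \<le> c \<Longrightarrow> \<bar>truncate c x\<bar> \<le> c"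
  by (simp add: truncate_def)

text \<open>The linear term of the expansion vanishes by symmetry, and truncation does not increase
  the second moment. The restriction on \<open>l\<close> keeps the exponent in the range of
  \<open>exp_le_quadratic\<close>.\<close>

lemma mgf_truncate_symmetric_le:
  assumes \<nu>: "prob_space \<nu>" "sets \<nu> = sets borel" "distr \<nu> borel uminus = \<nu>" "integrable \<nu> (\<lambda>x. x\<^sup>2)"
    and c: "0 < c" "\<bar>l\<bar> * c \<le> 1"
  shows "(\<integral>x. exp (l * truncate c x) \<partial>\<nu>) \<le> exp (l\<^sup>2 * (\<integral>x. x\<^sup>2 \<partial>\<nu>))"
proof -
  interpret prob_space \<nu> by fact
  have m: "truncate c \<in> borel_measurable \<nu>" using truncate_measurable \<nu>(2) measurable_cong_sets by blast
  have bd: "\<bar>l * truncate c x\<bar> \<le> 1" for x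
    using abs_truncate_le[of c x] c mult_left_mono[of "\<bar>truncate c x\<bar>" c "\<bar>l\<bar>"] by (simp add: abs_mult)
  have it: "integrable \<nu> (truncate c)"
    by (rule integrable_const_bound[of _ c]) (use m c abs_truncate_le in auto)
  have it2: "integrable \<nu> (\<lambda>x. (truncate c x)\<^sup>2)"
    by (rule Bochner_Integration.integrable_bound[OF \<nu>(4)]) (use borel_measurable_power[OF m] in simp, simp add: truncate_def)
  have ie: "integrable \<nu> (\<lambda>x. exp (l * truncate c x))"
    by (rule integrable_const_bound[of _ "exp 1"]) (use m bd in \<open>auto simp: abs_le_iff\<close>)
  have "(\<integral>x. truncate c x \<partial>\<nu>) = (\<integral>x. truncate c x \<partial>distr \<nu> borel uminus)" using \<nu>(3) by simp
  also have "\<dots> = (\<integral>x. truncate c (- x) \<partial>\<nu>)"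
    by (rule integral_distr) (use \<nu>(2) measurable_cong_sets in \<open>auto intro!: borel_measurable_uminus\<close>)
  also have "\<dots> = (\<integral>x. - truncate c x \<partial>\<nu>)" by (rule Bochner_Integration.integral_cong) (auto simp: truncate_def)
  finally have 0: "(\<integral>x. truncate c x \<partial>\<nu>) = 0" by simp
  have "(\<integral>x. exp (l * truncate c x) \<partial>\<nu>) \<le> (\<integral>x. 1 + l * truncate c x + l\<^sup>2 * (truncate c x)\<^sup>2 \<partial>\<nu>)"
    using exp_le_quadratic[OF bd] it it2 ie
    by (intro integral_mono) (auto simp: power_mult_distrib)
  also have "\<dots> = 1 + l\<^sup>2 * (\<integral>x. (truncate c x)\<^sup>2 \<partial>\<nu>)"
    using it it2 0 by (simp add: prob_space)
  also have "(\<integral>x. (truncate c x)\<^sup>2 \<partial>\<nu>) \<le> (\<integral>x. x\<^sup>2 \<partial>\<nu>)"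
    using it2 \<nu>(4) by (intro integral_mono) (auto simp: truncate_def)
  then have "1 + l\<^sup>2 * (\<integral>x. (truncate c x)\<^sup>2 \<partial>\<nu>) \<le> 1 + l\<^sup>2 * (\<integral>x. x\<^sup>2 \<partial>\<nu>)"
    by (simp add: mult_left_mono)
  also have "\<dots> \<le> exp (l\<^sup>2 * (\<integral>x. x\<^sup>2 \<partial>\<nu>))" using exp_ge_add_one_self by simp
  finally show ?thesis .
qed

text \<open>The variance is that of the untruncated law; the truncation level enters only through
  the term linear in \<open>t\<close>.\<close>

lemma (in prob_space) bernstein_truncated:
  fixes \<xi> :: "nat \<Rightarrow> 'a \<Rightarrow> real"
  assumes \<nu>: "prob_space \<nu>" "sets \<nu> = sets borel" "distr \<nu> borel uminus = \<nu>" "integrable \<nu> (\<lambda>x. x\<^sup>2)"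
    and ind: "indep_vars (\<lambda>_. borel) \<xi> T" and fin: "finite T"
    and law: "\<And>i. i \<in> T \<Longrightarrow> distr M borel (\<xi> i) = \<nu>"
    and c: "0 < c" and t: "0 < t" and \<sigma>: "0 < \<sigma>" "\<sigma>\<^sup>2 = (\<integral>x. x\<^sup>2 \<partial>\<nu>)"
  shows "prob {\<omega> \<in> space M. 2 * \<sigma> * sqrt (real (card T) * t) + 2 * c * t \<le> \<bar>\<Sum>i\<in>T. truncate c (\<xi> i \<omega>)\<bar>}
    \<le> 2 * exp (- t)"
proof -
  define y where "y = 2 * \<sigma> * sqrt (real (card T) * t) + 2 * c * t"
  have meas: "\<xi> i \<in> borel_measurable M" if "i \<in> T" for i
    using ind that by (auto simp: indep_vars_def)
  have tail: "prob {\<omega> \<in> space M. \<bar>l\<bar> * y \<le> (\<Sum>i\<in>T. l * truncate c (\<xi> i \<omega>))}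
      \<le> exp (- (\<bar>l\<bar> * y) + l\<^sup>2 * \<sigma>\<^sup>2 * real (card T))" if l: "\<bar>l\<bar> * c \<le> 1" for l
  proof -
    have bd: "\<bar>l * truncate c x\<bar> \<le> 1" for x
      using abs_truncate_le[of c x] c l mult_left_mono[of "\<bar>truncate c x\<bar>" c "\<bar>l\<bar>"] by (simp add: abs_mult)
    have "prob {\<omega> \<in> space M. \<bar>l\<bar> * y \<le> (\<Sum>i\<in>T. l * truncate c (\<xi> i \<omega>))}
      \<le> exp (- (\<bar>l\<bar> * y)) * (\<Prod>i\<in>T. exp (l\<^sup>2 * \<sigma>\<^sup>2))"
    proof (rule exponential_markov_indep[OF fin])
      show "indep_vars (\<lambda>_. borel) (\<lambda>i \<omega>. l * truncate c (\<xi> i \<omega>)) T"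
        by (rule indep_vars_compose2[OF ind]) simp
      fix i assume i: "i \<in> T"
      note [measurable] = meas[OF i]
      show "integrable M (\<lambda>\<omega>. exp (l * truncate c (\<xi> i \<omega>)))"
        by (rule integrable_const_bound[of _ "exp 1"]) (use bd in \<open>auto simp: abs_le_iff\<close>)
      have "expectation (\<lambda>\<omega>. exp (l * truncate c (\<xi> i \<omega>))) = (\<integral>x. exp (l * truncate c x) \<partial>distr M borel (\<xi> i))"
        by (subst integral_distr) auto
      also have "\<dots> \<le> exp (l\<^sup>2 * \<sigma>\<^sup>2)"
        unfolding law[OF i] \<sigma>(2) by (rule mgf_truncate_symmetric_le[OF \<nu> c l])
      finally show "expectation (\<lambda>\<omega>. exp (l * truncate c (\<xi> i \<omega>))) \<le> exp (l\<^sup>2 * \<sigma>\<^sup>2)" .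
    qed
    also have "\<dots> = exp (- (\<bar>l\<bar> * y) + l\<^sup>2 * \<sigma>\<^sup>2 * real (card T))"
      by (simp add: exp_add[symmetric] exp_of_nat_mult[symmetric] mult.commute)
    finally show ?thesis .
  qed
  \<comment> \<open>The tilt \<open>sqrt t / (\<sigma> * sqrt (card T))\<close> balances variance
    and deviation but is admissible only up to \<open>1 / c\<close>; otherwise the tilt
    \<open>1 / c\<close> is used and the linear term of \<open>y\<close> pays.\<close>
  have "\<exists>l>0. l * c \<le> 1 \<and> - (l * y) + l\<^sup>2 * \<sigma>\<^sup>2 * real (card T) \<le> - t"
  proof (cases "t * c\<^sup>2 \<le> \<sigma>\<^sup>2 * real (card T)")
    case True
    have S: "0 < real (card T)"
      using True t c \<sigma> by (metis less_le_not_le mult_pos_pos mult_zero_right of_nat_0_le_iff order_le_less zero_less_power)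
    define l where "l = sqrt t / (\<sigma> * sqrt (real (card T)))"
    have l0: "0 < l" using t \<sigma> S by (simp add: l_def)
    have l2: "l\<^sup>2 * \<sigma>\<^sup>2 * real (card T) = t"
      using t \<sigma>(1) S by (simp add: l_def power_divide power_mult_distrib)
    have "(l * c)\<^sup>2 * (\<sigma>\<^sup>2 * real (card T)) = t * c\<^sup>2"
      using l2 by (simp add: power_mult_distrib algebra_simps)
    then have "(l * c)\<^sup>2 * (\<sigma>\<^sup>2 * real (card T)) \<le> 1 * (\<sigma>\<^sup>2 * real (card T))" using True by simp
    moreover have "0 < \<sigma>\<^sup>2 * real (card T)" using \<sigma>(1) S by simp
    ultimately have "(l * c)\<^sup>2 \<le> 1" by (rule mult_right_le_imp_le)
    then have lc: "l * c \<le> 1" using power2_le_imp_le[of "l * c" 1] by simp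
    have "l * (2 * \<sigma> * sqrt (real (card T) * t)) = 2 * t"
      using t \<sigma> S by (simp add: l_def real_sqrt_mult)
    moreover have "0 \<le> l * (2 * c * t)" using l0 c t by simp
    ultimately have "2 * t \<le> l * y" unfolding y_def distrib_left by linarith
    then show ?thesis using l0 lc l2 by (intro exI[of _ l]) auto
  next
    case False
    define l where "l = 1 / c"
    have l0: "0 < l" using c by (simp add: l_def)
    have "l\<^sup>2 * \<sigma>\<^sup>2 * real (card T) \<le> l\<^sup>2 * (t * c\<^sup>2)"
      using False by (simp add: mult.assoc mult_left_mono)
    also have "\<dots> = t" using c by (simp add: l_def power_divide)
    finally have 1: "l\<^sup>2 * \<sigma>\<^sup>2 * real (card T) \<le> t" .
    have "l * (2 * c * t) = 2 * t" using c by (simp add: l_def)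
    moreover have "0 \<le> l * (2 * \<sigma> * sqrt (real (card T) * t))" using l0 \<sigma> t by simp
    ultimately have "2 * t \<le> l * y" unfolding y_def distrib_left by linarith
    then show ?thesis using l0 1 c by (intro exI[of _ l]) (auto simp: l_def)
  qed
  then obtain l where l: "0 < l" "l * c \<le> 1" "- (l * y) + l\<^sup>2 * \<sigma>\<^sup>2 * real (card T) \<le> - t" by blast
  have t1: "prob {\<omega> \<in> space M. l * y \<le> (\<Sum>i\<in>T. l * truncate c (\<xi> i \<omega>))} \<le> exp (- t)"
    using tail[of l] l by (simp, smt (verit) exp_le_cancel_iff)
  have t2: "prob {\<omega> \<in> space M. l * y \<le> (\<Sum>i\<in>T. - l * truncate c (\<xi> i \<omega>))} \<le> exp (- t)"
    using tail[of "- l"] l by (simp, smt (verit) exp_le_cancel_iff)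
  let ?A = "{\<omega> \<in> space M. l * y \<le> (\<Sum>i\<in>T. l * truncate c (\<xi> i \<omega>))}"
  let ?B = "{\<omega> \<in> space M. l * y \<le> (\<Sum>i\<in>T. - l * truncate c (\<xi> i \<omega>))}"
  have ev: "?A \<in> events" "?B \<in> events"
    using meas by (auto intro!: borel_measurable_le borel_measurable_sum borel_measurable_times
        measurable_compose[OF _ truncate_measurable])
  have "{\<omega> \<in> space M. y \<le> \<bar>\<Sum>i\<in>T. truncate c (\<xi> i \<omega>)\<bar>} \<subseteq> ?A \<union> ?B"
    using l(1) by (auto simp: sum_distrib_left[symmetric] sum_negf abs_if mult_le_cancel_left_pos split: if_splits)
       (smt (verit) mult_le_cancel_left_pos mult_minus_right)+
  then have "prob {\<omega> \<in> space M. y \<le> \<bar>\<Sum>i\<in>T. truncate c (\<xi> i \<omega>)\<bar>} \<le> prob (?A \<union> ?B)"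
    by (rule finite_measure_mono) (rule sets.Un[OF ev])
  also have "\<dots> \<le> prob ?A + prob ?B" by (rule measure_Un_le[OF ev])
  finally show ?thesis using t1 t2 unfolding y_def by linarith
qed

text \<open>With tilt 1 the deviation contributes \<open>a / 2\<close> per observation, and each
  exponential moment \<open>1 - (1 - exp (- 1)) * a\<close> is at most
  \<open>exp (- (5/8) * a)\<close>; the difference is the 1/8.\<close>

lemma (in prob_space) count_lower_tail:
  fixes X :: "'i \<Rightarrow> 'a \<Rightarrow> 'b"
  assumes fin: "finite I" and ind: "indep_vars (\<lambda>_. N) X I" and A: "A \<in> sets N"
    and a: "\<And>i. i \<in> I \<Longrightarrow> prob {\<omega> \<in> space M. X i \<omega> \<in> A} = a"
  shows "prob {\<omega> \<in> space M. real (card {i\<in>I. X i \<omega> \<in> A}) \<le> real (card I) * a / 2} \<le> exp (- real (card I) * a / 8)"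
proof -
  let ?Z = "\<lambda>i \<omega>. - indicat_real A (X i \<omega>)"
  have indZ: "indep_vars (\<lambda>_. borel) ?Z I"
    by (rule indep_vars_compose2[OF ind]) (use A in simp)
  have meas: "X i \<in> M \<rightarrow>\<^sub>M N" if "i \<in> I" for i
    using ind that by (auto simp: indep_vars_def)
  have g: "expectation (\<lambda>\<omega>. exp (?Z i \<omega>)) \<le> exp (- (5/8) * a)" "integrable M (\<lambda>\<omega>. exp (?Z i \<omega>))"
    if i: "i \<in> I" for i
  proof -
    note [measurable] = meas[OF i] A
    have e: "exp (?Z i \<omega>) = 1 - (1 - exp (- 1)) * indicat_real {\<omega> \<in> space M. X i \<omega> \<in> A} \<omega>"
      if "\<omega> \<in> space M" for \<omega>
      using that by (auto simp: indicator_def)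
    have "expectation (\<lambda>\<omega>. exp (?Z i \<omega>)) = expectation (\<lambda>\<omega>. 1 - (1 - exp (- 1)) * indicat_real {\<omega> \<in> space M. X i \<omega> \<in> A} \<omega>)"
      by (rule Bochner_Integration.integral_cong[OF refl e])
    also have "\<dots> = 1 - (1 - exp (- 1)) * a"
    proof -
      have [measurable]: "{\<omega> \<in> space M. X i \<omega> \<in> A} \<in> events" by measurable
      have "integrable M (indicat_real {\<omega> \<in> space M. X i \<omega> \<in> A})"
        by (rule integrable_const_bound[of _ 1]) auto
      then show ?thesis
        using a[OF i] by (subst Bochner_Integration.integral_diff) (auto simp: prob_space)
    qed
    also have "\<dots> \<le> 1 - 5/8 * a"
    proof -
      have "exp (- 1 :: real) \<le> 3/8"
        using e_approx_32 by (simp add: exp_minus field_simps abs_if split: if_splits)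
      moreover have "0 \<le> a" using a[OF i] by (metis measure_nonneg)
      ultimately have "5/8 * a \<le> (1 - exp (- 1)) * a" by (intro mult_right_mono) auto
      then show ?thesis by simp
    qed
    also have "\<dots> \<le> exp (- (5/8) * a)" using exp_ge_add_one_self[of "- (5/8) * a"] by simp
    finally show "expectation (\<lambda>\<omega>. exp (?Z i \<omega>)) \<le> exp (- (5/8) * a)" .
    show "integrable M (\<lambda>\<omega>. exp (?Z i \<omega>))"
      by (rule integrable_const_bound[of _ 1]) auto
  qed
  have cnt: "(\<Sum>i\<in>I. ?Z i \<omega>) = - real (card {i\<in>I. X i \<omega> \<in> A})" for \<omega>
    using fin by (simp add: sum_negf indicator_def sum.If_cases Int_def)
  have "prob {\<omega> \<in> space M. real (card {i\<in>I. X i \<omega> \<in> A}) \<le> real (card I) * a / 2}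
     = prob {\<omega> \<in> space M. - (real (card I) * a / 2) \<le> (\<Sum>i\<in>I. ?Z i \<omega>)}"
    unfolding cnt by simp
  also have "\<dots> \<le> exp (- (- (real (card I) * a / 2))) * (\<Prod>i\<in>I. exp (- (5/8) * a))"
    using g by (intro exponential_markov_indep[OF fin indZ]) auto
  also have "\<dots> = exp (- real (card I) * a / 8)"
    by (simp add: exp_of_nat_mult[symmetric] exp_add[symmetric] field_simps)
  finally show ?thesis .
qed

lemma indep_vars_PiM_coordinates:
  assumes "finite I" "I \<noteq> {}" "\<And>i. i \<in> I \<Longrightarrow> prob_space (M i)"
  shows "prob_space.indep_vars (PiM I M) M (\<lambda>i \<omega>. \<omega> i) I"
proof -
  interpret prob_space "PiM I M" by (rule prob_space_PiM) fact
  have "distr (PiM I M) (PiM I M) (\<lambda>x. \<lambda>i\<in>I. x i) = PiM I M"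
    using distr_PiM_reindex[of I M "\<lambda>i. i" I] assms by simp
  moreover have "PiM I (\<lambda>i. distr (PiM I M) (M i) (\<lambda>\<omega>. \<omega> i)) = PiM I M"
    by (intro PiM_cong refl distr_PiM_component) (use assms in auto)
  ultimately show ?thesis
    using assms by (subst indep_vars_iff_distr_eq_PiM') auto
qed

section \<open>Independent covariates and errors\<close>

text \<open>\<open>f\<close> will be one of the four cells or the symmetric difference. For a fixed
  sample the value depends on \<open>d\<close> only through its pattern, so the family is no larger
  than the family of patterns.\<close>

definition side_pattern ::
  "(nat set \<Rightarrow> nat set \<Rightarrow> nat set) \<Rightarrow> nat \<Rightarrow> nat \<Rightarrow> nat \<Rightarrow> (nat \<Rightarrow> real) \<Rightarrow> (nat \<Rightarrow> nat \<Rightarrow> real) \<Rightarrow> nat set set" where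
  "side_pattern f N p m d0 x = (\<lambda>d. f (hs_pattern N p x d) (hs_pattern N p x d0)) ` sparse_dirs p m"

lemma dot_measurable [measurable]: "(\<lambda>x. dot p x d) \<in> borel_measurable (Rn p)"
  unfolding dot_def Rn_def by measurable

lemma hs_pattern_fixed_measurable:
  "{x \<in> space (PiM {..<N} (\<lambda>_. Rn p)). hs_pattern N p x d0 = S} \<in> sets (PiM {..<N} (\<lambda>_. Rn p))"
proof (cases "S \<subseteq> {..<N}")
  case True
  have "{x \<in> space (PiM {..<N} (\<lambda>_. Rn p)). \<forall>i\<in>{..<N}. dot p (x i) d0 \<le> 0 \<longleftrightarrow> i \<in> S} \<in> sets (PiM {..<N} (\<lambda>_. Rn p))"
    by measurable
  also have "{x \<in> space (PiM {..<N} (\<lambda>_. Rn p)). \<forall>i\<in>{..<N}. dot p (x i) d0 \<le> 0 \<longleftrightarrow> i \<in> S} =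
     {x \<in> space (PiM {..<N} (\<lambda>_. Rn p)). hs_pattern N p x d0 = S}"
    using True by (auto simp: hs_pattern_def)
  finally show ?thesis .
next
  case False
  then have e: "{x \<in> space (PiM {..<N} (\<lambda>_. Rn p)). hs_pattern N p x d0 = S} = {}"
    by (auto simp: hs_pattern_def)
  show ?thesis unfolding e by (rule sets.empty_sets)
qed

text \<open>Patterns are subsets of a finite index set, so this is a finite union of events on which
  both patterns are prescribed.\<close>

lemma side_pattern_measurable:
  "{x \<in> space (PiM {..<N} (\<lambda>_. Rn p)). T \<in> side_pattern f N p m d0 x} \<in> sets (PiM {..<N} (\<lambda>_. Rn p))"
proof -
  let ?M = "PiM {..<N} (\<lambda>_. Rn p)"
  let ?P = "{(P, S). P \<in> Pow {..<N} \<and> S \<in> Pow {..<N} \<and> f P S = T}"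
  have "finite ?P" by (rule finite_subset[of _ "Pow {..<N} \<times> Pow {..<N}"]) auto
  moreover have "{x \<in> space ?M. T \<in> side_pattern f N p m d0 x} = (\<Union>(P, S)\<in>?P.
      {x \<in> space ?M. P \<in> hs_pattern N p x ` sparse_dirs p m} \<inter> {x \<in> space ?M. hs_pattern N p x d0 = S})"
    (is "?L = ?R")
  proof
    show "?L \<subseteq> ?R"
    proof
      fix x assume "x \<in> ?L"
      then obtain d where d: "x \<in> space ?M" "d \<in> sparse_dirs p m" "T = f (hs_pattern N p x d) (hs_pattern N p x d0)"
        by (auto simp: side_pattern_def)
      moreover have "(hs_pattern N p x d, hs_pattern N p x d0) \<in> ?P" using d by (auto simp: hs_pattern_def)
      ultimately show "x \<in> ?R" by blast
    qed
    show "?R \<subseteq> ?L" by (auto simp: side_pattern_def)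
  qed
  moreover have "(case z of (P, S) \<Rightarrow> {x \<in> space ?M. P \<in> hs_pattern N p x ` sparse_dirs p m}
      \<inter> {x \<in> space ?M. hs_pattern N p x d0 = S}) \<in> sets ?M" for z
    by (auto split: prod.split intro!: sets.Int hs_pattern_measurable hs_pattern_fixed_measurable)
  ultimately show ?thesis by (auto intro!: sets.finite_UN simp del: mem_Collect_eq)
qed

lemma finite_side_pattern: "finite (side_pattern f N p m d0 x)"
proof -
  have "side_pattern f N p m d0 x = (\<lambda>P. f P (hs_pattern N p x d0)) ` (hs_pattern N p x ` sparse_dirs p m)"
    by (simp add: side_pattern_def image_image)
  moreover have "finite (hs_pattern N p x ` sparse_dirs p m)"
    by (rule finite_subset[of _ "Pow {..<N}"]) (auto simp: hs_pattern_def)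
  ultimately show ?thesis by simp
qed

lemma card_side_pattern_le: "card (side_pattern f N p m d0 x) \<le> card (hs_pattern N p x ` sparse_dirs p m)"
proof -
  have "side_pattern f N p m d0 x = (\<lambda>P. f P (hs_pattern N p x d0)) ` (hs_pattern N p x ` sparse_dirs p m)"
    by (simp add: side_pattern_def image_image)
  moreover have "finite (hs_pattern N p x ` sparse_dirs p m)"
    by (rule finite_subset[of _ "Pow {..<N}"]) (auto simp: hs_pattern_def)
  ultimately show ?thesis by (simp add: card_image_le)
qed

text \<open>One row of the triangular array: the probability space, the dimension and the law of the
  covariates all vary with \<open>n\<close> in the theorem.\<close>

locale iid_model = prob_space M for M :: "'a measure" +
  fixes n p :: nat and \<mu> :: "(nat \<Rightarrow> real) measure" and \<nu> :: "real measure"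
    and X :: "nat \<Rightarrow> 'a \<Rightarrow> nat \<Rightarrow> real" and \<xi> :: "nat \<Rightarrow> 'a \<Rightarrow> real"
  assumes n: "1 \<le> n"
    and mu: "prob_space \<mu>" "sets \<mu> = sets (Rn p)"
    and nu: "prob_space \<nu>" "sets \<nu> = sets borel"
    and sample: "iid_sample M n p \<mu> \<nu> X \<xi>"
begin

lemma indep_pairs: "indep_vars (\<lambda>_. Rn p \<Otimes>\<^sub>M borel) (\<lambda>i \<omega>. (X i \<omega>, \<xi> i \<omega>)) {..<n}"
  and law_pair: "i < n \<Longrightarrow> distr M (Rn p \<Otimes>\<^sub>M borel) (\<lambda>\<omega>. (X i \<omega>, \<xi> i \<omega>)) = \<mu> \<Otimes>\<^sub>M \<nu>"
  using sample by (auto simp: iid_sample_def)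

lemma pair_measurable: "i < n \<Longrightarrow> (\<lambda>\<omega>. (X i \<omega>, \<xi> i \<omega>)) \<in> M \<rightarrow>\<^sub>M Rn p \<Otimes>\<^sub>M borel"
  using indep_pairs by (auto simp: indep_vars_def)

lemma X_measurable: "i < n \<Longrightarrow> X i \<in> M \<rightarrow>\<^sub>M Rn p"
  using measurable_compose[OF pair_measurable measurable_fst] by simp

lemma xi_measurable: "i < n \<Longrightarrow> \<xi> i \<in> borel_measurable M"
  using measurable_compose[OF pair_measurable measurable_snd] by simp

lemma indep_X: "indep_vars (\<lambda>_. Rn p) X {..<n}"
  using indep_vars_compose2[OF indep_pairs, of "\<lambda>_. fst" "\<lambda>_. Rn p"] by simp

lemma indep_xi: "indep_vars (\<lambda>_. borel) \<xi> {..<n}"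
  using indep_vars_compose2[OF indep_pairs, of "\<lambda>_. snd" "\<lambda>_. borel"] by simp

lemma rectangle_prob:
  assumes "i < n" "A \<in> sets (Rn p)" "B \<in> sets borel"
  shows "prob {\<omega> \<in> space M. X i \<omega> \<in> A \<and> \<xi> i \<omega> \<in> B} = measure \<mu> A * measure \<nu> B"
proof -
  interpret mu: prob_space \<mu> by (rule mu(1))
  interpret nu: prob_space \<nu> by (rule nu(1))
  have AB: "A \<times> B \<in> sets (Rn p \<Otimes>\<^sub>M borel)" using assms by auto
  have "prob {\<omega> \<in> space M. X i \<omega> \<in> A \<and> \<xi> i \<omega> \<in> B} =
      measure (distr M (Rn p \<Otimes>\<^sub>M borel) (\<lambda>\<omega>. (X i \<omega>, \<xi> i \<omega>))) (A \<times> B)"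
    by (subst measure_distr[OF pair_measurable[OF assms(1)] AB]) (auto intro!: arg_cong[where f = prob])
  also have "\<dots> = measure \<mu> A * measure \<nu> B"
    unfolding law_pair[OF assms(1)]
    using nu.emeasure_pair_measure_Times[of A \<mu> B] assms mu(2) nu(2)
    by (simp add: measure_def enn2real_mult)
  finally show ?thesis .
qed

lemma X_prob: "i < n \<Longrightarrow> A \<in> sets (Rn p) \<Longrightarrow> prob {\<omega> \<in> space M. X i \<omega> \<in> A} = measure \<mu> A"
  using rectangle_prob[of i A UNIV] prob_space.prob_space[OF nu(1)] sets_eq_imp_space_eq[OF nu(2)] by simp

lemma xi_prob:
  assumes "i < n" "B \<in> sets borel" shows "prob {\<omega> \<in> space M. \<xi> i \<omega> \<in> B} = measure \<nu> B"
proof -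
  have "{\<omega> \<in> space M. \<xi> i \<omega> \<in> B} = {\<omega> \<in> space M. X i \<omega> \<in> space (Rn p) \<and> \<xi> i \<omega> \<in> B}"
    using measurable_space[OF X_measurable[OF assms(1)]] by auto
  then show ?thesis
    using rectangle_prob[OF assms(1) sets.top assms(2)] prob_space.prob_space[OF mu(1)] sets_eq_imp_space_eq[OF mu(2)] by simp
qed

lemma law_X_eq:
  assumes i: "i < n" shows "distr M (Rn p) (X i) = \<mu>"
proof (rule measure_eqI)
  fix A assume "A \<in> sets (distr M (Rn p) (X i))"
  then have A: "A \<in> sets (Rn p)" by simp
  have "emeasure (distr M (Rn p) (X i)) A = emeasure M {\<omega> \<in> space M. X i \<omega> \<in> A}"
    by (subst emeasure_distr[OF X_measurable[OF i] A]) (auto intro!: arg_cong[where f = "emeasure M"])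
  also have "\<dots> = emeasure \<mu> A"
    unfolding emeasure_eq_measure X_prob[OF i A]
    by (simp add: finite_measure.emeasure_eq_measure[OF prob_space.finite_measure[OF mu(1)]])
  finally show "emeasure (distr M (Rn p) (X i)) A = emeasure \<mu> A" .
qed (simp add: mu)

lemma law_xi_eq:
  assumes i: "i < n" shows "distr M borel (\<xi> i) = \<nu>"
proof (rule measure_eqI)
  fix A assume "A \<in> sets (distr M borel (\<xi> i))"
  then have A: "A \<in> sets borel" by simp
  have "emeasure (distr M borel (\<xi> i)) A = emeasure M {\<omega> \<in> space M. \<xi> i \<omega> \<in> A}"
    by (subst emeasure_distr[OF xi_measurable[OF i] A]) (auto intro!: arg_cong[where f = "emeasure M"])
  also have "\<dots> = emeasure \<nu> A"
    unfolding emeasure_eq_measure xi_prob[OF i A]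
    by (simp add: finite_measure.emeasure_eq_measure[OF prob_space.finite_measure[OF nu(1)]])
  finally show "emeasure (distr M borel (\<xi> i)) A = emeasure \<nu> A" .
qed (simp add: nu)

lemma index_nonempty: "{..<n} \<noteq> {}"
  using n by (metis empty_iff lessThan_iff less_le_trans zero_less_one)

definition Xv :: "'a \<Rightarrow> nat \<Rightarrow> nat \<Rightarrow> real" where "Xv \<omega> = (\<lambda>i\<in>{..<n}. X i \<omega>)"
definition xiv :: "'a \<Rightarrow> nat \<Rightarrow> real" where "xiv \<omega> = (\<lambda>i\<in>{..<n}. \<xi> i \<omega>)"

lemma Xv_measurable: "Xv \<in> M \<rightarrow>\<^sub>M PiM {..<n} (\<lambda>_. Rn p)"
  unfolding Xv_def by (intro measurable_restrict) (auto intro: X_measurable)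

lemma xiv_measurable: "xiv \<in> M \<rightarrow>\<^sub>M PiM {..<n} (\<lambda>_. borel)"
  unfolding xiv_def by (intro measurable_restrict) (auto intro: xi_measurable)

lemma law_Xv: "distr M (PiM {..<n} (\<lambda>_. \<mu>)) Xv = PiM {..<n} (\<lambda>_. \<mu>)"
proof -
  have "distr M (PiM {..<n} (\<lambda>_. Rn p)) (\<lambda>\<omega>. \<lambda>i\<in>{..<n}. X i \<omega>) = PiM {..<n} (\<lambda>i. distr M (Rn p) (X i))"
    using index_nonempty indep_X X_measurable by (subst indep_vars_iff_distr_eq_PiM'[symmetric]) auto
  also have "\<dots> = PiM {..<n} (\<lambda>_. \<mu>)" by (intro PiM_cong) (auto simp: law_X_eq)
  finally show ?thesis unfolding Xv_def
    by (subst distr_cong[OF refl _ refl]) (auto intro!: sets_PiM_cong simp: mu)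
qed

text \<open>Independence holds across \<open>i\<close> by hypothesis and within each pair by the
  product law. On rectangles both combine to a product of \<open>2 * n\<close> factors, and
  rectangles are generators stable under intersection.\<close>

lemma indep_Xv_xiv:
  assumes A: "A \<in> sets (PiM {..<n} (\<lambda>_. Rn p))" and B: "B \<in> sets (PiM {..<n} (\<lambda>_. borel))"
  shows "prob ({\<omega> \<in> space M. Xv \<omega> \<in> A} \<inter> {\<omega> \<in> space M. xiv \<omega> \<in> B}) =
    prob {\<omega> \<in> space M. Xv \<omega> \<in> A} * prob {\<omega> \<in> space M. xiv \<omega> \<in> B}"
proof -
  define GX where "GX = {Xv -` C \<inter> space M | C. C \<in> {PiE {..<n} E | E. E \<in> (\<Pi> i\<in>{..<n}. sets (Rn p))}}"
  define GE where "GE = {xiv -` C \<inter> space M | C. C \<in> {PiE {..<n} E | E. E \<in> (\<Pi> i\<in>{..<n}. sets (borel :: real measure))}}"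
  have Xv_in: "Xv \<in> space M \<rightarrow> (\<Pi>\<^sub>E i\<in>{..<n}. space (Rn p))"
    using measurable_space[OF Xv_measurable] by (auto simp: space_PiM)
  have xiv_in: "xiv \<in> space M \<rightarrow> (\<Pi>\<^sub>E i\<in>{..<n}. space (borel :: real measure))"
    using measurable_space[OF xiv_measurable] by (auto simp: space_PiM)
  have sX: "{Xv -` C \<inter> space M | C. C \<in> sets (PiM {..<n} (\<lambda>_. Rn p))} = sigma_sets (space M) GX"
    unfolding sets_PiM prod_algebra_eq_finite[OF finite_lessThan] GX_def
    by (rule sigma_sets_vimage_commute[OF Xv_in])
  have sE: "{xiv -` C \<inter> space M | C. C \<in> sets (PiM {..<n} (\<lambda>_. borel :: real measure))} = sigma_sets (space M) GE"
    unfolding sets_PiM prod_algebra_eq_finite[OF finite_lessThan] GE_def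
    by (rule sigma_sets_vimage_commute[OF xiv_in])
  have "indep_set GX GE"
    unfolding indep_sets2_eq
  proof (intro conjI ballI)
    show "GX \<subseteq> events"
      unfolding GX_def by (auto intro!: measurable_sets[OF Xv_measurable] sets_PiM_I_finite)
    show "GE \<subseteq> events"
      unfolding GE_def by (auto intro!: measurable_sets[OF xiv_measurable] sets_PiM_I_finite)
    fix a b assume "a \<in> GX" "b \<in> GE"
    then obtain E F where E: "a = Xv -` PiE {..<n} E \<inter> space M" "\<And>i. i < n \<Longrightarrow> E i \<in> sets (Rn p)"
      and F: "b = xiv -` PiE {..<n} F \<inter> space M" "\<And>i. i < n \<Longrightarrow> F i \<in> sets (borel :: real measure)"
      unfolding GX_def GE_def by (auto simp: Pi_iff)
    have rect: "prob (\<Inter>i\<in>{..<n}. (\<lambda>\<omega>. (X i \<omega>, \<xi> i \<omega>)) -` (E' i \<times> F' i) \<inter> space M)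
        = (\<Prod>i<n. measure \<mu> (E' i)) * (\<Prod>i<n. measure \<nu> (F' i))"
      if "\<And>i. i < n \<Longrightarrow> E' i \<in> sets (Rn p)" "\<And>i. i < n \<Longrightarrow> F' i \<in> sets (borel :: real measure)" for E' F'
    proof -
      have "prob (\<Inter>i\<in>{..<n}. (\<lambda>\<omega>. (X i \<omega>, \<xi> i \<omega>)) -` (E' i \<times> F' i) \<inter> space M) =
          (\<Prod>i<n. prob ((\<lambda>\<omega>. (X i \<omega>, \<xi> i \<omega>)) -` (E' i \<times> F' i) \<inter> space M))"
        using index_nonempty that by (intro indep_varsD_finite[OF indep_pairs]) auto
      also have "\<dots> = (\<Prod>i<n. measure \<mu> (E' i) * measure \<nu> (F' i))"
      proof (rule prod.cong[OF refl])
        fix i assume "i \<in> {..<n}"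
        then show "prob ((\<lambda>\<omega>. (X i \<omega>, \<xi> i \<omega>)) -` (E' i \<times> F' i) \<inter> space M) = measure \<mu> (E' i) * measure \<nu> (F' i)"
          using rectangle_prob[of i "E' i" "F' i"] that[of i]
          by (simp add: vimage_def Int_def conj_commute)
      qed
      finally show ?thesis by (simp add: prod.distrib)
    qed
    have sp: "X i \<omega> \<in> space (Rn p)" if "i < n" "\<omega> \<in> space M" for i \<omega>
      using measurable_space[OF X_measurable] that by auto
    note ne = index_nonempty
    \<comment> \<open>An event about one of the two vectors is a rectangle whose other sides are
      full, so \<open>rect\<close> yields all three probabilities.\<close>
    have a: "a = (\<Inter>i\<in>{..<n}. (\<lambda>\<omega>. (X i \<omega>, \<xi> i \<omega>)) -` (E i \<times> UNIV) \<inter> space M)"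
      unfolding E using ne by (auto simp: Xv_def PiE_iff)
    have b: "b = (\<Inter>i\<in>{..<n}. (\<lambda>\<omega>. (X i \<omega>, \<xi> i \<omega>)) -` (space (Rn p) \<times> F i) \<inter> space M)"
      unfolding F using ne sp by (auto simp: xiv_def PiE_iff)
    have ab: "a \<inter> b = (\<Inter>i\<in>{..<n}. (\<lambda>\<omega>. (X i \<omega>, \<xi> i \<omega>)) -` (E i \<times> F i) \<inter> space M)"
      unfolding E F using ne by (auto simp: xiv_def Xv_def PiE_iff)
    have "measure \<mu> (space (Rn p)) = 1" "measure \<nu> UNIV = 1"
      using prob_space.prob_space[OF mu(1)] prob_space.prob_space[OF nu(1)] sets_eq_imp_space_eq[OF mu(2)]
        sets_eq_imp_space_eq[OF nu(2)] by auto
    then have "prob a = (\<Prod>i<n. measure \<mu> (E i))" "prob b = (\<Prod>i<n. measure \<nu> (F i))"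
      unfolding a b using E(2) F(2) by (subst rect; simp)+
    then show "prob (a \<inter> b) = prob a * prob b"
      unfolding ab using E(2) F(2) by (subst rect) auto
  qed
  moreover have "Int_stable GX"
  proof (rule Int_stableI)
    fix a b assume "a \<in> GX" "b \<in> GX"
    then obtain E F where E: "a = Xv -` PiE {..<n} E \<inter> space M" "E \<in> (\<Pi> i\<in>{..<n}. sets (Rn p))"
      and F: "b = Xv -` PiE {..<n} F \<inter> space M" "F \<in> (\<Pi> i\<in>{..<n}. sets (Rn p))"
      unfolding GX_def by blast
    have "a \<inter> b = Xv -` PiE {..<n} (\<lambda>i. E i \<inter> F i) \<inter> space M" unfolding E F by auto
    moreover have "(\<lambda>i. E i \<inter> F i) \<in> (\<Pi> i\<in>{..<n}. sets (Rn p))" using E F by auto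
    ultimately show "a \<inter> b \<in> GX" unfolding GX_def by blast
  qed
  moreover have "Int_stable GE"
  proof (rule Int_stableI)
    fix a b assume "a \<in> GE" "b \<in> GE"
    then obtain E F where E: "a = xiv -` PiE {..<n} E \<inter> space M" "E \<in> (\<Pi> i\<in>{..<n}. sets (borel :: real measure))"
      and F: "b = xiv -` PiE {..<n} F \<inter> space M" "F \<in> (\<Pi> i\<in>{..<n}. sets (borel :: real measure))"
      unfolding GE_def by blast
    have "a \<inter> b = xiv -` PiE {..<n} (\<lambda>i. E i \<inter> F i) \<inter> space M" unfolding E F by auto
    moreover have "(\<lambda>i. E i \<inter> F i) \<in> (\<Pi> i\<in>{..<n}. sets (borel :: real measure))" using E F by auto
    ultimately show "a \<inter> b \<in> GE" unfolding GE_def by blast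
  qed
  ultimately have "indep_set (sigma_sets (space M) GX) (sigma_sets (space M) GE)"
    by (rule indep_set_sigma_sets)
  then have ind: "\<And>a b. a \<in> sigma_sets (space M) GX \<Longrightarrow> b \<in> sigma_sets (space M) GE \<Longrightarrow> prob (a \<inter> b) = prob a * prob b"
    unfolding indep_sets2_eq by blast
  have "{\<omega> \<in> space M. Xv \<omega> \<in> A} \<in> sigma_sets (space M) GX"
    unfolding sX[symmetric] using A by (auto intro!: exI[of _ A])
  moreover have "{\<omega> \<in> space M. xiv \<omega> \<in> B} \<in> sigma_sets (space M) GE"
    unfolding sE[symmetric] using B by (auto intro!: exI[of _ B])
  ultimately show ?thesis by (rule ind)
qed

text \<open>A conditional union bound without conditional probabilities. The sum formally runs over
  all subsets, but by independence each contributes \<open>q\<close> times the probability of being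
  realised, and these probabilities add up to the expected number of realised sets, at most
  \<open>K\<close>.\<close>

lemma union_bound_patterns:
  assumes T: "\<And>T. {x \<in> space (PiM {..<n} (\<lambda>_. Rn p)). T \<in> \<T> x} \<in> sets (PiM {..<n} (\<lambda>_. Rn p))"
    and sub: "\<And>x. \<T> x \<subseteq> Pow {..<n}"
    and cardT: "\<And>x. x \<in> space (PiM {..<n} (\<lambda>_. Rn p)) \<Longrightarrow> real (card (\<T> x)) \<le> K"
    and B: "\<And>T. T \<subseteq> {..<n} \<Longrightarrow> B T \<in> sets (PiM {..<n} (\<lambda>_. borel :: real measure))"
    and q: "\<And>T. T \<subseteq> {..<n} \<Longrightarrow> prob {\<omega> \<in> space M. xiv \<omega> \<in> B T} \<le> q" "0 \<le> q"
  shows "{\<omega> \<in> space M. \<exists>T\<in>\<T> (Xv \<omega>). xiv \<omega> \<in> B T} \<in> events"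
    and "prob {\<omega> \<in> space M. \<exists>T\<in>\<T> (Xv \<omega>). xiv \<omega> \<in> B T} \<le> K * q"
proof -
  let ?S = "\<lambda>T. {x \<in> space (PiM {..<n} (\<lambda>_. Rn p)). T \<in> \<T> x}"
  let ?X = "\<lambda>T. {\<omega> \<in> space M. Xv \<omega> \<in> ?S T}"
  let ?E = "\<lambda>T. {\<omega> \<in> space M. xiv \<omega> \<in> B T}"
  have Xsp: "Xv \<omega> \<in> space (PiM {..<n} (\<lambda>_. Rn p))" if "\<omega> \<in> space M" for \<omega>
    using measurable_space[OF Xv_measurable that] .
  have ev: "?X T \<in> events" for T
    using measurable_sets[OF Xv_measurable T] by (simp add: vimage_def Int_def conj_commute)
  have ev2: "?E T \<in> events" if "T \<subseteq> {..<n}" for T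
    using measurable_sets[OF xiv_measurable B[OF that]] by (simp add: vimage_def Int_def conj_commute)
  have eq: "{\<omega> \<in> space M. \<exists>T\<in>\<T> (Xv \<omega>). xiv \<omega> \<in> B T} = (\<Union>T\<in>Pow {..<n}. ?X T \<inter> ?E T)"
    using sub Xsp by blast
  show "{\<omega> \<in> space M. \<exists>T\<in>\<T> (Xv \<omega>). xiv \<omega> \<in> B T} \<in> events"
    unfolding eq using ev ev2 by (intro sets.finite_UN sets.Int) auto
  have "prob (\<Union>T\<in>Pow {..<n}. ?X T \<inter> ?E T) \<le> (\<Sum>T\<in>Pow {..<n}. prob (?X T \<inter> ?E T))"
    using ev ev2 by (intro finite_measure_subadditive_finite) auto
  also have "\<dots> \<le> (\<Sum>T\<in>Pow {..<n}. prob (?X T) * q)"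
  proof (rule sum_mono)
    fix T assume T': "T \<in> Pow {..<n}"
    have "prob (?X T \<inter> ?E T) = prob (?X T) * prob (?E T)"
      using T' by (intro indep_Xv_xiv T B) auto
    also have "\<dots> \<le> prob (?X T) * q" using q T' by (intro mult_left_mono) auto
    finally show "prob (?X T \<inter> ?E T) \<le> prob (?X T) * q" .
  qed
  also have "\<dots> = (\<Sum>T\<in>Pow {..<n}. prob (?X T)) * q" by (simp add: sum_distrib_right)
  also have "(\<Sum>T\<in>Pow {..<n}. prob (?X T)) = (\<Sum>T\<in>Pow {..<n}. expectation (indicator (?X T)))"
    using ev by simp
  also have "\<dots> = expectation (\<lambda>\<omega>. \<Sum>T\<in>Pow {..<n}. indicator (?X T) \<omega>)"
    using ev by (subst Bochner_Integration.integral_sum) (auto simp: emeasure_eq_measure)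
  also have "\<dots> \<le> expectation (\<lambda>\<omega>. K)"
  proof (rule integral_mono)
    show "integrable M (\<lambda>\<omega>. \<Sum>T\<in>Pow {..<n}. indicat_real (?X T) \<omega>)"
      using ev by (intro Bochner_Integration.integrable_sum) (auto simp: emeasure_eq_measure)
    fix \<omega> assume w: "\<omega> \<in> space M"
    have "(\<Sum>T\<in>Pow {..<n}. indicat_real (?X T) \<omega>) = (\<Sum>T\<in>Pow {..<n}. if T \<in> \<T> (Xv \<omega>) then 1 else 0)"
      using w Xsp by (intro sum.cong) (auto simp: indicator_def)
    also have "\<dots> = real (card (\<T> (Xv \<omega>)))"
      using sub[of "Xv \<omega>"] by (simp add: sum.If_cases Int_absorb1)
    also have "\<dots> \<le> K" by (rule cardT[OF Xsp[OF w]])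
    finally show "(\<Sum>T\<in>Pow {..<n}. indicat_real (?X T) \<omega>) \<le> K" .
  qed simp
  also have "\<dots> = K" by (simp add: prob_space)
  finally show "prob {\<omega> \<in> space M. \<exists>T\<in>\<T> (Xv \<omega>). xiv \<omega> \<in> B T} \<le> K * q"
    unfolding eq using q(2) by (simp add: mult_right_mono)
qed

end

section \<open>A ghost sample bound for wedges\<close>

text \<open>The sample occupies the indices below \<open>n\<close>, its ghost the next
  \<open>n\<close>; \<open>\<sigma>\<close> lists the positions at which the two are
  exchanged.\<close>

definition swap_index :: "nat \<Rightarrow> nat set \<Rightarrow> nat \<Rightarrow> nat" where
  "swap_index n \<sigma> i = (if i < n then (if i \<in> \<sigma> then n + i else i) else (if i - n \<in> \<sigma> then i - n else i))"

definition swap_set :: "nat \<Rightarrow> nat set \<Rightarrow> nat set \<Rightarrow> nat set" where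
  "swap_set n \<sigma> T = {i\<in>{..<2 * n}. swap_index n \<sigma> i \<in> T}"

text \<open>The ratio 4 is that of the two counts to be confronted: for a wedge of probability
  \<open>a\<close> a violating sample has fewer than \<open>n * a / 8\<close> hits, a typical ghost
  sample more than \<open>n * a / 2\<close>.\<close>

definition unbalanced :: "nat \<Rightarrow> real \<Rightarrow> nat set \<Rightarrow> bool" where
  "unbalanced n w T \<longleftrightarrow> w \<le> real (card (T \<inter> {n..<2 * n})) \<and>
     4 * real (card (T \<inter> {..<n})) \<le> real (card (T \<inter> {n..<2 * n}))"

lemma swap_index_less: "\<sigma> \<subseteq> {..<n} \<Longrightarrow> i < 2 * n \<Longrightarrow> swap_index n \<sigma> i < 2 * n"
  by (auto simp: swap_index_def)

lemma swap_index_swap_index: "\<sigma> \<subseteq> {..<n} \<Longrightarrow> swap_index n \<sigma> (swap_index n \<sigma> i) = i"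
  by (auto simp: swap_index_def)

lemma inj_swap_index: "\<sigma> \<subseteq> {..<n} \<Longrightarrow> inj_on (swap_index n \<sigma>) A"
  by (metis inj_on_inverseI swap_index_swap_index)

lemma card_swap_set:
  assumes "\<sigma> \<subseteq> {..<n}"
  shows "real (card (swap_set n \<sigma> T \<inter> {..<n})) = (\<Sum>i<n. if i \<in> \<sigma> then of_bool (n + i \<in> T) else of_bool (i \<in> T))"
    and "real (card (swap_set n \<sigma> T \<inter> {n..<2 * n})) = (\<Sum>i<n. if i \<in> \<sigma> then of_bool (i \<in> T) else of_bool (n + i \<in> T))"
proof -
  have "swap_set n \<sigma> T \<inter> {..<n} = {i\<in>{..<n}. if i \<in> \<sigma> then n + i \<in> T else i \<in> T}"
    by (auto simp: swap_set_def swap_index_def)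
  then have "real (card (swap_set n \<sigma> T \<inter> {..<n})) = (\<Sum>i<n. if (if i \<in> \<sigma> then n + i \<in> T else i \<in> T) then 1 else 0)"
    by (simp add: sum.If_cases Int_def)
  also have "\<dots> = (\<Sum>i<n. if i \<in> \<sigma> then of_bool (n + i \<in> T) else of_bool (i \<in> T))"
    by (intro sum.cong) auto
  finally show "real (card (swap_set n \<sigma> T \<inter> {..<n})) = (\<Sum>i<n. if i \<in> \<sigma> then of_bool (n + i \<in> T) else of_bool (i \<in> T))" .
  have "swap_set n \<sigma> T \<inter> {n..<2 * n} = (\<lambda>i. n + i) ` {i\<in>{..<n}. if i \<in> \<sigma> then i \<in> T else n + i \<in> T}"
  proof (intro set_eqI iffI)
    fix i assume i: "i \<in> swap_set n \<sigma> T \<inter> {n..<2 * n}"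
    then have "i - n \<in> {i\<in>{..<n}. if i \<in> \<sigma> then i \<in> T else n + i \<in> T}" "i = n + (i - n)"
      by (auto simp: swap_set_def swap_index_def split: if_splits)
    then show "i \<in> (\<lambda>i. n + i) ` {i\<in>{..<n}. if i \<in> \<sigma> then i \<in> T else n + i \<in> T}" by blast
  qed (auto simp: swap_set_def swap_index_def split: if_splits)
  then have "card (swap_set n \<sigma> T \<inter> {n..<2 * n}) = card {i\<in>{..<n}. if i \<in> \<sigma> then i \<in> T else n + i \<in> T}"
    by (simp add: card_image)
  then have "real (card (swap_set n \<sigma> T \<inter> {n..<2 * n})) = (\<Sum>i<n. if (if i \<in> \<sigma> then i \<in> T else n + i \<in> T) then 1 else 0)"
    by (simp add: sum.If_cases Int_def)
  also have "\<dots> = (\<Sum>i<n. if i \<in> \<sigma> then of_bool (i \<in> T) else of_bool (n + i \<in> T))"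
    by (intro sum.cong) auto
  finally show "real (card (swap_set n \<sigma> T \<inter> {n..<2 * n})) = (\<Sum>i<n. if i \<in> \<sigma> then of_bool (i \<in> T) else of_bool (n + i \<in> T))" .
qed

text \<open>Exponential Markov inequality for a uniformly chosen set of swaps. A count at least 4
  times the other exceeds it by at least 3/5 of their sum, which is unlikely because each pair is
  oriented either way equally often.\<close>

lemma card_unbalanced_swaps_le:
  "real (card {\<sigma>\<in>Pow {..<n}. unbalanced n w (swap_set n \<sigma> T)}) \<le> 2 ^ n * exp (- w / 16)"
proof -
  define a where "a = (\<lambda>i. of_bool (i \<in> T) :: real)"
  define b where "b = (\<lambda>i. of_bool (n + i \<in> T) :: real)"
  define W where "W = (\<Sum>i<n. a i + b i)"
  define f1 where "f1 = (\<lambda>i. exp (1/5 * (a i - b i - 3/5 * (a i + b i))))"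
  define f2 where "f2 = (\<lambda>i. exp (1/5 * (b i - a i - 3/5 * (a i + b i))))"
  \<comment> \<open>The tilt is 1/5. A pair with exactly one hit contributes at most 1.09 + 0.785,
    which is twice 15/16, and 15/16 is below \<open>exp (- 1/16)\<close>.\<close>
  have pair: "f1 i + f2 i \<le> 2 * exp (- (a i + b i) / 16)" for i
  proof -
    have e1: "exp (2/25 :: real) \<le> 109/100" using exp_le_quadratic[of "2/25"] by (simp add: power2_eq_square)
    have e2: "exp (- (8/25) :: real) \<le> 785/1000" using exp_le_quadratic[of "- (8/25)"] by (simp add: power2_eq_square)
    have e3: "(15/16 :: real) \<le> exp (- 1/16)" using exp_ge_add_one_self[of "- 1/16 :: real"] by simp
    have e4: "exp (- (6/25) :: real) \<le> exp (- (1/8))" by simp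
    consider "a i = 0 \<and> b i = 0" | "a i = 1 \<and> b i = 0" | "a i = 0 \<and> b i = 1" | "a i = 1 \<and> b i = 1"
      by (auto simp: a_def b_def)
    then show ?thesis using e1 e2 e3 e4 unfolding f1_def f2_def by cases auto
  qed
  have exp_sum': "(\<Prod>i\<in>\<sigma>. f1 i) * (\<Prod>i\<in>{..<n} - \<sigma>. f2 i) =
     exp (1/5 * ((\<Sum>i<n. if i \<in> \<sigma> then a i else b i) - (\<Sum>i<n. if i \<in> \<sigma> then b i else a i) - 3/5 * W))"
    if s: "\<sigma> \<in> Pow {..<n}" for \<sigma>
  proof -
    have fs: "finite \<sigma>" using s finite_subset by blast
    have "(\<Prod>i\<in>\<sigma>. f1 i) * (\<Prod>i\<in>{..<n} - \<sigma>. f2 i) = (\<Prod>i<n. if i \<in> \<sigma> then f1 i else f2 i)"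
      using s by (simp add: prod.If_cases Int_absorb1 Diff_eq)
    also have "\<dots> = (\<Prod>i<n. exp (1/5 * ((if i \<in> \<sigma> then a i else b i) - (if i \<in> \<sigma> then b i else a i) - 3/5 * (a i + b i))))"
      by (intro prod.cong) (auto simp: f1_def f2_def)
    also have "\<dots> = exp (\<Sum>i<n. 1/5 * ((if i \<in> \<sigma> then a i else b i) - (if i \<in> \<sigma> then b i else a i) - 3/5 * (a i + b i)))"
      by (simp add: exp_sum)
    also have "(\<Sum>i<n. 1/5 * ((if i \<in> \<sigma> then a i else b i) - (if i \<in> \<sigma> then b i else a i) - 3/5 * (a i + b i)))
      = 1/5 * ((\<Sum>i<n. if i \<in> \<sigma> then a i else b i) - (\<Sum>i<n. if i \<in> \<sigma> then b i else a i) - 3/5 * W)"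
      unfolding W_def sum_distrib_left[symmetric] sum_subtractf by simp
    finally show ?thesis .
  qed
  have tot: "(\<Sum>i<n. if i \<in> \<sigma> then a i else b i) + (\<Sum>i<n. if i \<in> \<sigma> then b i else a i) = W" for \<sigma>
    unfolding W_def sum.distrib[symmetric] by (intro sum.cong) auto
  have unb: "w \<le> W \<and> 1 \<le> (\<Prod>i\<in>\<sigma>. f1 i) * (\<Prod>i\<in>{..<n} - \<sigma>. f2 i)"
    if s: "\<sigma> \<in> Pow {..<n}" "unbalanced n w (swap_set n \<sigma> T)" for \<sigma>
  proof -
    define hi where "hi = (\<Sum>i<n. if i \<in> \<sigma> then a i else b i)"
    define lo where "lo = (\<Sum>i<n. if i \<in> \<sigma> then b i else a i)"
    have "real (card (swap_set n \<sigma> T \<inter> {..<n})) = lo" "real (card (swap_set n \<sigma> T \<inter> {n..<2 * n})) = hi"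
      unfolding lo_def hi_def a_def b_def using s(1) card_swap_set[of \<sigma> n T] by auto
    then have "w \<le> hi" "4 * lo \<le> hi" using s(2) by (simp_all add: unbalanced_def)
    moreover have "0 \<le> lo" by (auto simp: lo_def a_def b_def intro!: sum_nonneg)
    moreover have "hi + lo = W" using tot by (simp add: hi_def lo_def)
    ultimately have "w \<le> W" "0 \<le> hi - lo - 3/5 * W" by argo+
    then show ?thesis unfolding exp_sum'[OF s(1)] by (simp add: hi_def lo_def)
  qed
  show ?thesis
  proof (cases "w \<le> W")
    case True
    have "real (card {\<sigma>\<in>Pow {..<n}. unbalanced n w (swap_set n \<sigma> T)}) = (\<Sum>\<sigma> | \<sigma> \<in> Pow {..<n} \<and> unbalanced n w (swap_set n \<sigma> T). 1)"
      by simp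
    also have "\<dots> \<le> (\<Sum>\<sigma> | \<sigma> \<in> Pow {..<n} \<and> unbalanced n w (swap_set n \<sigma> T). (\<Prod>i\<in>\<sigma>. f1 i) * (\<Prod>i\<in>{..<n} - \<sigma>. f2 i))"
      using unb by (intro sum_mono) blast
    also have "\<dots> \<le> (\<Sum>\<sigma>\<in>Pow {..<n}. (\<Prod>i\<in>\<sigma>. f1 i) * (\<Prod>i\<in>{..<n} - \<sigma>. f2 i))"
      by (intro sum_mono2) (auto simp: f1_def f2_def intro!: mult_nonneg_nonneg prod_nonneg)
    also have "\<dots> = (\<Prod>i<n. f1 i + f2 i)" by (rule prod_add[symmetric]) simp
    also have "\<dots> \<le> (\<Prod>i<n. 2 * exp (- (a i + b i) / 16))"
      using pair by (intro prod_mono) (auto simp: f1_def f2_def intro!: add_nonneg_nonneg)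
    also have "\<dots> = 2 ^ n * exp (- W / 16)"
      by (simp add: prod.distrib W_def sum_divide_distrib sum_negf[symmetric] flip: exp_sum)
    also have "\<dots> \<le> 2 ^ n * exp (- w / 16)" using True by simp
    finally show ?thesis .
  next
    case False
    then have "{\<sigma>\<in>Pow {..<n}. unbalanced n w (swap_set n \<sigma> T)} = {}" using unb by blast
    then show ?thesis by (simp only: card.empty) simp
  qed
qed

definition wedge_set :: "(nat \<Rightarrow> real) measure \<Rightarrow> nat \<Rightarrow> (nat \<Rightarrow> real) \<Rightarrow> (nat \<Rightarrow> real) \<Rightarrow> (nat \<Rightarrow> real) set" where
  "wedge_set \<mu> p d d0 = {x \<in> space \<mu>. sign_pm (dot p x d) \<noteq> sign_pm (dot p x d0)}"

abbreviation sdiff :: "nat set \<Rightarrow> nat set \<Rightarrow> nat set" where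
  "sdiff P S \<equiv> (P - S) \<union> (S - P)"

lemma sdiff_hs_pattern:
  assumes "\<And>i. i < N \<Longrightarrow> x i \<in> space \<mu>"
  shows "sdiff (hs_pattern N p x d) (hs_pattern N p x d0) = {i\<in>{..<N}. x i \<in> wedge_set \<mu> p d d0}"
  using assms by (auto simp: hs_pattern_def wedge_set_def sign_pm_def)

lemma wedge_set_measurable:
  assumes "sets \<mu> = sets (Rn p)" shows "wedge_set \<mu> p d d0 \<in> sets \<mu>"
proof -
  have [measurable]: "(\<lambda>x. dot p x d) \<in> borel_measurable \<mu>" "(\<lambda>x. dot p x d0) \<in> borel_measurable \<mu>"
    using dot_measurable measurable_cong_sets[OF assms refl] by blast+
  have "wedge_set \<mu> p d d0 = {x \<in> space \<mu>. (0 < dot p x d) \<noteq> (0 < dot p x d0)}"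
    by (auto simp: wedge_set_def sign_pm_def)
  also have "\<dots> \<in> sets \<mu>" by measurable
  finally show ?thesis .
qed

text \<open>Symmetrization: a violation for the sample \<open>x\<close> makes half of all ghost samples unbalanced, and
  swapping sample and ghost points at random shows that unbalanced pairs are rare. The violating
  sections form a measurable set although the supremum over directions is uncountable.\<close>

lemma ghost_sample_bound:
  assumes \<mu>: "prob_space \<mu>" "sets \<mu> = sets (Rn p)" and n: "1 \<le> n"
    and K: "\<forall>z\<in>space (PiM {..<2 * n} (\<lambda>_. Rn p)).
      real (card (hs_pattern (2 * n) p z ` sparse_dirs p m)) \<le> K"
    and u: "8 \<le> real n * u"
  shows "\<exists>B\<in>sets (PiM {..<n} (\<lambda>_. \<mu>)).
    measure (PiM {..<n} (\<lambda>_. \<mu>)) B \<le> 2 * K * exp (- real n * u / 32) \<and>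
    (\<forall>x\<in>space (PiM {..<n} (\<lambda>_. \<mu>)) - B. \<forall>d\<in>sparse_dirs p m. u \<le> measure \<mu> (wedge_set \<mu> p d d0) \<longrightarrow>
       real n * measure \<mu> (wedge_set \<mu> p d d0) / 8 \<le> real (card {i\<in>{..<n}. x i \<in> wedge_set \<mu> p d d0}))"
proof -
  interpret mu: prob_space \<mu> by fact
  interpret ps: product_prob_space "\<lambda>_. \<mu>" UNIV by standard
  define P1 where "P1 = PiM {..<n} (\<lambda>_. \<mu>)"
  define Q where "Q = PiM {n..<2 * n} (\<lambda>_. \<mu>)"
  define P2 where "P2 = PiM {..<2 * n} (\<lambda>_. \<mu>)"
  have un: "{..<n} \<union> {n..<2 * n} = {..<2 * n}" by auto
  interpret P1: prob_space P1 unfolding P1_def by (rule prob_space_PiM) (rule \<mu>(1))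
  interpret Q: prob_space Q unfolding Q_def by (rule prob_space_PiM) (rule \<mu>(1))
  interpret P2: prob_space P2 unfolding P2_def by (rule prob_space_PiM) (rule \<mu>(1))
  have setsP2: "sets P2 = sets (PiM {..<2 * n} (\<lambda>_. Rn p))" unfolding P2_def by (intro sets_PiM_cong) (auto simp: \<mu>)
  have spP2: "space P2 = space (PiM {..<2 * n} (\<lambda>_. Rn p))" by (rule sets_eq_imp_space_eq[OF setsP2])
  \<comment> \<open>Half of the hits to be expected from a wedge of probability
    \<open>u\<close>.\<close>
  define w where "w = real n * u / 2"
  define \<T> where "\<T> = side_pattern sdiff (2 * n) p m d0"
  have T_sub: "\<T> z \<subseteq> Pow {..<2 * n}" for z by (auto simp: \<T>_def side_pattern_def hs_pattern_def)
  have T_fin: "finite (\<T> z)" for z unfolding \<T>_def by (rule finite_side_pattern)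
  have T_card: "real (card (\<T> z)) \<le> K" if "z \<in> space P2" for z
    using card_side_pattern_le[of sdiff "2*n" p m d0 z] bspec[OF K, of z] that unfolding \<T>_def spP2 by linarith
  define G where "G = {z \<in> space P2. \<exists>T\<in>\<T> z. unbalanced n w T}"
  have Gsets: "G \<in> sets P2"
  proof -
    have "G = (\<Union>T\<in>{T\<in>Pow {..<2 * n}. unbalanced n w T}. {z \<in> space P2. T \<in> \<T> z})"
      unfolding G_def using T_sub by blast
    moreover have "{z \<in> space P2. T \<in> \<T> z} \<in> sets P2" for T
      using side_pattern_measurable unfolding setsP2 spP2 \<T>_def .
    ultimately show ?thesis by (auto intro!: sets.finite_UN)
  qed
  define sw where "sw = (\<lambda>\<sigma> (z :: nat \<Rightarrow> nat \<Rightarrow> real). \<lambda>i\<in>{..<2 * n}. z (swap_index n \<sigma> i))"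
  have law: "distr P2 P2 (sw \<sigma>) = P2" if "\<sigma> \<in> Pow {..<n}" for \<sigma>
    using distr_PiM_reindex[of "{..<2 * n}" "\<lambda>_. \<mu>" "swap_index n \<sigma>" "{..<2 * n}"] that \<mu>(1)
      inj_swap_index swap_index_less unfolding P2_def sw_def by auto
  have sw_meas: "sw \<sigma> \<in> P2 \<rightarrow>\<^sub>M P2" if "\<sigma> \<in> Pow {..<n}" for \<sigma>
    unfolding P2_def sw_def using that swap_index_less[of \<sigma> n]
    by (intro measurable_restrict measurable_component_singleton) auto
  \<comment> \<open>Swapping points permutes indices, so the realised sets are permuted as well and
    one family of at most \<open>K\<close> sets serves all swaps.\<close>
  have T_sw: "\<T> (sw \<sigma> z) = swap_set n \<sigma> ` \<T> z" if s: "\<sigma> \<in> Pow {..<n}" for \<sigma> z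
  proof -
    have 1: "hs_pattern (2 * n) p (sw \<sigma> z) d = swap_set n \<sigma> (hs_pattern (2 * n) p z d)" for d
      using s swap_index_less[of \<sigma> n] by (auto simp: hs_pattern_def swap_set_def sw_def)
    have 2: "sdiff (swap_set n \<sigma> A) (swap_set n \<sigma> B) = swap_set n \<sigma> (sdiff A B)" for A B
      by (auto simp: swap_set_def)
    show ?thesis unfolding \<T>_def side_pattern_def 1 2 by (simp add: image_image)
  qed
  have pointwise: "(\<Sum>\<sigma>\<in>Pow {..<n}. indicat_real {z \<in> space P2. sw \<sigma> z \<in> G} z) \<le> K * (2 ^ n * exp (- w / 16))"
    if z: "z \<in> space P2" for z
  proof -
    have "(\<Sum>\<sigma>\<in>Pow {..<n}. indicat_real {z \<in> space P2. sw \<sigma> z \<in> G} z)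
        \<le> (\<Sum>\<sigma>\<in>Pow {..<n}. \<Sum>T\<in>\<T> z. if unbalanced n w (swap_set n \<sigma> T) then 1 else 0)"
    proof (rule sum_mono)
      fix \<sigma> assume s: "\<sigma> \<in> Pow {..<n}"
      show "indicat_real {z \<in> space P2. sw \<sigma> z \<in> G} z \<le> (\<Sum>T\<in>\<T> z. if unbalanced n w (swap_set n \<sigma> T) then 1 else 0)"
      proof (cases "sw \<sigma> z \<in> G")
        case True
        then have "\<exists>T\<in>\<T> (sw \<sigma> z). unbalanced n w T" by (simp add: G_def)
        then obtain T where T: "T \<in> \<T> z" "unbalanced n w (swap_set n \<sigma> T)"
          unfolding T_sw[OF s] by blast
        have "(1::real) \<le> (\<Sum>T\<in>{T}. if unbalanced n w (swap_set n \<sigma> T) then 1 else 0)" using T by simp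
        also have "\<dots> \<le> (\<Sum>T\<in>\<T> z. if unbalanced n w (swap_set n \<sigma> T) then 1 else 0)"
          using T T_fin by (intro sum_mono2) auto
        finally show ?thesis by (simp add: indicator_def)
      qed (auto intro!: sum_nonneg)
    qed
    also have "\<dots> = (\<Sum>T\<in>\<T> z. \<Sum>\<sigma>\<in>Pow {..<n}. if unbalanced n w (swap_set n \<sigma> T) then 1 else 0)"
      by (rule sum.swap)
    also have "\<dots> = (\<Sum>T\<in>\<T> z. real (card {\<sigma>\<in>Pow {..<n}. unbalanced n w (swap_set n \<sigma> T)}))"
      by (intro sum.cong refl) (simp add: sum.If_cases Int_def)
    also have "\<dots> \<le> (\<Sum>T\<in>\<T> z. 2 ^ n * exp (- w / 16))"
      by (intro sum_mono card_unbalanced_swaps_le)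
    also have "\<dots> = real (card (\<T> z)) * (2 ^ n * exp (- w / 16))" by simp
    also have "\<dots> \<le> K * (2 ^ n * exp (- w / 16))" using T_card[OF z] by (intro mult_right_mono) auto
    finally show ?thesis .
  qed
  have swG: "{z \<in> space P2. sw \<sigma> z \<in> G} \<in> P2.events" if "\<sigma> \<in> Pow {..<n}" for \<sigma>
    using measurable_sets[OF sw_meas[OF that] Gsets] by (simp add: vimage_def Int_def conj_commute)
  \<comment> \<open>Every swap preserves the law, so the probability of \<open>G\<close> is an
    average over swaps; for a fixed double sample that average is a counting problem.\<close>
  have "2 ^ n * P2.prob G = (\<Sum>\<sigma>\<in>Pow {..<n}. P2.prob G)" by (simp add: card_Pow)
  also have "\<dots> = (\<Sum>\<sigma>\<in>Pow {..<n}. P2.prob {z \<in> space P2. sw \<sigma> z \<in> G})"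
  proof (rule sum.cong[OF refl])
    fix \<sigma> assume s: "\<sigma> \<in> Pow {..<n}"
    have "P2.prob G = measure (distr P2 P2 (sw \<sigma>)) G" by (simp add: law[OF s])
    also have "\<dots> = P2.prob (sw \<sigma> -` G \<inter> space P2)" by (rule measure_distr[OF sw_meas[OF s] Gsets])
    finally show "P2.prob G = P2.prob {z \<in> space P2. sw \<sigma> z \<in> G}" by (simp add: vimage_def Int_def conj_commute)
  qed
  also have "\<dots> = (\<Sum>\<sigma>\<in>Pow {..<n}. P2.expectation (indicat_real {z \<in> space P2. sw \<sigma> z \<in> G}))"
    using swG by simp
  also have "\<dots> = P2.expectation (\<lambda>z. \<Sum>\<sigma>\<in>Pow {..<n}. indicat_real {z \<in> space P2. sw \<sigma> z \<in> G} z)"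
    using swG by (subst Bochner_Integration.integral_sum) (auto simp: P2.emeasure_eq_measure)
  also have "\<dots> \<le> P2.expectation (\<lambda>z. K * (2 ^ n * exp (- w / 16)))"
    using swG pointwise by (intro integral_mono Bochner_Integration.integrable_sum) (auto simp: P2.emeasure_eq_measure)
  also have "\<dots> = K * (2 ^ n * exp (- w / 16))" by (simp add: P2.prob_space)
  finally have PG: "P2.prob G \<le> K * exp (- w / 16)" by (simp add: mult.left_commute)
  define sec where "sec = (\<lambda>x. emeasure Q ((\<lambda>y. merge {..<n} {n..<2 * n} (x, y)) -` G \<inter> space Q))"
  have G': "G \<in> sets (PiM ({..<n} \<union> {n..<2 * n}) (\<lambda>_. \<mu>))" using Gsets by (simp add: un P2_def)
  have sec_meas [measurable]: "sec \<in> borel_measurable P1"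
    unfolding sec_def P1_def Q_def by (rule ps.emeasure_fold_measurable) (use G' in auto)
  have sec_int: "emeasure P2 G = (\<integral>\<^sup>+x. sec x \<partial>P1)"
    unfolding sec_def P1_def Q_def P2_def un[symmetric] by (rule ps.emeasure_fold_integral) (use G' in auto)
  \<comment> \<open>The section probability is measurable by Fubini's theorem, and Markov's
    inequality at level 1/2 costs a factor 2.\<close>
  define B where "B = {x \<in> space P1. ennreal (1/2) \<le> sec x}"
  have Bsets: "B \<in> sets P1" unfolding B_def by measurable
  have "ennreal (1/2) * emeasure P1 B = (\<integral>\<^sup>+x. ennreal (1/2) * indicator B x \<partial>P1)"
    by (rule nn_integral_cmult_indicator[OF Bsets, symmetric])
  also have "\<dots> \<le> (\<integral>\<^sup>+x. sec x \<partial>P1)"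
    by (intro nn_integral_mono) (auto simp: B_def indicator_def)
  also have "\<dots> = ennreal (P2.prob G)" by (simp add: sec_int[symmetric] P2.emeasure_eq_measure)
  finally have "ennreal (1/2 * P1.prob B) \<le> ennreal (P2.prob G)"
    unfolding P1.emeasure_eq_measure by (simp only: ennreal_mult'' measure_nonneg)
  then have PB: "P1.prob B \<le> 2 * P2.prob G" by (subst (asm) ennreal_le_iff) auto
  show ?thesis
  proof (intro bexI[of _ B] conjI ballI impI)
    show "B \<in> sets (PiM {..<n} (\<lambda>_. \<mu>))" using Bsets by (simp add: P1_def)
    have "2 * P2.prob G \<le> 2 * (K * exp (- w / 16))" using PG by simp
    then show "measure (PiM {..<n} (\<lambda>_. \<mu>)) B \<le> 2 * K * exp (- real n * u / 32)"
      using PB unfolding P1_def w_def by simp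
    fix x d assume x: "x \<in> space (PiM {..<n} (\<lambda>_. \<mu>)) - B" and d: "d \<in> sparse_dirs p m"
      and a: "u \<le> measure \<mu> (wedge_set \<mu> p d d0)"
    let ?A = "wedge_set \<mu> p d d0"
    have A: "?A \<in> sets \<mu>" by (rule wedge_set_measurable[OF \<mu>(2)])
    show "real n * measure \<mu> ?A / 8 \<le> real (card {i\<in>{..<n}. x i \<in> ?A})"
    proof (rule ccontr)
      assume "\<not> ?thesis"
      then have lo: "real (card {i\<in>{..<n}. x i \<in> ?A}) < real n * measure \<mu> ?A / 8" by simp
      have ua: "real n * u \<le> real n * measure \<mu> ?A" using a by (intro mult_left_mono) auto
      let ?E = "{y \<in> space Q. real (card {i\<in>{n..<2 * n}. y i \<in> ?A}) \<le> real (card {n..<2 * n}) * measure \<mu> ?A / 2}"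
      have "Q.prob ?E \<le> exp (- real (card {n..<2 * n}) * measure \<mu> ?A / 8)"
      proof (rule Q.count_lower_tail[where N = \<mu>])
        show "Q.indep_vars (\<lambda>_. \<mu>) (\<lambda>i y. y i) {n..<2 * n}"
          unfolding Q_def using n by (intro indep_vars_PiM_coordinates \<mu>) auto
        show "?A \<in> sets \<mu>" by (rule A)
        fix i assume i: "i \<in> {n..<2 * n}"
        have "Q.prob {y \<in> space Q. y i \<in> ?A} = measure (distr Q \<mu> (\<lambda>y. y i)) ?A"
          using i A by (subst measure_distr) (auto simp: Q_def intro!: arg_cong[where f = "measure _"])
        also have "distr Q \<mu> (\<lambda>y. y i) = \<mu>"
          unfolding Q_def using i \<mu>(1) by (intro distr_PiM_component) auto
        finally show "Q.prob {y \<in> space Q. y i \<in> ?A} = measure \<mu> ?A" .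
      qed simp
      \<comment> \<open>Here \<open>8 \<le> real n * u\<close> makes the ghost sample typical with
        probability at least 1/2.\<close>
      also have "\<dots> \<le> exp (- 1)" using ua u by simp
      also have "\<dots> \<le> 1/2" using exp_ge_add_one_self[of "1::real"] by (simp add: exp_minus field_simps)
      finally have half: "Q.prob ?E \<le> 1/2" .
      have Emeas: "?E \<in> Q.events"
      proof -
        have "(\<lambda>y. real (card {i\<in>{n..<2 * n}. y i \<in> ?A})) = (\<lambda>y. \<Sum>i\<in>{n..<2 * n}. indicat_real ?A (y i))"
          by (simp add: indicator_def sum.If_cases Int_def of_bool_def)
        moreover have "(\<lambda>y. \<Sum>i\<in>{n..<2 * n}. indicat_real ?A (y i)) \<in> borel_measurable Q"
          unfolding Q_def
          by (intro borel_measurable_sum measurable_compose[OF measurable_component_singleton]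
              borel_measurable_indicator A)
        ultimately have "(\<lambda>y. real (card {i\<in>{n..<2 * n}. y i \<in> ?A})) \<in> borel_measurable Q" by simp
        then show ?thesis by (rule borel_measurable_le) simp
      qed
      have "space Q - ?E \<subseteq> (\<lambda>y. merge {..<n} {n..<2 * n} (x, y)) -` G \<inter> space Q"
      proof
        fix y assume y: "y \<in> space Q - ?E"
        define z where "z = merge {..<n} {n..<2 * n} (x, y)"
        have zsp: "z \<in> space P2"
          unfolding z_def P2_def un[symmetric] using x y
          by (auto simp: space_PiM Q_def PiE_def Pi_iff merge_def extensional_def)
        have zs: "z i \<in> space \<mu>" if "i < 2 * n" for i
          using zsp that by (auto simp: P2_def space_PiM)
        define T where "T = {i\<in>{..<2 * n}. z i \<in> ?A}"
        have T: "T \<in> \<T> z"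
          unfolding \<T>_def side_pattern_def T_def using sdiff_hs_pattern[of "2 * n" z \<mu> p d d0, OF zs] d by blast
        have "T \<inter> {..<n} = {i\<in>{..<n}. x i \<in> ?A}" unfolding T_def z_def merge_def by auto
        moreover have "T \<inter> {n..<2 * n} = {i\<in>{n..<2 * n}. y i \<in> ?A}" unfolding T_def z_def merge_def by auto
        moreover have "real n * measure \<mu> ?A / 2 < real (card {i\<in>{n..<2 * n}. y i \<in> ?A})" using y by auto
        ultimately have "unbalanced n w T" using lo ua by (simp add: unbalanced_def w_def)
        then show "y \<in> (\<lambda>y. merge {..<n} {n..<2 * n} (x, y)) -` G \<inter> space Q"
          using T zsp y by (auto simp: G_def z_def)
      qed
      moreover have "(\<lambda>y. merge {..<n} {n..<2 * n} (x, y)) -` G \<inter> space Q \<in> Q.events"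
      proof -
        have "(\<lambda>y. merge {..<n} {n..<2 * n} (x, y)) \<in> Q \<rightarrow>\<^sub>M PiM ({..<n} \<union> {n..<2 * n}) (\<lambda>_. \<mu>)"
          unfolding Q_def using x by (intro measurable_compose[OF _ measurable_merge] measurable_Pair1') auto
        then show ?thesis using G' by (rule measurable_sets)
      qed
      ultimately have "Q.prob (space Q - ?E) \<le> Q.prob ((\<lambda>y. merge {..<n} {n..<2 * n} (x, y)) -` G \<inter> space Q)"
        by (rule Q.finite_measure_mono)
      then have "1/2 \<le> Q.prob ((\<lambda>y. merge {..<n} {n..<2 * n} (x, y)) -` G \<inter> space Q)"
        using half Q.prob_compl[OF Emeas] by linarith
      then have "ennreal (1/2) \<le> sec x"
        unfolding sec_def Q.emeasure_eq_measure by (rule ennreal_leI)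
      then show False using x by (simp add: B_def P1_def)
    qed
  qed
qed

section \<open>Deterministic analysis of the two stages\<close>

text \<open>With \<open>P\<close> and \<open>S\<close> the indices of the sample points on the negative side of \<open>d\<close> and of \<open>d0\<close>,
  the pair \<open>(f\<^sub>\<theta>, f\<^sub>0)\<close> takes the values \<open>(\<alpha>, \<alpha>0)\<close>, \<open>(\<alpha>, \<beta>0)\<close>, \<open>(\<beta>, \<alpha>0)\<close>, \<open>(\<beta>, \<beta>0)\<close> on the four cells.\<close>

definition cell11 :: "nat set \<Rightarrow> nat set \<Rightarrow> nat set" where "cell11 P S = P \<inter> S"
definition cell10 :: "nat set \<Rightarrow> nat set \<Rightarrow> nat set" where "cell10 P S = P - S"
definition cell01 :: "nat set \<Rightarrow> nat set \<Rightarrow> nat set" where "cell01 P S = S - P"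
definition cell00 :: "nat \<Rightarrow> nat set \<Rightarrow> nat set \<Rightarrow> nat set" where "cell00 n P S = {..<n} - (P \<union> S)"

definition cell_set :: "nat \<Rightarrow> nat set \<Rightarrow> nat set \<Rightarrow> nat set set" where
  "cell_set n P S = {cell11 P S, cell10 P S, cell01 P S, cell00 n P S}"

lemmas cell_defs = cell11_def cell10_def cell01_def cell00_def

lemma sum_cells:
  fixes G :: "nat \<Rightarrow> real"
  assumes P: "P \<subseteq> {..<n}" and S: "S \<subseteq> {..<n}"
  shows "(\<Sum>i<n. G i) = (\<Sum>i\<in>cell11 P S. G i) + (\<Sum>i\<in>cell10 P S. G i) + (\<Sum>i\<in>cell01 P S. G i) + (\<Sum>i\<in>cell00 n P S. G i)"
proof -
  have fin: "finite P" "finite S" using P S finite_subset by blast+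
  have "{..<n} = ((cell11 P S \<union> cell10 P S) \<union> cell01 P S) \<union> cell00 n P S"
    using P S by (auto simp: cell_defs)
  then have "(\<Sum>i<n. G i) = (\<Sum>i\<in>((cell11 P S \<union> cell10 P S) \<union> cell01 P S) \<union> cell00 n P S. G i)" by simp
  also have "\<dots> = (\<Sum>i\<in>cell11 P S. G i) + (\<Sum>i\<in>cell10 P S. G i) + (\<Sum>i\<in>cell01 P S. G i) + (\<Sum>i\<in>cell00 n P S. G i)"
    using fin by (subst sum.union_disjoint, (auto simp: cell_defs)[3])+ simp
  finally show ?thesis .
qed

lemma card_cells:
  assumes P: "P \<subseteq> {..<n}" and S: "S \<subseteq> {..<n}"
  shows "real (card (cell11 P S)) + real (card (cell01 P S)) = real (card S)"
    and "real (card (cell10 P S)) + real (card (cell00 n P S)) = real n - real (card S)"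
proof -
  have fin: "finite P" "finite S" using P S finite_subset by blast+
  have "card (cell11 P S \<union> cell01 P S) = card (cell11 P S) + card (cell01 P S)"
    using fin by (intro card_Un_disjoint) (auto simp: cell_defs)
  moreover have "cell11 P S \<union> cell01 P S = S" by (auto simp: cell_defs)
  ultimately show "real (card (cell11 P S)) + real (card (cell01 P S)) = real (card S)" by simp
  have "card (cell10 P S \<union> cell00 n P S) = card (cell10 P S) + card (cell00 n P S)"
    using fin by (intro card_Un_disjoint) (auto simp: cell_defs)
  moreover have "cell10 P S \<union> cell00 n P S = {..<n} - S" using P by (auto simp: cell_defs)
  moreover have "real (card ({..<n} - S)) = real n - real (card S)"
    using S fin card_mono[OF _ S] by (simp add: card_Diff_subset of_nat_diff)
  ultimately show "real (card (cell10 P S)) + real (card (cell00 n P S)) = real n - real (card S)" by simp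
qed

text \<open>\<open>h\<close> is general because the squared error, the noise term and the residuals
  of the second stage are all expanded in this way.\<close>

lemma sum_cells_f_theta:
  fixes h :: "nat \<Rightarrow> real \<Rightarrow> real \<Rightarrow> real" and x :: "nat \<Rightarrow> nat \<Rightarrow> real" and n p :: nat
  defines "P \<equiv> \<lambda>d. hs_pattern n p x d"
  shows "(\<Sum>i<n. h i (f_theta p (\<alpha>, \<beta>, d) (x i)) (f_theta p (\<alpha>0, \<beta>0, d0) (x i))) =
    (\<Sum>i\<in>cell11 (P d) (P d0). h i \<alpha> \<alpha>0) + (\<Sum>i\<in>cell10 (P d) (P d0). h i \<alpha> \<beta>0) +
    (\<Sum>i\<in>cell01 (P d) (P d0). h i \<beta> \<alpha>0) + (\<Sum>i\<in>cell00 n (P d) (P d0). h i \<beta> \<beta>0)"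
proof -
  have f: "f_theta p (\<alpha>, \<beta>, d) (x i) = (if i \<in> P d then \<alpha> else \<beta>)" if "i < n" for i \<alpha> \<beta> d
    using that by (auto simp: f_theta_def P_def hs_pattern_def)
  have PS: "P d \<subseteq> {..<n}" "P d0 \<subseteq> {..<n}" by (auto simp: P_def hs_pattern_def)
  show ?thesis
    unfolding sum_cells[OF PS]
    by (intro arg_cong2[where f = "(+)"] sum.cong refl)
       (use PS in \<open>auto simp: cell_defs f subset_iff\<close>)
qed

text \<open>Young's inequality with weights 1/8 and 8 on the square root term. The share 1/8 of the
  squared error is absorbed by the 1/2 of the basic inequality.\<close>

lemma cell_noise_bound:
  assumes T: "\<bar>S\<bar> \<le> 2 * \<sigma> * sqrt (N * t) + 2 * c * t" and v: "\<bar>v\<bar> \<le> D"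
    and pos: "0 \<le> \<sigma>" "0 \<le> t" "0 \<le> c" "0 \<le> N"
  shows "v * S \<le> v\<^sup>2 * N / 8 + 8 * \<sigma>\<^sup>2 * t + 2 * D * c * (t::real)"
proof -
  have "v * S \<le> \<bar>v\<bar> * \<bar>S\<bar>" by (metis abs_ge_self abs_mult)
  also have "\<dots> \<le> \<bar>v\<bar> * (2 * \<sigma> * sqrt (N * t) + 2 * c * t)" using T by (intro mult_left_mono) auto
  also have "\<dots> = 2 * (\<bar>v\<bar> * sqrt N) * (\<sigma> * sqrt t) + \<bar>v\<bar> * (2 * c * t)"
    by (simp add: real_sqrt_mult algebra_simps)
  also have "2 * (\<bar>v\<bar> * sqrt N) * (\<sigma> * sqrt t) \<le> (\<bar>v\<bar> * sqrt N)\<^sup>2 / 8 + 8 * (\<sigma> * sqrt t)\<^sup>2"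
    using zero_le_power2[of "\<bar>v\<bar> * sqrt N / 4 - 2 * (\<sigma> * sqrt t)"] by (simp add: power2_diff power_divide)
  also have "\<dots> = v\<^sup>2 * N / 8 + 8 * \<sigma>\<^sup>2 * t" using pos by (simp add: power_mult_distrib)
  also have "\<bar>v\<bar> * (2 * c * t) \<le> D * (2 * c * t)" using v pos by (intro mult_right_mono) auto
  finally show ?thesis by simp
qed

text \<open>Two numbers that differ by at least \<open>g\<close> cannot both be smaller than
  \<open>g / 2\<close> in absolute value.\<close>

lemma weighted_squares_ge_min:
  fixes a b :: real
  assumes "g \<le> b - a" "0 \<le> g" "0 \<le> M" "0 \<le> N"
  shows "g\<^sup>2 / 4 * min M N \<le> a\<^sup>2 * M + b\<^sup>2 * N"
proof -
  have "g / 2 \<le> \<bar>a\<bar> \<or> g / 2 \<le> \<bar>b\<bar>" using assms by linarith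
  then have "(g / 2)\<^sup>2 \<le> a\<^sup>2 \<or> (g / 2)\<^sup>2 \<le> b\<^sup>2"
    using assms(2) by (metis abs_le_square_iff abs_of_nonneg divide_nonneg_nonneg zero_le_numeral)
  then have "g\<^sup>2 / 4 \<le> a\<^sup>2 \<or> g\<^sup>2 / 4 \<le> b\<^sup>2" by (simp add: power_divide)
  then show ?thesis
  proof
    assume "g\<^sup>2 / 4 \<le> a\<^sup>2"
    then have "g\<^sup>2 / 4 * min M N \<le> a\<^sup>2 * M" using assms by (intro mult_mono) auto
    then show ?thesis using assms by (simp add: add_increasing2)
  next
    assume "g\<^sup>2 / 4 \<le> b\<^sup>2"
    then have "g\<^sup>2 / 4 * min M N \<le> b\<^sup>2 * N" using assms by (intro mult_mono) auto
    then show ?thesis using assms by (simp add: add_increasing)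
  qed
qed

text \<open>Two step functions that are close in the empirical norm have almost the same jump set: a swap of
  the two sides is excluded because both functions step down by at least \<open>g\<close>.\<close>

lemma misclassified_le:
  fixes N11 N10 N01 N00 :: real
  assumes W: "(\<alpha> - \<alpha>0)\<^sup>2 * N11 + (\<alpha> - \<beta>0)\<^sup>2 * N10 + (\<beta> - \<alpha>0)\<^sup>2 * N01 + (\<beta> - \<beta>0)\<^sup>2 * N00 \<le> w"
    and N: "0 \<le> N11" "0 \<le> N10" "0 \<le> N01" "0 \<le> N00"
    and g: "0 < g" "g \<le> \<alpha> - \<beta>" "g \<le> \<alpha>0 - \<beta>0"
    and h: "h \<le> N11 + N01" "h \<le> N10 + N00" "8 * w / g\<^sup>2 < h"
  shows "N10 + N01 \<le> 8 * w / g\<^sup>2"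
proof -
  define e where "e = 4 * w / g\<^sup>2"
  have nn: "0 \<le> (\<alpha> - \<alpha>0)\<^sup>2 * N11" "0 \<le> (\<alpha> - \<beta>0)\<^sup>2 * N10" "0 \<le> (\<beta> - \<alpha>0)\<^sup>2 * N01" "0 \<le> (\<beta> - \<beta>0)\<^sup>2 * N00"
    using N by simp_all
  have le: "m \<le> e" if "g\<^sup>2 / 4 * m \<le> w" for m
    using that g(1) by (simp add: e_def field_simps)
  \<comment> \<open>In each pair of cells the two errors differ by at least \<open>g\<close>: by the
    gap of the true levels in the first two, of the fitted levels in the third, by both gaps in the
    last.\<close>
  have w1: "g\<^sup>2 / 4 * min N11 N10 \<le> (\<alpha> - \<alpha>0)\<^sup>2 * N11 + (\<alpha> - \<beta>0)\<^sup>2 * N10"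
    and w2: "g\<^sup>2 / 4 * min N01 N00 \<le> (\<beta> - \<alpha>0)\<^sup>2 * N01 + (\<beta> - \<beta>0)\<^sup>2 * N00"
    and w3: "g\<^sup>2 / 4 * min N01 N11 \<le> (\<beta> - \<alpha>0)\<^sup>2 * N01 + (\<alpha> - \<alpha>0)\<^sup>2 * N11"
    and w4: "g\<^sup>2 / 4 * min N01 N10 \<le> (\<beta> - \<alpha>0)\<^sup>2 * N01 + (\<alpha> - \<beta>0)\<^sup>2 * N10"
    using N g by (intro weighted_squares_ge_min; linarith)+
  have 1: "min N11 N10 \<le> e" by (rule le) (use w1 W nn in linarith)
  have 2: "min N01 N00 \<le> e" by (rule le) (use w2 W nn in linarith)
  have 3: "min N01 N11 \<le> e" by (rule le) (use w3 W nn in linarith)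
  have 4: "min N01 N10 \<le> e" by (rule le) (use w4 W nn in linarith)
  have h': "2 * e < h" using h(3) by (simp add: e_def)
  \<comment> \<open>If \<open>N01\<close> exceeded \<open>e\<close>, the other three cells would be
    at most \<open>e\<close> and \<open>N10 + N00\<close> at most \<open>2 * e < h\<close>. So
    \<open>N01 \<le> e\<close>; if then \<open>N10\<close> exceeded \<open>e\<close>,
    \<open>N11\<close> would be at most \<open>e\<close> and \<open>N11 + N01\<close> below
    \<open>h\<close>.\<close>
  have "N10 + N01 \<le> 2 * e"
    using 1 2 3 4 h' h(1,2) by (auto simp: min_def split: if_splits)
  then show ?thesis by (simp add: e_def)
qed

text \<open>The four noise bounds add up to \<open>W / 8\<close> plus a remainder that half of the
  penalty \<open>Qh\<close> swallows. What is left, \<open>3 / 8 * W + Qh / 2 \<le> Q0\<close>,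
  controls the error and the selected penalty at once; 24 is 8 times the 3 in
  \<open>W \<le> 3 * Q0\<close>.\<close>

lemma first_stage:
  fixes x :: "nat \<Rightarrow> nat \<Rightarrow> real" and e :: "nat \<Rightarrow> real" and p n :: nat
    and \<alpha> \<beta> \<alpha>0 \<beta>0 :: real and d d0 :: "nat \<Rightarrow> real"
  defines "P \<equiv> \<lambda>d. hs_pattern n p x d"
  defines "W \<equiv> \<Sum>i<n. (f_theta p (\<alpha>, \<beta>, d) (x i) - f_theta p (\<alpha>0, \<beta>0, d0) (x i))\<^sup>2"
  assumes basic: "W / 2 - (\<Sum>i<n. e i * (f_theta p (\<alpha>, \<beta>, d) (x i) - f_theta p (\<alpha>0, \<beta>0, d0) (x i))) + Qh \<le> Q0"
    and noise: "\<And>T. T \<in> cell_set n (P d) (P d0) \<Longrightarrow>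
      \<bar>\<Sum>i\<in>T. e i\<bar> \<le> 2 * \<sigma> * sqrt (real (card T) * t) + 2 * c * t"
    and D: "\<bar>\<alpha> - \<alpha>0\<bar> \<le> D" "\<bar>\<alpha> - \<beta>0\<bar> \<le> D" "\<bar>\<beta> - \<alpha>0\<bar> \<le> D" "\<bar>\<beta> - \<beta>0\<bar> \<le> D"
    and pos: "0 \<le> \<sigma>" "0 \<le> t" "0 \<le> c"
    and small: "32 * \<sigma>\<^sup>2 * t + 8 * D * c * t \<le> Qh / 2"
    and g: "0 < g" "g \<le> \<alpha> - \<beta>" "g \<le> \<alpha>0 - \<beta>0"
    and h: "h \<le> real (card (P d0))" "h \<le> real n - real (card (P d0))" "24 * Q0 / g\<^sup>2 < h"
  shows "Qh \<le> 2 * Q0" and "real (card (cell10 (P d) (P d0))) + real (card (cell01 (P d) (P d0))) \<le> 24 * Q0 / g\<^sup>2"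
proof -
  let ?A = "cell11 (P d) (P d0)" and ?B = "cell10 (P d) (P d0)" and ?C = "cell01 (P d) (P d0)" and ?E = "cell00 n (P d) (P d0)"
  have PS: "P d \<subseteq> {..<n}" "P d0 \<subseteq> {..<n}" by (auto simp: P_def hs_pattern_def)
  have fin: "finite (P d)" "finite (P d0)" using PS finite_subset by blast+
  have W: "W = (\<alpha> - \<alpha>0)\<^sup>2 * real (card ?A) + (\<alpha> - \<beta>0)\<^sup>2 * real (card ?B) + (\<beta> - \<alpha>0)\<^sup>2 * real (card ?C) + (\<beta> - \<beta>0)\<^sup>2 * real (card ?E)"
    unfolding W_def P_def using sum_cells_f_theta[of "\<lambda>i a b. (a - b)\<^sup>2" p \<alpha> \<beta> d x \<alpha>0 \<beta>0 d0 n] by simp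
  have lin: "(\<Sum>i<n. e i * (f_theta p (\<alpha>, \<beta>, d) (x i) - f_theta p (\<alpha>0, \<beta>0, d0) (x i))) =
     (\<alpha> - \<alpha>0) * (\<Sum>i\<in>?A. e i) + (\<alpha> - \<beta>0) * (\<Sum>i\<in>?B. e i) + (\<beta> - \<alpha>0) * (\<Sum>i\<in>?C. e i) + (\<beta> - \<beta>0) * (\<Sum>i\<in>?E. e i)"
    unfolding P_def using sum_cells_f_theta[of "\<lambda>i a b. e i * (a - b)" p \<alpha> \<beta> d x \<alpha>0 \<beta>0 d0 n]
    by (simp add: sum_distrib_right[symmetric] mult.commute)
  have "(\<alpha> - \<alpha>0) * (\<Sum>i\<in>?A. e i) \<le> (\<alpha> - \<alpha>0)\<^sup>2 * real (card ?A) / 8 + 8 * \<sigma>\<^sup>2 * t + 2 * D * c * t"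
    "(\<alpha> - \<beta>0) * (\<Sum>i\<in>?B. e i) \<le> (\<alpha> - \<beta>0)\<^sup>2 * real (card ?B) / 8 + 8 * \<sigma>\<^sup>2 * t + 2 * D * c * t"
    "(\<beta> - \<alpha>0) * (\<Sum>i\<in>?C. e i) \<le> (\<beta> - \<alpha>0)\<^sup>2 * real (card ?C) / 8 + 8 * \<sigma>\<^sup>2 * t + 2 * D * c * t"
    "(\<beta> - \<beta>0) * (\<Sum>i\<in>?E. e i) \<le> (\<beta> - \<beta>0)\<^sup>2 * real (card ?E) / 8 + 8 * \<sigma>\<^sup>2 * t + 2 * D * c * t"
    using D pos by (intro cell_noise_bound noise; simp add: cell_set_def)+
  then have "(\<Sum>i<n. e i * (f_theta p (\<alpha>, \<beta>, d) (x i) - f_theta p (\<alpha>0, \<beta>0, d0) (x i))) \<le>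
     W / 8 + (32 * \<sigma>\<^sup>2 * t + 8 * D * c * t)"
    unfolding lin W by argo
  then have main: "3 / 8 * W + Qh / 2 \<le> Q0" using basic small by argo
  have W0: "0 \<le> W" unfolding W_def by (intro sum_nonneg) auto
  then show "Qh \<le> 2 * Q0" using main by argo
  have D0: "0 \<le> D" using D(1) by linarith
  have "0 \<le> 32 * \<sigma>\<^sup>2 * t + 8 * D * c * t" using pos D0 by simp
  then have W3: "W \<le> 3 * Q0" using main small W0 by argo
  note cards = card_cells[OF PS]
  have "real (card ?B) + real (card ?C) \<le> 8 * (3 * Q0) / g\<^sup>2"
    by (rule misclassified_le[of \<alpha> \<alpha>0 "real (card ?A)" \<beta>0 _ \<beta> _ "real (card ?E)" _ g h])
       (use W W3 g h cards in simp_all)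
  then show "real (card ?B) + real (card ?C) \<le> 24 * Q0 / g\<^sup>2" by simp
qed

text \<open>The fit is compared with the true levels at the same direction \<open>d\<close>. The
  noise over a side of \<open>d\<close> is the noise over the corresponding side of
  \<open>d0\<close>, which does not involve the estimator, corrected by the two misclassified cells;
  each misclassified point also adds a bias of at most \<open>D\<close>.\<close>

lemma second_stage:
  fixes x :: "nat \<Rightarrow> nat \<Rightarrow> real" and e :: "nat \<Rightarrow> real" and p n :: nat
    and \<alpha> \<beta> \<alpha>0 \<beta>0 :: real and d d0 :: "nat \<Rightarrow> real"
  defines "P \<equiv> \<lambda>d. hs_pattern n p x d"
  assumes ls: "(\<Sum>i<n. (f_theta p (\<alpha>0, \<beta>0, d0) (x i) + e i - f_theta p (\<alpha>, \<beta>, d) (x i))\<^sup>2) \<le>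
      (\<Sum>i<n. (f_theta p (\<alpha>0, \<beta>0, d0) (x i) + e i - f_theta p (\<alpha>0, \<beta>0, d) (x i))\<^sup>2)"
    and D: "\<bar>\<alpha>0 - \<beta>0\<bar> \<le> D"
    and side: "\<bar>\<Sum>i\<in>P d0. e i\<bar> \<le> Z" "\<bar>\<Sum>i\<in>{..<n} - P d0. e i\<bar> \<le> Z"
    and cells: "\<bar>\<Sum>i\<in>cell10 (P d) (P d0). e i\<bar> \<le> z" "\<bar>\<Sum>i\<in>cell01 (P d) (P d0). e i\<bar> \<le> z"
    and mis: "real (card (cell10 (P d) (P d0))) + real (card (cell01 (P d) (P d0))) \<le> N" "N \<le> h / 2"
    and h: "0 < h" "h \<le> real (card (P d0))" "h \<le> real n - real (card (P d0))"
  shows "\<bar>\<alpha> - \<alpha>0\<bar> \<le> 8 * (Z + 2 * z + D * N) / h \<and> \<bar>\<beta> - \<beta>0\<bar> \<le> 8 * (Z + 2 * z + D * N) / h"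
proof -
  let ?A = "cell11 (P d) (P d0)" and ?B = "cell10 (P d) (P d0)" and ?C = "cell01 (P d) (P d0)" and ?E = "cell00 n (P d) (P d0)"
  define a b R where "a = \<alpha> - \<alpha>0" and "b = \<beta> - \<beta>0" and "R = Z + 2 * z + D * N"
  have PS: "P d \<subseteq> {..<n}" "P d0 \<subseteq> {..<n}" by (auto simp: P_def hs_pattern_def)
  have fin: "finite (P d)" "finite (P d0)" using PS finite_subset by blast+
  have fincell: "finite ?A" "finite ?B" "finite ?C" "finite ?E" using fin by (auto simp: cell_defs)
  define sA sB sC sE where "sA = (\<Sum>i\<in>?A. e i)" and "sB = (\<Sum>i\<in>?B. e i)" and "sC = (\<Sum>i\<in>?C. e i)" and "sE = (\<Sum>i\<in>?E. e i)"
  define NA NB NC NE where "NA = real (card ?A)" and "NB = real (card ?B)" and "NC = real (card ?C)" and "NE = real (card ?E)"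
  have "(\<Sum>i<n. (f_theta p (\<alpha>0, \<beta>0, d0) (x i) + e i - f_theta p (\<alpha>, \<beta>, d) (x i))\<^sup>2) =
     (\<Sum>i\<in>?A. (\<alpha>0 + e i - \<alpha>)\<^sup>2) + (\<Sum>i\<in>?B. (\<beta>0 + e i - \<alpha>)\<^sup>2) + (\<Sum>i\<in>?C. (\<alpha>0 + e i - \<beta>)\<^sup>2) + (\<Sum>i\<in>?E. (\<beta>0 + e i - \<beta>)\<^sup>2)"
    for \<alpha> \<beta>
    unfolding P_def by (rule sum_cells_f_theta[of "\<lambda>i u v. (v + e i - u)\<^sup>2"])
  note exp = ls[unfolded this]
  have diff: "(\<Sum>i\<in>T. (v + e i - u)\<^sup>2) - (\<Sum>i\<in>T. (v + e i - u')\<^sup>2) =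
      (u - u')\<^sup>2 * real (card T) - 2 * (u - u') * ((v - u') * real (card T) + (\<Sum>i\<in>T. e i))" for T u u' v
  proof -
    have "(\<Sum>i\<in>T. (v + e i - u)\<^sup>2) - (\<Sum>i\<in>T. (v + e i - u')\<^sup>2) = (\<Sum>i\<in>T. (u - u')\<^sup>2 - 2 * (u - u') * (v - u') - 2 * (u - u') * e i)"
      unfolding sum_subtractf[symmetric] by (intro sum.cong) (auto simp: power2_eq_square algebra_simps)
    also have "\<dots> = real (card T) * ((u - u')\<^sup>2 - 2 * (u - u') * (v - u')) - 2 * (u - u') * (\<Sum>i\<in>T. e i)"
      by (simp add: sum_subtractf sum_distrib_left)
    finally show ?thesis by (simp add: algebra_simps)
  qed
  have "a\<^sup>2 * (NA + NB) + b\<^sup>2 * (NC + NE) \<le> 2 * (a * (sA + sB + (\<beta>0 - \<alpha>0) * NB) + b * (sC + sE + (\<alpha>0 - \<beta>0) * NC))"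
  proof -
    have "(\<Sum>i\<in>?A. (\<alpha>0 + e i - \<alpha>)\<^sup>2) - (\<Sum>i\<in>?A. (\<alpha>0 + e i - \<alpha>0)\<^sup>2) = a\<^sup>2 * NA - 2 * (a * sA)"
      "(\<Sum>i\<in>?B. (\<beta>0 + e i - \<alpha>)\<^sup>2) - (\<Sum>i\<in>?B. (\<beta>0 + e i - \<alpha>0)\<^sup>2) = a\<^sup>2 * NB - 2 * (a * ((\<beta>0 - \<alpha>0) * NB)) - 2 * (a * sB)"
      "(\<Sum>i\<in>?C. (\<alpha>0 + e i - \<beta>)\<^sup>2) - (\<Sum>i\<in>?C. (\<alpha>0 + e i - \<beta>0)\<^sup>2) = b\<^sup>2 * NC - 2 * (b * ((\<alpha>0 - \<beta>0) * NC)) - 2 * (b * sC)"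
      "(\<Sum>i\<in>?E. (\<beta>0 + e i - \<beta>)\<^sup>2) - (\<Sum>i\<in>?E. (\<beta>0 + e i - \<beta>0)\<^sup>2) = b\<^sup>2 * NE - 2 * (b * sE)"
      unfolding diff a_def b_def sA_def sB_def sC_def sE_def NA_def NB_def NC_def NE_def
      by (simp_all add: distrib_left mult.assoc del: mult_2 right_diff_distrib_numeral left_diff_distrib_numeral)
    then show ?thesis using exp unfolding distrib_left by linarith
  qed
  also have "\<dots> \<le> 2 * (\<bar>a\<bar> * R + \<bar>b\<bar> * R)"
  proof -
    \<comment> \<open>\<open>sA + sB\<close> is read as \<open>(sA + sC) + sB - sC\<close>: passing
      to the side of \<open>d0\<close> costs two cell sums, whence \<open>2 * z\<close> in
      \<open>R\<close>.\<close>
    have AC: "sA + sC = (\<Sum>i\<in>P d0. e i)"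
      unfolding sA_def sC_def using fin by (subst sum.union_disjoint[symmetric]) (auto simp: cell_defs intro!: sum.cong)
    have BE: "sB + sE = (\<Sum>i\<in>{..<n} - P d0. e i)"
      unfolding sB_def sE_def using fin PS by (subst sum.union_disjoint[symmetric]) (auto simp: cell_defs intro!: sum.cong)
    have NN: "0 \<le> NB" "0 \<le> NC" "NB + NC \<le> N" using mis by (auto simp: NB_def NC_def)
    have D0: "0 \<le> D" using D by linarith
    have dB: "\<bar>(\<beta>0 - \<alpha>0) * NB\<bar> \<le> D * N" "\<bar>(\<alpha>0 - \<beta>0) * NC\<bar> \<le> D * N"
      unfolding abs_mult using D D0 NN by (intro mult_mono; linarith)+
    have "\<bar>sA + sB + (\<beta>0 - \<alpha>0) * NB\<bar> \<le> R"
      using AC side(1) cells dB unfolding R_def sB_def[symmetric] sC_def[symmetric] by linarith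
    moreover have "\<bar>sC + sE + (\<alpha>0 - \<beta>0) * NC\<bar> \<le> R"
      using BE side(2) cells dB unfolding R_def sB_def[symmetric] sC_def[symmetric] by linarith
    moreover have "u * v \<le> \<bar>u\<bar> * R" if "\<bar>v\<bar> \<le> R" for u v
    proof -
      have "u * v \<le> \<bar>u\<bar> * \<bar>v\<bar>" using abs_ge_self[of "u * v"] by (simp only: abs_mult)
      also have "\<dots> \<le> \<bar>u\<bar> * R" using that by (intro mult_left_mono) auto
      finally show ?thesis .
    qed
    ultimately have "a * (sA + sB + (\<beta>0 - \<alpha>0) * NB) \<le> \<bar>a\<bar> * R" "b * (sC + sE + (\<alpha>0 - \<beta>0) * NC) \<le> \<bar>b\<bar> * R"
      by blast+
    from mult_left_mono[OF add_mono[OF this], of 2] show ?thesis by simp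
  qed
  finally have quad: "a\<^sup>2 * (NA + NB) + b\<^sup>2 * (NC + NE) \<le> 2 * (\<bar>a\<bar> * R + \<bar>b\<bar> * R)" .
  note cards = card_cells[OF PS, folded NA_def NB_def NC_def NE_def]
  have Nn: "0 \<le> NA" "0 \<le> NB" "0 \<le> NC" "0 \<le> NE" by (auto simp: NA_def NB_def NC_def NE_def)
  have mis': "NB + NC \<le> h / 2" using mis by (simp add: NB_def NC_def)
  define m where "m = max \<bar>a\<bar> \<bar>b\<bar>"
  \<comment> \<open>Each side of \<open>d0\<close> has at least \<open>h\<close> points and at most
    \<open>h / 2\<close> points are misclassified, so both sides of \<open>d\<close> keep
    \<open>h / 2\<close>.\<close>
  have "h / 2 \<le> NA + NB" "h / 2 \<le> NC + NE" using cards h mis' Nn by linarith+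
  then have ab: "a\<^sup>2 * (h / 2) \<le> a\<^sup>2 * (NA + NB)" "b\<^sup>2 * (h / 2) \<le> b\<^sup>2 * (NC + NE)"
    by (intro mult_left_mono; simp)+
  have nn: "0 \<le> a\<^sup>2 * (NA + NB)" "0 \<le> b\<^sup>2 * (NC + NE)" using Nn by auto
  have R0: "0 \<le> R"
  proof -
    have "0 \<le> NB + NC" using Nn by simp
    then have "0 \<le> N" using mis(1) by (simp add: NB_def NC_def)
    moreover have "0 \<le> D" using D by linarith
    moreover have "0 \<le> Z" "0 \<le> z" using side(1) cells(1) by linarith+
    ultimately show ?thesis unfolding R_def by simp
  qed
  have "m\<^sup>2 * (h / 2) \<le> a\<^sup>2 * (NA + NB) + b\<^sup>2 * (NC + NE)"
    using ab nn by (auto simp: m_def max_def)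
  also have "\<dots> \<le> 4 * R * m"
  proof -
    have "\<bar>a\<bar> * R \<le> m * R" "\<bar>b\<bar> * R \<le> m * R" using R0 by (auto simp: m_def intro!: mult_right_mono)
    then show ?thesis using quad by argo
  qed
  finally have "m * (m * h) \<le> m * (8 * R)" by (simp add: power2_eq_square algebra_simps)
  moreover have "0 \<le> m" by (simp add: m_def)
  ultimately have "m * h \<le> 8 * R"
    using R0 h(1) by (cases "m = 0") (auto simp: mult_le_cancel_left)
  then have "m \<le> 8 * R / h" using h(1) by (simp add: field_simps)
  then show ?thesis by (simp add: m_def R_def a_def b_def)
qed

section \<open>Geometry of the unit sphere and the wedge condition\<close>

lemma l0norm_usphere:
  assumes "d \<in> usphere p"
  shows "1 \<le> l0norm p d" "l0norm p d \<le> p"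
proof -
  have "{j. j < p \<and> d j \<noteq> 0} \<noteq> {}"
  proof
    assume "{j. j < p \<and> d j \<noteq> 0} = {}"
    then have "L2_set d {..<p} = 0" by (simp add: L2_set_eq_0_iff)
    then show False using assms by (simp add: usphere_def)
  qed
  then show "1 \<le> l0norm p d" by (simp add: l0norm_def Suc_le_eq card_gt_0_iff)
  show "l0norm p d \<le> p"
    unfolding l0norm_def using card_mono[of "{..<p}" "{j. j < p \<and> d j \<noteq> 0}"] by auto
qed

lemma dist2_usphere_le:
  assumes "d \<in> usphere p" "d0 \<in> usphere p"
  shows "dist2 p d d0 \<le> 2"
proof -
  have "dist2 p d d0 \<le> L2_set d {..<p} + L2_set (\<lambda>j. - d0 j) {..<p}"
    unfolding dist2_def using L2_set_triangle_ineq[of d "\<lambda>j. - d0 j" "{..<p}"] by simp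
  also have "L2_set (\<lambda>j. - d0 j) {..<p} = L2_set d0 {..<p}" by (simp add: L2_set_def)
  finally show ?thesis using assms by (simp add: usphere_def)
qed

lemma dot_linear: "dot p x (\<lambda>j. a * d j + b * d' j) = a * dot p x d + b * dot p x d'"
  by (simp add: dot_def sum.distrib sum_distrib_left algebra_simps)

text \<open>The local wedge condition is global: on the great circle arc from \<open>d0\<close> to \<open>d\<close> the wedge
  sets increase, so it suffices to look at the point of the arc at distance \<open>\<eta>\<close>.\<close>

lemma wedge_condition_global:
  assumes wedge: "wedge_condition c C1 C2 \<eta> p \<mu> d0" and \<mu>: "prob_space \<mu>" "sets \<mu> = sets (Rn p)"
    and d0: "d0 \<in> usphere p" and d: "d \<in> usphere p" and pos: "0 < c" "0 < C1" "0 < \<eta>"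
  shows "min c (min (c * \<eta> / 2) (C1 / 2)) * dist2 p d d0 \<le> measure \<mu> (wedge_set \<mu> p d d0)"
proof -
  interpret prob_space \<mu> by fact
  let ?c = "min c (min (c * \<eta> / 2) (C1 / 2))"
  have dist0: "0 \<le> dist2 p d d0" by (simp add: dist2_def L2_set_nonneg)
  have dist2: "dist2 p d d0 \<le> 2" by (rule dist2_usphere_le[OF d d0])
  have wedge': "c * dist2 p u d0 \<le> prob (wedge_set \<mu> p u d0)" if "u \<in> usphere p" "dist2 p u d0 \<le> \<eta>" for u
    using wedge that unfolding wedge_condition_def wedge_set_def by blast
  \<comment> \<open>Distances on the sphere are at most 2, so away from \<open>d0\<close> any
    positive lower bound of the wedge probability becomes a linear one; hence the divisions by 2 in
    \<open>?c\<close>.\<close>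
  have bnd: "?c * dist2 p d d0 \<le> K" if "?c \<le> K / 2" for K
  proof -
    have "?c * dist2 p d d0 \<le> ?c * 2" using pos dist2 by (intro mult_left_mono) auto
    then show ?thesis using that by linarith
  qed
  show ?thesis
  proof (cases "dist2 p d d0 \<le> \<eta>")
    case True
    have "?c * dist2 p d d0 \<le> c * dist2 p d d0" using dist0 by (intro mult_right_mono) auto
    then show ?thesis using wedge'[OF d True] by linarith
  next
    case far: False
    show ?thesis
    \<comment> \<open>At the antipode the segment from \<open>d0\<close> to \<open>d\<close> meets 0
      and cannot be normalised. There the wedge contains the open half-space of \<open>d0\<close>,
      whose mass is at least \<open>C1\<close>.\<close>
    proof (cases "\<forall>j<p. d j = - d0 j")
      case True
      have "dot p x d = - dot p x d0" for x
        unfolding dot_def sum_negf[symmetric] using True by (intro sum.cong) auto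
      then have "{x \<in> space \<mu>. min (dot p x d0) (dot p x d0) > 0} \<subseteq> wedge_set \<mu> p d d0"
        by (auto simp: wedge_set_def sign_pm_def)
      then have "prob {x \<in> space \<mu>. min (dot p x d0) (dot p x d0) > 0} \<le> prob (wedge_set \<mu> p d d0)"
        by (rule finite_measure_mono) (rule wedge_set_measurable[OF \<mu>(2)])
      moreover have "dist2 p d0 d0 \<le> \<eta>" using pos by (simp add: dist2_def L2_set_def)
      then have "C1 \<le> prob {x \<in> space \<mu>. min (dot p x d0) (dot p x d0) > 0}"
        using wedge d0 unfolding wedge_condition_def by blast
      moreover have "?c * dist2 p d d0 \<le> C1" by (rule bnd) auto
      ultimately show ?thesis by linarith
    next
      case not_opp: False
      \<comment> \<open>The segment stands for the arc: dividing by its length \<open>N l\<close>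
        gives unit vectors, and a positive factor does not affect signs.\<close>
      define v where "v = (\<lambda>l j. (1 - l) * d0 j + l * d j)"
      define N where "N = (\<lambda>l. L2_set (v l) {..<p})"
      have sq: "(\<Sum>j<p. (d0 j)\<^sup>2) = 1" "(\<Sum>j<p. (d j)\<^sup>2) = 1"
        using d d0 by (auto simp: usphere_def L2_set_def)
      have N0: "N l \<noteq> 0" if l: "0 \<le> l" "l \<le> 1" for l
      proof
        assume "N l = 0"
        then have v0: "v l j = 0" if "j < p" for j using that by (simp add: N_def L2_set_eq_0_iff)
        then have e: "(1 - l) * d0 j = - (l * d j)" if "j < p" for j using that unfolding v_def by fastforce
        have "(1 - l)\<^sup>2 * (\<Sum>j<p. (d0 j)\<^sup>2) = (\<Sum>j<p. ((1 - l) * d0 j)\<^sup>2)"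
          by (simp add: sum_distrib_left power_mult_distrib)
        also have "\<dots> = (\<Sum>j<p. (l * d j)\<^sup>2)" by (intro sum.cong) (auto simp: e)
        also have "\<dots> = l\<^sup>2 * (\<Sum>j<p. (d j)\<^sup>2)" by (simp add: sum_distrib_left power_mult_distrib)
        finally have "(1 - l)\<^sup>2 = l\<^sup>2" using sq by simp
        then have l2: "l = 1/2" by (simp add: power2_eq_square algebra_simps)
        have "\<forall>j<p. d j = - d0 j" using e unfolding l2 by force
        then show False using not_opp by blast
      qed
      have Npos: "0 < N l" if "0 \<le> l" "l \<le> 1" for l
        using N0[OF that] L2_set_nonneg[of "v l" "{..<p}"] by (simp add: N_def order_less_le)
      define g where "g = (\<lambda>l. L2_set (\<lambda>j. v l j / N l - d0 j) {..<p})"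
      have contN: "continuous_on {0..1} N" unfolding N_def L2_set_def v_def by (intro continuous_intros)
      have contg: "continuous_on {0..1} g"
        unfolding g_def L2_set_def v_def
        by (intro continuous_intros contN) (use N0 in auto)
      have g0: "g 0 = 0"
      proof -
        have "v 0 = d0" by (auto simp: v_def)
        then have "N 0 = 1" using sq by (simp add: N_def L2_set_def)
        then show ?thesis using \<open>v 0 = d0\<close> by (simp add: g_def L2_set_def)
      qed
      have g1: "g 1 = dist2 p d d0"
      proof -
        have "v 1 = d" by (auto simp: v_def)
        then have "N 1 = 1" using sq by (simp add: N_def L2_set_def)
        then show ?thesis using \<open>v 1 = d\<close> by (simp add: g_def dist2_def)
      qed
      obtain l where l: "0 \<le> l" "l \<le> 1" "g l = \<eta>"
        using IVT'[of g 0 \<eta> 1] g0 g1 far pos contg by auto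
      have lpos: "0 < l" using l g0 pos by (metis less_irrefl order_le_less)
      define u where "u = (\<lambda>j\<in>{..<p}. v l j / N l)"
      have uS: "u \<in> usphere p"
      proof -
        have "L2_set u {..<p} = L2_set (\<lambda>j. inverse (N l) * v l j) {..<p}"
          by (rule L2_set_cong) (auto simp: u_def divide_inverse mult.commute)
        also have "\<dots> = inverse (N l) * N l"
          unfolding N_def[symmetric] using L2_set_right_distrib[of "inverse (N l)" "v l" "{..<p}"] Npos[OF l(1,2)] by (simp add: N_def)
        also have "\<dots> = 1" using N0[OF l(1,2)] by simp
        finally show ?thesis by (simp add: usphere_def u_def Rn_def space_PiM)
      qed
      have du: "dist2 p u d0 = \<eta>"
        unfolding l(3)[symmetric] g_def dist2_def by (rule L2_set_cong) (auto simp: u_def)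
      have dotu: "dot p x u = ((1 - l) * dot p x d0 + l * dot p x d) / N l" for x
      proof -
        have "dot p x u = dot p x (v l) / N l"
          unfolding dot_def sum_divide_distrib by (intro sum.cong) (auto simp: u_def)
        then show ?thesis by (simp add: v_def dot_linear)
      qed
      have "wedge_set \<mu> p u d0 \<subseteq> wedge_set \<mu> p d d0"
      proof
        fix x assume "x \<in> wedge_set \<mu> p u d0"
        then have x: "x \<in> space \<mu>" "(0 < dot p x u) \<noteq> (0 < dot p x d0)"
          by (auto simp: wedge_set_def sign_pm_def split: if_splits)
        have "0 < dot p x u \<longleftrightarrow> 0 < (1 - l) * dot p x d0 + l * dot p x d"
          using Npos[OF l(1,2)] by (simp add: dotu zero_less_divide_iff)
        moreover have "0 < (1 - l) * dot p x d0 + l * dot p x d" if "0 < dot p x d0" "0 < dot p x d"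
          using that lpos l(2) by (intro add_nonneg_pos) auto
        moreover have "\<not> 0 < (1 - l) * dot p x d0 + l * dot p x d" if "\<not> 0 < dot p x d0" "\<not> 0 < dot p x d"
        proof -
          have "(1 - l) * dot p x d0 \<le> 0" "l * dot p x d \<le> 0"
            using that lpos l(2) by (auto intro!: mult_nonneg_nonpos)
          then show ?thesis by linarith
        qed
        ultimately have "(0 < dot p x d) \<noteq> (0 < dot p x d0)" using x(2) by blast
        then show "x \<in> wedge_set \<mu> p d d0" using x(1) by (auto simp: wedge_set_def sign_pm_def)
      qed
      then have "prob (wedge_set \<mu> p u d0) \<le> prob (wedge_set \<mu> p d d0)"
        by (rule finite_measure_mono) (rule wedge_set_measurable[OF \<mu>(2)])
      moreover have "c * \<eta> \<le> prob (wedge_set \<mu> p u d0)" using wedge'[OF uS] du by simp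
      moreover have "?c * dist2 p d d0 \<le> c * \<eta>" by (rule bnd) auto
      ultimately show ?thesis by linarith
    qed
  qed
qed

section \<open>The good event\<close>

text \<open>The level \<open>8 L\<^sub>m\<close> beats the \<open>exp (3 L\<^sub>m)\<close> patterns with enough room left for the union over
  the \<open>p\<close> models, since \<open>p \<le> 2 exp V\<^sub>m\<close>; likewise for the factor 200.\<close>

definition good_sample ::
  "nat \<Rightarrow> nat \<Rightarrow> (real \<times> real) set \<Rightarrow> (nat \<Rightarrow> real) measure \<Rightarrow> (nat \<Rightarrow> real) \<Rightarrow> real \<Rightarrow> real \<Rightarrow> real \<Rightarrow> real \<Rightarrow>
   (nat \<Rightarrow> nat \<Rightarrow> real) \<Rightarrow> (nat \<Rightarrow> real) \<Rightarrow> bool" where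
  "good_sample n p \<Omega> \<mu> d0 \<sigma> c Z h x e \<longleftrightarrow>
     (\<forall>m\<in>{1..p}. \<forall>d\<in>sparse_dirs p m. \<forall>T\<in>cell_set n (hs_pattern n p x d) (hs_pattern n p x d0).
        \<bar>\<Sum>i\<in>T. e i\<bar> \<le> 2 * \<sigma> * sqrt (real (card T) * (8 * vc_log n (V_model p \<Omega> m))) +
          2 * c * (8 * vc_log n (V_model p \<Omega> m))) \<and>
     (\<forall>m\<in>{1..p}. \<forall>d\<in>sparse_dirs p m.
        200 * vc_log n (V_model p \<Omega> m) \<le> real n * measure \<mu> (wedge_set \<mu> p d d0) \<longrightarrow>
        real n * measure \<mu> (wedge_set \<mu> p d d0) / 8 \<le>
          real (card (cell10 (hs_pattern n p x d) (hs_pattern n p x d0))) +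
          real (card (cell01 (hs_pattern n p x d) (hs_pattern n p x d0)))) \<and>
     h \<le> real (card (hs_pattern n p x d0)) \<and> h \<le> real n - real (card (hs_pattern n p x d0)) \<and>
     \<bar>\<Sum>i\<in>hs_pattern n p x d0. e i\<bar> \<le> Z \<and> \<bar>\<Sum>i\<in>{..<n} - hs_pattern n p x d0. e i\<bar> \<le> Z"

lemma hs_pattern_cong: "(\<And>i. i < n \<Longrightarrow> x i = x' i) \<Longrightarrow> hs_pattern n p x d = hs_pattern n p x' d"
  by (auto simp: hs_pattern_def)

context iid_model
begin

lemma Xv_pattern: "hs_pattern n p (Xv \<omega>) d = hs_pattern n p (\<lambda>i. X i \<omega>) d"
  by (rule hs_pattern_cong) (simp add: Xv_def)

lemma integral_xi_square: "i < n \<Longrightarrow> (\<integral>\<omega>. (\<xi> i \<omega>)\<^sup>2 \<partial>M) = (\<integral>x. x\<^sup>2 \<partial>\<nu>)"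
  by (subst law_xi_eq[symmetric], assumption, subst integral_distr) (auto intro: xi_measurable)

lemma integrable_xi_square:
  assumes "integrable \<nu> (\<lambda>x. x\<^sup>2)" "i < n" shows "integrable M (\<lambda>\<omega>. (\<xi> i \<omega>)\<^sup>2)"
proof -
  have "integrable (distr M borel (\<xi> i)) (\<lambda>x. x\<^sup>2)" using assms law_xi_eq by simp
  then show ?thesis by (subst (asm) integrable_distr_eq) (auto intro: xi_measurable assms)
qed

lemma max_square:
  assumes sq: "integrable \<nu> (\<lambda>x. x\<^sup>2)"
  defines "Z \<equiv> \<lambda>\<omega>. Max ((\<lambda>i. (\<xi> i \<omega>)\<^sup>2) ` {..<n})"
  shows "integrable M Z" "\<And>\<omega> i. i < n \<Longrightarrow> (\<xi> i \<omega>)\<^sup>2 \<le> Z \<omega>" "Z \<omega> \<le> (\<Sum>i<n. (\<xi> i \<omega>)\<^sup>2)"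
proof -
  show ge: "(\<xi> i \<omega>)\<^sup>2 \<le> Z \<omega>" if "i < n" for \<omega> i unfolding Z_def using that by (intro Max_ge) auto
  have le: "Z \<omega> \<le> (\<Sum>i<n. (\<xi> i \<omega>)\<^sup>2)" for \<omega>
    unfolding Z_def
  proof (rule Max.boundedI)
    show "(\<lambda>i. (\<xi> i \<omega>)\<^sup>2) ` {..<n} \<noteq> {}" using index_nonempty by blast
    fix a assume "a \<in> (\<lambda>i. (\<xi> i \<omega>)\<^sup>2) ` {..<n}"
    then obtain i where i: "i \<in> {..<n}" "a = (\<xi> i \<omega>)\<^sup>2" by blast
    then show "a \<le> (\<Sum>i<n. (\<xi> i \<omega>)\<^sup>2)"
      using member_le_sum[of i "{..<n}" "\<lambda>i. (\<xi> i \<omega>)\<^sup>2"] by simp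
  qed simp
  show "Z \<omega> \<le> (\<Sum>i<n. (\<xi> i \<omega>)\<^sup>2)" by (rule le)
  have Z0: "0 \<le> Z \<omega>" for \<omega> using ge[of 0 \<omega>] n by (intro order_trans[OF zero_le_power2[of "\<xi> 0 \<omega>"]]) simp
  have Zm: "Z \<in> borel_measurable M"
    unfolding Z_def using xi_measurable by (intro borel_measurable_Max) auto
  have si: "integrable M (\<lambda>\<omega>. \<Sum>i<n. (\<xi> i \<omega>)\<^sup>2)"
    by (intro Bochner_Integration.integrable_sum integrable_xi_square[OF sq]) auto
  have ae: "AE \<omega> in M. norm (Z \<omega>) \<le> norm (\<Sum>i<n. (\<xi> i \<omega>)\<^sup>2)"
  proof (rule AE_I2)
    fix \<omega>
    have "norm (Z \<omega>) = Z \<omega>" using Z0[of \<omega>] by (simp only: real_norm_def abs_of_nonneg)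
    also have "\<dots> \<le> norm (\<Sum>i<n. (\<xi> i \<omega>)\<^sup>2)"
      unfolding real_norm_def by (rule order_trans[OF le abs_ge_self])
    finally show "norm (Z \<omega>) \<le> norm (\<Sum>i<n. (\<xi> i \<omega>)\<^sup>2)" .
  qed
  show "integrable M Z" by (rule Bochner_Integration.integrable_bound[OF si Zm ae])
qed

lemma envelope2_square:
  "(envelope2 M n \<xi>)\<^sup>2 = (\<integral>\<omega>. Max ((\<lambda>i. (\<xi> i \<omega>)\<^sup>2) ` {..<n}) \<partial>M)"
proof -
  have "0 \<le> Max ((\<lambda>i. (\<xi> i \<omega>)\<^sup>2) ` {..<n})" for \<omega>
  proof -
    have "(\<xi> 0 \<omega>)\<^sup>2 \<le> Max ((\<lambda>i. (\<xi> i \<omega>)\<^sup>2) ` {..<n})" using n by (intro Max_ge) auto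
    then show ?thesis using zero_le_power2 order_trans by blast
  qed
  then have "0 \<le> (\<integral>\<omega>. Max ((\<lambda>i. (\<xi> i \<omega>)\<^sup>2) ` {..<n}) \<partial>M)"
    by (intro Bochner_Integration.integral_nonneg)
  then show ?thesis by (simp add: envelope2_def)
qed

text \<open>The lower bound lets the variance part of the noise be absorbed by a penalty
  proportional to the envelope norm. The upper bound, from replacing the maximum by the sum, keeps
  the truncation part of the side sums of order \<open>sqrt n\<close>.\<close>

lemma envelope2_bounds:
  assumes sq: "integrable \<nu> (\<lambda>x. x\<^sup>2)" and \<sigma>: "0 \<le> \<sigma>" "\<sigma>\<^sup>2 = (\<integral>x. x\<^sup>2 \<partial>\<nu>)"
  shows "\<sigma> \<le> envelope2 M n \<xi>" "envelope2 M n \<xi> \<le> \<sigma> * sqrt (real n)"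
proof -
  have E0: "0 \<le> envelope2 M n \<xi>"
  proof -
    have "0 \<le> (envelope2 M n \<xi>)\<^sup>2" by simp
    then show ?thesis unfolding envelope2_square by (simp add: envelope2_def)
  qed
  have "\<sigma>\<^sup>2 = (\<integral>\<omega>. (\<xi> 0 \<omega>)\<^sup>2 \<partial>M)" using integral_xi_square[of 0] n \<sigma> by simp
  also have "\<dots> \<le> (envelope2 M n \<xi>)\<^sup>2"
    unfolding envelope2_square using n
    by (intro integral_mono integrable_xi_square[OF sq] max_square[OF sq]) auto
  finally show "\<sigma> \<le> envelope2 M n \<xi>" using E0 by (rule power2_le_imp_le)
  have "(envelope2 M n \<xi>)\<^sup>2 \<le> (\<integral>\<omega>. (\<Sum>i<n. (\<xi> i \<omega>)\<^sup>2) \<partial>M)"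
    unfolding envelope2_square
    by (intro integral_mono max_square[OF sq] Bochner_Integration.integrable_sum integrable_xi_square[OF sq]) auto
  also have "\<dots> = (\<Sum>i<n. \<integral>\<omega>. (\<xi> i \<omega>)\<^sup>2 \<partial>M)"
    by (rule Bochner_Integration.integral_sum) (auto intro: integrable_xi_square[OF sq])
  also have "\<dots> = real n * \<sigma>\<^sup>2" using \<sigma>(2) integral_xi_square by simp
  also have "\<dots> = (\<sigma> * sqrt (real n))\<^sup>2" by (simp add: power_mult_distrib mult.commute)
  finally show "envelope2 M n \<xi> \<le> \<sigma> * sqrt (real n)"
    by (rule power2_le_imp_le) (use \<sigma> in simp)
qed

text \<open>Markov's inequality for the largest squared error, whose mean is the square of the
  envelope norm.\<close>

lemma max_noise:
  assumes sq: "integrable \<nu> (\<lambda>x. x\<^sup>2)" and E: "0 < envelope2 M n \<xi>" and K: "0 < K"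
  shows "{\<omega> \<in> space M. \<exists>i<n. K * envelope2 M n \<xi> < \<bar>\<xi> i \<omega>\<bar>} \<in> events"
    "prob {\<omega> \<in> space M. \<exists>i<n. K * envelope2 M n \<xi> < \<bar>\<xi> i \<omega>\<bar>} \<le> 1 / K\<^sup>2"
proof -
  let ?E = "envelope2 M n \<xi>"
  let ?Z = "\<lambda>\<omega>. Max ((\<lambda>i. (\<xi> i \<omega>)\<^sup>2) ` {..<n})"
  have "{\<omega> \<in> space M. \<exists>i<n. K * ?E < \<bar>\<xi> i \<omega>\<bar>} = (\<Union>i\<in>{..<n}. {\<omega> \<in> space M. K * ?E < \<bar>\<xi> i \<omega>\<bar>})" by auto
  also have "\<dots> \<in> events" using xi_measurable by (intro sets.finite_UN) auto
  finally show "{\<omega> \<in> space M. \<exists>i<n. K * ?E < \<bar>\<xi> i \<omega>\<bar>} \<in> events" .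
  have Zm: "?Z \<in> borel_measurable M" using max_square(1)[OF sq] by (rule borel_measurable_integrable)
  have Z0: "0 \<le> ?Z \<omega>" for \<omega>
    using order_trans[OF zero_le_power2 max_square(2)[OF sq, of 0 \<omega>]] n by simp
  have "{\<omega> \<in> space M. \<exists>i<n. K * ?E < \<bar>\<xi> i \<omega>\<bar>} \<subseteq> {\<omega> \<in> space M. K\<^sup>2 * ?E\<^sup>2 \<le> ?Z \<omega>}"
  proof
    fix \<omega> assume "\<omega> \<in> {\<omega> \<in> space M. \<exists>i<n. K * ?E < \<bar>\<xi> i \<omega>\<bar>}"
    then obtain i where i: "\<omega> \<in> space M" "i < n" "K * ?E < \<bar>\<xi> i \<omega>\<bar>" by blast
    have "(K * ?E)\<^sup>2 \<le> \<bar>\<xi> i \<omega>\<bar>\<^sup>2" using i(3) K E by (intro power_mono) auto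
    also have "\<dots> \<le> ?Z \<omega>" using max_square(2)[OF sq i(2)] by simp
    finally show "\<omega> \<in> {\<omega> \<in> space M. K\<^sup>2 * ?E\<^sup>2 \<le> ?Z \<omega>}" using i(1) by (simp add: power_mult_distrib)
  qed
  then have "prob {\<omega> \<in> space M. \<exists>i<n. K * ?E < \<bar>\<xi> i \<omega>\<bar>} \<le> prob {\<omega> \<in> space M. K\<^sup>2 * ?E\<^sup>2 \<le> ?Z \<omega>}"
    using Zm by (intro finite_measure_mono) auto
  also have "\<dots> \<le> (\<integral>\<omega>. ?Z \<omega> \<partial>M) / (K\<^sup>2 * ?E\<^sup>2)"
    using K E Z0 by (intro integral_Markov_inequality_measure[where A = "{}"] max_square[OF sq]) auto
  also have "\<dots> = 1 / K\<^sup>2" unfolding envelope2_square[symmetric] using E by simp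
  finally show "prob {\<omega> \<in> space M. \<exists>i<n. K * ?E < \<bar>\<xi> i \<omega>\<bar>} \<le> 1 / K\<^sup>2" .
qed

text \<open>The exceptional event is defined with truncated errors, to which Bernstein's inequality
  applies. Boundedness of the errors stays a premise on the single outcome, where truncation changes
  nothing; conditioning on bounded errors is thus avoided.\<close>

lemma bernstein_patterns:
  assumes sym: "distr \<nu> borel uminus = \<nu>" and sq: "integrable \<nu> (\<lambda>x. x\<^sup>2)"
    and \<sigma>: "0 < \<sigma>" "\<sigma>\<^sup>2 = (\<integral>x. x\<^sup>2 \<partial>\<nu>)" and c: "0 < c" and t: "0 < t"
    and T: "\<And>T. {x \<in> space (PiM {..<n} (\<lambda>_. Rn p)). T \<in> \<T> x} \<in> sets (PiM {..<n} (\<lambda>_. Rn p))"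
    and sub: "\<And>x. \<T> x \<subseteq> Pow {..<n}"
    and cardT: "\<forall>x\<in>space (PiM {..<n} (\<lambda>_. Rn p)). real (card (\<T> x)) \<le> K"
  shows "\<exists>B\<in>events. prob B \<le> K * (2 * exp (- t)) \<and>
    (\<forall>\<omega>\<in>space M - B. \<forall>T\<in>\<T> (Xv \<omega>). (\<forall>i<n. \<bar>\<xi> i \<omega>\<bar> \<le> c) \<longrightarrow>
      \<bar>\<Sum>i\<in>T. \<xi> i \<omega>\<bar> \<le> 2 * \<sigma> * sqrt (real (card T) * t) + 2 * c * t)"
proof -
  define y where "y = (\<lambda>T :: nat set. 2 * \<sigma> * sqrt (real (card T) * t) + 2 * c * t)"
  define C where "C = (\<lambda>T. {z \<in> space (PiM {..<n} (\<lambda>_. borel :: real measure)). y T \<le> \<bar>\<Sum>i\<in>T. truncate c (z i)\<bar>})"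
  define B where "B = {\<omega> \<in> space M. \<exists>T\<in>\<T> (Xv \<omega>). xiv \<omega> \<in> C T}"
  have sp: "xiv \<omega> \<in> space (PiM {..<n} (\<lambda>_. borel :: real measure))" for \<omega>
    by (simp add: space_PiM xiv_def)
  have tr: "(\<Sum>i\<in>T. truncate c (xiv \<omega> i)) = (\<Sum>i\<in>T. truncate c (\<xi> i \<omega>))" if "T \<subseteq> {..<n}" for T \<omega>
    using that by (intro sum.cong) (auto simp: xiv_def)
  have Cm: "C T \<in> sets (PiM {..<n} (\<lambda>_. borel :: real measure))" if T: "T \<subseteq> {..<n}" for T
  proof -
    have "(\<lambda>z. truncate c (z i)) \<in> borel_measurable (PiM {..<n} (\<lambda>_. borel :: real measure))" if "i \<in> T" for i
      using that T by (intro measurable_compose[OF _ truncate_measurable] measurable_component_singleton) auto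
    then have [measurable]: "(\<lambda>z. \<Sum>i\<in>T. truncate c (z i)) \<in> borel_measurable (PiM {..<n} (\<lambda>_. borel :: real measure))"
      by (rule borel_measurable_sum)
    show ?thesis unfolding C_def by measurable
  qed
  have Cp: "prob {\<omega> \<in> space M. xiv \<omega> \<in> C T} \<le> 2 * exp (- t)" if T: "T \<subseteq> {..<n}" for T
  proof -
    have "{\<omega> \<in> space M. xiv \<omega> \<in> C T} = {\<omega> \<in> space M. y T \<le> \<bar>\<Sum>i\<in>T. truncate c (\<xi> i \<omega>)\<bar>}"
      using sp tr[OF T] by (auto simp: C_def)
    moreover have "prob {\<omega> \<in> space M. y T \<le> \<bar>\<Sum>i\<in>T. truncate c (\<xi> i \<omega>)\<bar>} \<le> 2 * exp (- t)"
      unfolding y_def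
      by (rule bernstein_truncated[OF nu sym sq _ _ _ c t \<sigma>])
         (use T finite_subset indep_vars_subset[OF indep_xi T] law_xi_eq in auto)
    ultimately show ?thesis by simp
  qed
  show ?thesis
  proof (intro bexI[of _ B] conjI ballI impI)
    show "B \<in> events" unfolding B_def
      by (rule union_bound_patterns(1)[OF T sub bspec[OF cardT] Cm Cp]) auto
    show "prob B \<le> K * (2 * exp (- t))" unfolding B_def
      by (rule union_bound_patterns(2)[OF T sub bspec[OF cardT] Cm Cp]) auto
    fix \<omega> T assume w: "\<omega> \<in> space M - B" and TT: "T \<in> \<T> (Xv \<omega>)" and b: "\<forall>i<n. \<bar>\<xi> i \<omega>\<bar> \<le> c"
    have Ts: "T \<subseteq> {..<n}" using TT sub by blast
    have "xiv \<omega> \<notin> C T" using w TT by (auto simp: B_def)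
    then have "\<bar>\<Sum>i\<in>T. truncate c (\<xi> i \<omega>)\<bar> \<le> y T" using sp tr[OF Ts] by (auto simp: C_def)
    moreover have "(\<Sum>i\<in>T. truncate c (\<xi> i \<omega>)) = (\<Sum>i\<in>T. \<xi> i \<omega>)"
      using Ts b by (intro sum.cong) (auto simp: truncate_def)
    ultimately show "\<bar>\<Sum>i\<in>T. \<xi> i \<omega>\<bar> \<le> 2 * \<sigma> * sqrt (real (card T) * t) + 2 * c * t" by (simp add: y_def)
  qed
qed

lemma side_counts:
  assumes A: "A \<in> sets (Rn p)" and a: "a \<le> measure \<mu> A" "0 \<le> a"
  shows "{\<omega> \<in> space M. real (card {i\<in>{..<n}. X i \<omega> \<in> A}) \<le> real n * a / 2} \<in> events"
    "prob {\<omega> \<in> space M. real (card {i\<in>{..<n}. X i \<omega> \<in> A}) \<le> real n * a / 2} \<le> exp (- real n * a / 8)"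
proof -
  have m: "(\<lambda>\<omega>. real (card {i\<in>{..<n}. X i \<omega> \<in> A})) \<in> borel_measurable M"
  proof -
    have "(\<lambda>\<omega>. real (card {i\<in>{..<n}. X i \<omega> \<in> A})) = (\<lambda>\<omega>. \<Sum>i\<in>{..<n}. indicat_real A (X i \<omega>))"
      by (simp add: indicator_def sum.If_cases Int_def of_bool_def)
    moreover have "(\<lambda>\<omega>. \<Sum>i\<in>{..<n}. indicat_real A (X i \<omega>)) \<in> borel_measurable M"
      by (intro borel_measurable_sum measurable_compose[OF X_measurable] borel_measurable_indicator A) auto
    ultimately show ?thesis by simp
  qed
  then show "{\<omega> \<in> space M. real (card {i\<in>{..<n}. X i \<omega> \<in> A}) \<le> real n * a / 2} \<in> events"
    by (rule borel_measurable_le) simp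
  have "prob {\<omega> \<in> space M. real (card {i\<in>{..<n}. X i \<omega> \<in> A}) \<le> real n * a / 2}
      \<le> prob {\<omega> \<in> space M. real (card {i\<in>{..<n}. X i \<omega> \<in> A}) \<le> real (card {..<n}) * measure \<mu> A / 2}"
  proof (rule finite_measure_mono)
    have "real n * a \<le> real n * measure \<mu> A" using a by (intro mult_left_mono) auto
    then show "{\<omega> \<in> space M. real (card {i\<in>{..<n}. X i \<omega> \<in> A}) \<le> real n * a / 2} \<subseteq>
      {\<omega> \<in> space M. real (card {i\<in>{..<n}. X i \<omega> \<in> A}) \<le> real (card {..<n}) * measure \<mu> A / 2}"
      by auto
    show "{\<omega> \<in> space M. real (card {i\<in>{..<n}. X i \<omega> \<in> A}) \<le> real (card {..<n}) * measure \<mu> A / 2} \<in> events"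
      using m by (rule borel_measurable_le) simp
  qed
  also have "\<dots> \<le> exp (- real (card {..<n}) * measure \<mu> A / 8)"
    by (rule count_lower_tail[OF _ indep_X A]) (auto intro: X_prob A)
  also have "\<dots> \<le> exp (- real n * a / 8)" using a(1) by (simp add: mult_left_mono)
  finally show "prob {\<omega> \<in> space M. real (card {i\<in>{..<n}. X i \<omega> \<in> A}) \<le> real n * a / 2} \<le> exp (- real n * a / 8)" .
qed

lemma prob_Xv:
  assumes "B \<in> sets (PiM {..<n} (\<lambda>_. \<mu>))"
  shows "{\<omega> \<in> space M. Xv \<omega> \<in> B} \<in> events" "prob {\<omega> \<in> space M. Xv \<omega> \<in> B} = measure (PiM {..<n} (\<lambda>_. \<mu>)) B"
proof -
  have "sets (PiM {..<n} (\<lambda>_. \<mu>)) = sets (PiM {..<n} (\<lambda>_. Rn p))" by (intro sets_PiM_cong) (auto simp: mu)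
  then have m: "Xv \<in> M \<rightarrow>\<^sub>M PiM {..<n} (\<lambda>_. \<mu>)" using Xv_measurable measurable_cong_sets by blast
  have e: "{\<omega> \<in> space M. Xv \<omega> \<in> B} = Xv -` B \<inter> space M" by auto
  show "{\<omega> \<in> space M. Xv \<omega> \<in> B} \<in> events" unfolding e by (rule measurable_sets[OF m assms])
  show "prob {\<omega> \<in> space M. Xv \<omega> \<in> B} = measure (PiM {..<n} (\<lambda>_. \<mu>)) B"
    unfolding e by (subst law_Xv[symmetric]) (rule measure_distr[OF m assms, symmetric])
qed

text \<open>In order, the failure terms come from errors above the truncation level, the noise sums
  over the two sides of \<open>d0\<close>, and the counts on these sides. The last one is
  \<open>32 / p\<close> for four cells in \<open>p\<close> models plus \<open>8 / p\<close> for the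
  wedges, each event costing at most \<open>8 / p ^ 2\<close>.\<close>

lemma good_event:
  assumes sym: "distr \<nu> borel uminus = \<nu>" and sq: "integrable \<nu> (\<lambda>x. x\<^sup>2)"
    and \<sigma>: "0 < \<sigma>" "\<sigma>\<^sup>2 = (\<integral>x. x\<^sup>2 \<partial>\<nu>)"
    and ab: "(\<alpha>0, \<beta>0) \<in> \<Omega>" "\<beta>0 < \<alpha>0" and p: "3 \<le> p" and K: "0 < K" and y: "0 < y"
    and sides: "a \<le> measure \<mu> {x \<in> space \<mu>. dot p x d0 \<le> 0}" "a \<le> measure \<mu> {x \<in> space \<mu>. 0 < dot p x d0}" "0 \<le> a"
  defines "c \<equiv> K * envelope2 M n \<xi>"
    and "L \<equiv> \<lambda>m. vc_log n (V_model p \<Omega> m)"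
    and "P \<equiv> \<lambda>\<omega> d. hs_pattern n p (\<lambda>i. X i \<omega>) d"
  shows "\<exists>B\<in>events. prob B \<le> 1 / K\<^sup>2 + 4 * exp (- y) + 2 * exp (- real n * a / 8) + 40 / real p \<and>
    (\<forall>\<omega>\<in>space M - B. good_sample n p \<Omega> \<mu> d0 \<sigma> c (2 * \<sigma> * sqrt (real n * y) + 2 * c * y) (real n * a / 2)
      (\<lambda>i. X i \<omega>) (\<lambda>i. \<xi> i \<omega>))"
proof -
  have E: "0 < envelope2 M n \<xi>" using envelope2_bounds(1)[OF sq _ \<sigma>(2)] \<sigma>(1) by linarith
  then have c: "0 < c" using K by (simp add: c_def)
  have Psub: "P \<omega> d \<subseteq> {..<n}" for \<omega> d by (auto simp: P_def hs_pattern_def)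
  have Pfin: "finite (P \<omega> d)" for \<omega> d using Psub finite_subset by blast
  define E1 where "E1 = {\<omega> \<in> space M. \<exists>i<n. K * envelope2 M n \<xi> < \<bar>\<xi> i \<omega>\<bar>}"
  note E1 = max_noise[OF sq E K, folded E1_def]
  have bounded: "\<bar>\<xi> i \<omega>\<bar> \<le> c" if "\<omega> \<in> space M - E1" "i < n" for \<omega> i
    by (rule ccontr) (use that in \<open>auto simp: E1_def c_def not_le\<close>)
  have V: "1 \<le> V_model p \<Omega> m" "real p \<le> 2 * exp (real (V_model p \<Omega> m))" if "m \<in> {1..p}" for m
    using le_exp_V_model[OF ab _ _ p, of m] that by auto
  have L1: "1 \<le> L m" if "m \<in> {1..p}" for m
    using vc_log_ge[of "V_model p \<Omega> m" n] V(1)[OF that] by (simp add: L_def)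
  have expL: "exp (- 2 * L m) \<le> 4 / (real p)\<^sup>2" if m: "m \<in> {1..p}" for m
  proof -
    have "real p \<le> 2 * exp (real (V_model p \<Omega> m))" by (rule V(2)[OF m])
    also have "\<dots> \<le> 2 * exp (L m)" using vc_log_ge by (simp add: L_def)
    finally have "(real p)\<^sup>2 \<le> (2 * exp (L m))\<^sup>2" by (intro power_mono) auto
    also have "\<dots> = 4 * exp (2 * L m)" by (simp add: power_mult_distrib exp_double)
    finally show ?thesis using p by (simp add: exp_minus field_simps)
  qed
  have card_pat: "real (card (hs_pattern N p x ` sparse_dirs p m)) \<le> exp (3 * L m)"
    if m: "m \<in> {1..p}" and x: "x \<in> space (PiM {..<N} (\<lambda>_. Rn p))" and N: "N \<le> 2 * n" for m x N
    unfolding L_def using m V(1)[OF m] x N n p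
    by (intro card_hs_patterns_le[OF ab]) (auto simp: space_PiM)
  define cells where "cells = {cell11, cell10, cell01, cell00 n}"
  define Q2 where "Q2 = (\<lambda>m f B. B \<in> events \<and> prob B \<le> 8 / (real p)\<^sup>2 \<and>
      (\<forall>\<omega> d. \<omega> \<in> space M - B \<longrightarrow> (\<forall>i<n. \<bar>\<xi> i \<omega>\<bar> \<le> c) \<longrightarrow> d \<in> sparse_dirs p m \<longrightarrow>
        \<bar>\<Sum>i\<in>f (P \<omega> d) (P \<omega> d0). \<xi> i \<omega>\<bar> \<le> 2 * \<sigma> * sqrt (real (card (f (P \<omega> d) (P \<omega> d0))) * (8 * L m)) + 2 * c * (8 * L m)))"
  have ex2: "\<exists>B. Q2 m f B"
    if m: "m \<in> {1..p}" and f: "f \<in> cells" for m f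
  proof -
    have sub: "\<And>x. side_pattern f n p m d0 x \<subseteq> Pow {..<n}"
      using f by (auto simp: side_pattern_def cells_def cell_defs hs_pattern_def)
    have crd: "\<forall>x\<in>space (PiM {..<n} (\<lambda>_. Rn p)). real (card (side_pattern f n p m d0 x)) \<le> exp (3 * L m)"
    proof
      fix x assume "x \<in> space (PiM {..<n} (\<lambda>_. Rn p))"
      then show "real (card (side_pattern f n p m d0 x)) \<le> exp (3 * L m)"
        using card_pat[OF m, of x n] card_side_pattern_le[of f n p m d0 x] by linarith
    qed
    have pos: "0 < 8 * L m" using L1[OF m] by simp
    obtain B where B: "B \<in> events" "prob B \<le> exp (3 * L m) * (2 * exp (- (8 * L m)))"
      "\<forall>\<omega>\<in>space M - B. \<forall>T\<in>side_pattern f n p m d0 (Xv \<omega>). (\<forall>i<n. \<bar>\<xi> i \<omega>\<bar> \<le> c) \<longrightarrow>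
        \<bar>\<Sum>i\<in>T. \<xi> i \<omega>\<bar> \<le> 2 * \<sigma> * sqrt (real (card T) * (8 * L m)) + 2 * c * (8 * L m)"
      using bernstein_patterns[OF sym sq \<sigma> c pos side_pattern_measurable sub crd] by (elim bexE conjE)
    \<comment> \<open>\<open>3 * L m\<close> from the number of patterns against
      \<open>8 * L m\<close> from the Bernstein level.\<close>
    have "prob B \<le> 2 * exp (- 5 * L m)" using B(2) by (simp add: mult.left_commute exp_add[symmetric])
    also have "\<dots> \<le> 2 * exp (- 2 * L m)" using L1[OF m] by simp
    also have "\<dots> \<le> 8 / (real p)\<^sup>2" using expL[OF m] by simp
    finally have pB: "prob B \<le> 8 / (real p)\<^sup>2" .
    have "f (P \<omega> d) (P \<omega> d0) \<in> side_pattern f n p m d0 (Xv \<omega>)" if "d \<in> sparse_dirs p m" for \<omega> d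
      using that unfolding side_pattern_def P_def Xv_pattern by blast
    then have "\<bar>\<Sum>i\<in>f (P \<omega> d) (P \<omega> d0). \<xi> i \<omega>\<bar> \<le> 2 * \<sigma> * sqrt (real (card (f (P \<omega> d) (P \<omega> d0))) * (8 * L m)) + 2 * c * (8 * L m)"
      if "\<omega> \<in> space M - B" "\<forall>i<n. \<bar>\<xi> i \<omega>\<bar> \<le> c" "d \<in> sparse_dirs p m" for \<omega> d
      using bspec[OF bspec[OF B(3) that(1)]] that by blast
    then have "Q2 m f B" unfolding Q2_def using B(1) pB by blast
    then show ?thesis by blast
  qed
  \<comment> \<open>One exceptional event is fixed for each model and cell before the union is
    formed, hence the choice operator.\<close>
  define E2 where "E2 = (\<lambda>m f. SOME B. Q2 m f B)"
  have E2Q: "Q2 m f (E2 m f)" if "m \<in> {1..p}" "f \<in> cells" for m f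
    unfolding E2_def by (rule someI_ex[OF ex2[OF that]])
  have E2: "\<And>m f. m \<in> {1..p} \<Longrightarrow> f \<in> cells \<Longrightarrow> E2 m f \<in> events"
    "\<And>m f. m \<in> {1..p} \<Longrightarrow> f \<in> cells \<Longrightarrow> prob (E2 m f) \<le> 8 / (real p)\<^sup>2"
    "\<And>m f \<omega> d. m \<in> {1..p} \<Longrightarrow> f \<in> cells \<Longrightarrow> \<omega> \<in> space M - E2 m f \<Longrightarrow> (\<forall>i<n. \<bar>\<xi> i \<omega>\<bar> \<le> c) \<Longrightarrow> d \<in> sparse_dirs p m \<Longrightarrow>
        \<bar>\<Sum>i\<in>f (P \<omega> d) (P \<omega> d0). \<xi> i \<omega>\<bar> \<le> 2 * \<sigma> * sqrt (real (card (f (P \<omega> d) (P \<omega> d0))) * (8 * L m)) + 2 * c * (8 * L m)"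
    using E2Q unfolding Q2_def by blast+
  define Q3 where "Q3 = (\<lambda>m B. B \<in> events \<and> prob B \<le> 8 / (real p)\<^sup>2 \<and>
      (\<forall>\<omega> d. \<omega> \<in> space M - B \<longrightarrow> d \<in> sparse_dirs p m \<longrightarrow> 200 * L m \<le> real n * measure \<mu> (wedge_set \<mu> p d d0) \<longrightarrow>
       real n * measure \<mu> (wedge_set \<mu> p d d0) / 8 \<le> real (card (cell10 (P \<omega> d) (P \<omega> d0))) + real (card (cell01 (P \<omega> d) (P \<omega> d0)))))"
  have ex3: "\<exists>B. Q3 m B"
    if m: "m \<in> {1..p}" for m
  proof -
    define u where "u = 200 * L m / real n"
    have nu_eq: "real n * u = 200 * L m" using n by (simp add: u_def)
    have u8: "8 \<le> real n * u" unfolding nu_eq using L1[OF m] by simp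
    have "\<forall>z\<in>space (PiM {..<2 * n} (\<lambda>_. Rn p)). real (card (hs_pattern (2 * n) p z ` sparse_dirs p m)) \<le> exp (3 * L m)"
      using card_pat[OF m _ order_refl] by blast
    then obtain B where B: "B \<in> sets (PiM {..<n} (\<lambda>_. \<mu>))"
      "measure (PiM {..<n} (\<lambda>_. \<mu>)) B \<le> 2 * exp (3 * L m) * exp (- real n * u / 32)"
      "\<forall>x\<in>space (PiM {..<n} (\<lambda>_. \<mu>)) - B. \<forall>d\<in>sparse_dirs p m. u \<le> measure \<mu> (wedge_set \<mu> p d d0) \<longrightarrow>
       real n * measure \<mu> (wedge_set \<mu> p d d0) / 8 \<le> real (card {i\<in>{..<n}. x i \<in> wedge_set \<mu> p d d0})"
      using ghost_sample_bound[OF mu n _ u8, of m "exp (3 * L m)" d0] by (elim meta_impE bexE conjE)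
    let ?B = "{\<omega> \<in> space M. Xv \<omega> \<in> B}"
    have "prob ?B \<le> 2 * exp (3 * L m) * exp (- real n * u / 32)" using prob_Xv(2)[OF B(1)] B(2) by simp
    \<comment> \<open>\<open>200 / 32 = 25/4\<close> exceeds the 3 of the pattern count by
      \<open>13/4\<close>.\<close>
    also have "\<dots> = 2 * exp (- (13/4) * L m)"
    proof -
      have e: "- real n * u / 32 = - (25/4) * L m" using nu_eq by simp
      show ?thesis unfolding e mult.assoc exp_add[symmetric] by simp
    qed
    also have "\<dots> \<le> 2 * exp (- 2 * L m)" using L1[OF m] by simp
    also have "\<dots> \<le> 8 / (real p)\<^sup>2" using expL[OF m] by simp
    finally have pB: "prob ?B \<le> 8 / (real p)\<^sup>2" .
    have "real n * measure \<mu> (wedge_set \<mu> p d d0) / 8 \<le> real (card (cell10 (P \<omega> d) (P \<omega> d0))) + real (card (cell01 (P \<omega> d) (P \<omega> d0)))"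
      if w: "\<omega> \<in> space M - ?B" and d: "d \<in> sparse_dirs p m" and l: "200 * L m \<le> real n * measure \<mu> (wedge_set \<mu> p d d0)" for \<omega> d
    proof -
      have "Xv \<omega> \<in> space (PiM {..<n} (\<lambda>_. Rn p))" using measurable_space[OF Xv_measurable] w by blast
      moreover have "space (PiM {..<n} (\<lambda>_. Rn p)) = space (PiM {..<n} (\<lambda>_. \<mu>))"
        using sets_eq_imp_space_eq[OF mu(2)] by (simp add: space_PiM)
      ultimately have x: "Xv \<omega> \<in> space (PiM {..<n} (\<lambda>_. \<mu>)) - B" using w by auto
      have "u \<le> measure \<mu> (wedge_set \<mu> p d d0)" using l n by (simp add: u_def field_simps)
      then have "real n * measure \<mu> (wedge_set \<mu> p d d0) / 8 \<le> real (card {i\<in>{..<n}. Xv \<omega> i \<in> wedge_set \<mu> p d d0})"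
        by (rule B(3)[rule_format, OF x d])
      also have "{i\<in>{..<n}. Xv \<omega> i \<in> wedge_set \<mu> p d d0} = sdiff (P \<omega> d) (P \<omega> d0)"
        unfolding P_def Xv_pattern[symmetric] using x by (subst sdiff_hs_pattern[where \<mu> = \<mu>]) (auto simp: space_PiM)
      also have "card \<dots> = card (cell10 (P \<omega> d) (P \<omega> d0)) + card (cell01 (P \<omega> d) (P \<omega> d0))"
        unfolding cell10_def cell01_def using Pfin by (intro card_Un_disjoint) auto
      finally show ?thesis by simp
    qed
    then have "Q3 m ?B" unfolding Q3_def using pB prob_Xv(1)[OF B(1)] by blast
    then show ?thesis by blast
  qed
  define E3 where "E3 = (\<lambda>m. SOME B. Q3 m B)"
  have E3Q: "Q3 m (E3 m)" if "m \<in> {1..p}" for m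
    unfolding E3_def by (rule someI_ex[OF ex3[OF that]])
  have E3: "\<And>m. m \<in> {1..p} \<Longrightarrow> E3 m \<in> events" "\<And>m. m \<in> {1..p} \<Longrightarrow> prob (E3 m) \<le> 8 / (real p)\<^sup>2"
    "\<And>m \<omega> d. m \<in> {1..p} \<Longrightarrow> \<omega> \<in> space M - E3 m \<Longrightarrow> d \<in> sparse_dirs p m \<Longrightarrow> 200 * L m \<le> real n * measure \<mu> (wedge_set \<mu> p d d0) \<Longrightarrow>
       real n * measure \<mu> (wedge_set \<mu> p d d0) / 8 \<le> real (card (cell10 (P \<omega> d) (P \<omega> d0))) + real (card (cell01 (P \<omega> d) (P \<omega> d0)))"
    using E3Q unfolding Q3_def by blast+
  have spmu: "space \<mu> = space (Rn p)" by (rule sets_eq_imp_space_eq[OF mu(2)])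
  define A1 A2 where "A1 = {x \<in> space \<mu>. dot p x d0 \<le> 0}" and "A2 = {x \<in> space \<mu>. 0 < dot p x d0}"
  have A12: "A1 \<in> sets (Rn p)" "A2 \<in> sets (Rn p)" unfolding A1_def A2_def spmu by measurable
  define E4 where "E4 = (\<lambda>A. {\<omega> \<in> space M. real (card {i\<in>{..<n}. X i \<omega> \<in> A}) \<le> real n * a / 2})"
  have E41: "E4 A1 \<in> events" "prob (E4 A1) \<le> exp (- real n * a / 8)"
    unfolding E4_def using side_counts[OF A12(1) sides(1)[folded A1_def] sides(3)] by blast+
  have E42: "E4 A2 \<in> events" "prob (E4 A2) \<le> exp (- real n * a / 8)"
    unfolding E4_def using side_counts[OF A12(2) sides(2)[folded A2_def] sides(3)] by blast+
  \<comment> \<open>The sides of \<open>d0\<close> involve no candidate direction. A family of two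
    sets needs no complexity term, so the level \<open>y\<close> can stay fixed while
    \<open>n\<close> grows.\<close>
  define \<T>0 where "\<T>0 = (\<lambda>x. {hs_pattern n p x d0, {..<n} - hs_pattern n p x d0})"
  have T0_meas: "{x \<in> space (PiM {..<n} (\<lambda>_. Rn p)). T \<in> \<T>0 x} \<in> sets (PiM {..<n} (\<lambda>_. Rn p))" for T
  proof -
    have "{x \<in> space (PiM {..<n} (\<lambda>_. Rn p)). T \<in> \<T>0 x} = {x \<in> space (PiM {..<n} (\<lambda>_. Rn p)). hs_pattern n p x d0 = T} \<union>
       (if T \<subseteq> {..<n} then {x \<in> space (PiM {..<n} (\<lambda>_. Rn p)). hs_pattern n p x d0 = {..<n} - T} else {})"
      by (auto simp: \<T>0_def hs_pattern_def)
    also have "\<dots> \<in> sets (PiM {..<n} (\<lambda>_. Rn p))" using hs_pattern_fixed_measurable by auto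
    finally show ?thesis .
  qed
  have T0_sub: "\<T>0 x \<subseteq> Pow {..<n}" for x by (auto simp: \<T>0_def hs_pattern_def)
  have T0_card: "\<forall>x\<in>space (PiM {..<n} (\<lambda>_. Rn p)). real (card (\<T>0 x)) \<le> 2"
  proof
    fix x
    show "real (card (\<T>0 x)) \<le> 2"
      unfolding \<T>0_def using card_insert_le_m1[of 2 "{{..<n} - hs_pattern n p x d0}" "hs_pattern n p x d0"] by simp
  qed
  obtain E5 where E5: "E5 \<in> events" "prob E5 \<le> 2 * (2 * exp (- y))"
    "\<forall>\<omega>\<in>space M - E5. \<forall>T\<in>\<T>0 (Xv \<omega>). (\<forall>i<n. \<bar>\<xi> i \<omega>\<bar> \<le> c) \<longrightarrow>
      \<bar>\<Sum>i\<in>T. \<xi> i \<omega>\<bar> \<le> 2 * \<sigma> * sqrt (real (card T) * y) + 2 * c * y"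
    using bernstein_patterns[OF sym sq \<sigma> c y T0_meas T0_sub T0_card] by (elim bexE conjE)
  define U2 where "U2 = (\<Union>m\<in>{1..p}. \<Union>f\<in>cells. E2 m f)"
  define U3 where "U3 = (\<Union>m\<in>{1..p}. E3 m)"
  have cells_fin: "finite cells" "card cells \<le> 4"
    unfolding cells_def by (auto intro!: card_insert_le_m1)
  have U2: "U2 \<in> events" unfolding U2_def using E2(1) cells_fin by (intro sets.finite_UN) auto
  have U3: "U3 \<in> events" unfolding U3_def using E3(1) by (intro sets.finite_UN) auto
  have pU2: "prob U2 \<le> 32 / real p"
  proof -
    have "prob U2 \<le> (\<Sum>m\<in>{1..p}. prob (\<Union>f\<in>cells. E2 m f))"
      unfolding U2_def using E2(1) cells_fin by (intro finite_measure_subadditive_finite) (auto intro!: sets.finite_UN)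
    also have "\<dots> \<le> (\<Sum>m\<in>{1..p}. \<Sum>f\<in>cells. prob (E2 m f))"
      using E2(1) cells_fin by (intro sum_mono finite_measure_subadditive_finite) auto
    also have "\<dots> \<le> (\<Sum>m\<in>{1..p}. \<Sum>f\<in>cells. 8 / (real p)\<^sup>2)" using E2(2) by (intro sum_mono) auto
    also have "\<dots> = real p * (real (card cells) * (8 / (real p)\<^sup>2))" by simp
    also have "\<dots> \<le> real p * (4 * (8 / (real p)\<^sup>2))" using cells_fin(2) by (intro mult_left_mono mult_right_mono) auto
    also have "\<dots> = 32 / real p" using p by (simp add: power2_eq_square)
    finally show ?thesis .
  qed
  have pU3: "prob U3 \<le> 8 / real p"
  proof -
    have "prob U3 \<le> (\<Sum>m\<in>{1..p}. prob (E3 m))"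
      unfolding U3_def using E3(1) by (intro finite_measure_subadditive_finite) auto
    also have "\<dots> \<le> (\<Sum>m\<in>{1..p}. 8 / (real p)\<^sup>2)" using E3(2) by (intro sum_mono) auto
    also have "\<dots> = 8 / real p" using p by (simp add: power2_eq_square)
    finally show ?thesis .
  qed
  define B where "B = E1 \<union> E5 \<union> (E4 A1 \<union> E4 A2) \<union> (U2 \<union> U3)"
  have pats: "P \<omega> d0 = {i\<in>{..<n}. X i \<omega> \<in> A1}" "{..<n} - P \<omega> d0 = {i\<in>{..<n}. X i \<omega> \<in> A2}" if "\<omega> \<in> space M" for \<omega>
    using measurable_space[OF X_measurable that] by (auto simp: P_def hs_pattern_def A1_def A2_def spmu)
  show ?thesis
  proof (intro bexI[of _ B] conjI ballI)
    show "B \<in> events" unfolding B_def using E1(1) E5(1) E41(1) E42(1) U2 U3 by (intro sets.Un) auto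
    have "prob B \<le> prob (E1 \<union> E5 \<union> (E4 A1 \<union> E4 A2)) + prob (U2 \<union> U3)"
      unfolding B_def by (rule measure_Un_le) (intro sets.Un E1 E5 E41 E42 U2 U3)+
    also have "\<dots> \<le> prob (E1 \<union> E5) + prob (E4 A1 \<union> E4 A2) + (prob U2 + prob U3)"
      by (intro add_mono measure_Un_le sets.Un E1 E5 E41 E42 U2 U3)
    also have "\<dots> \<le> (prob E1 + prob E5) + (prob (E4 A1) + prob (E4 A2)) + (prob U2 + prob U3)"
      by (intro add_mono measure_Un_le order_refl E1 E5 E41 E42)
    also have "\<dots> \<le> (1 / K\<^sup>2 + 2 * (2 * exp (- y))) + (exp (- real n * a / 8) + exp (- real n * a / 8)) + (32 / real p + 8 / real p)"
      by (intro add_mono E1 E5 E41 E42 pU2 pU3)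
    finally show "prob B \<le> 1 / K\<^sup>2 + 4 * exp (- y) + 2 * exp (- real n * a / 8) + 40 / real p" by simp
    fix \<omega> assume w: "\<omega> \<in> space M - B"
    have b: "\<forall>i<n. \<bar>\<xi> i \<omega>\<bar> \<le> c" using w bounded by (auto simp: B_def)
    have w5: "\<omega> \<in> space M - E5" using w by (auto simp: B_def)
    have T0: "\<bar>\<Sum>i\<in>T. \<xi> i \<omega>\<bar> \<le> 2 * \<sigma> * sqrt (real n * y) + 2 * c * y" if T: "T \<in> \<T>0 (Xv \<omega>)" for T
    proof -
      have "T \<subseteq> {..<n}" using T by (auto simp: \<T>0_def hs_pattern_def)
      then have "card T \<le> n" using card_mono[of "{..<n}" T] by simp
      then have "sqrt (real (card T) * y) \<le> sqrt (real n * y)" using y by simp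
      then have "2 * \<sigma> * sqrt (real (card T) * y) \<le> 2 * \<sigma> * sqrt (real n * y)" using \<sigma>(1) by (intro mult_left_mono) auto
      then show ?thesis using E5(3)[rule_format, OF w5 T] b by fastforce
    qed
    have w': "\<omega> \<in> space M" "\<omega> \<notin> E4 A1" "\<omega> \<notin> E4 A2" using w unfolding B_def by blast+
    then have counts: "real n * a / 2 \<le> real (card {i\<in>{..<n}. X i \<omega> \<in> A1})" "real n * a / 2 \<le> real (card {i\<in>{..<n}. X i \<omega> \<in> A2})"
      unfolding E4_def by simp_all
    have compl: "real n - real (card (P \<omega> d0)) = real (card ({..<n} - P \<omega> d0))"
      using card_mono[OF _ Psub] Pfin Psub by (simp add: card_Diff_subset of_nat_diff)
    have PL: "hs_pattern n p (\<lambda>i. X i \<omega>) d = P \<omega> d" "vc_log n (V_model p \<Omega> m) = L m" for d m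
      by (simp_all add: P_def L_def)
    show "good_sample n p \<Omega> \<mu> d0 \<sigma> c (2 * \<sigma> * sqrt (real n * y) + 2 * c * y) (real n * a / 2) (\<lambda>i. X i \<omega>) (\<lambda>i. \<xi> i \<omega>)"
      unfolding good_sample_def PL
    proof (intro conjI ballI impI)
      fix m d T assume m: "m \<in> {1..p}" and d: "d \<in> sparse_dirs p m" and T: "T \<in> cell_set n (P \<omega> d) (P \<omega> d0)"
      obtain f where f: "f \<in> cells" "T = f (P \<omega> d) (P \<omega> d0)" using T unfolding cells_def cell_set_def by blast
      have "\<omega> \<in> space M - E2 m f" using w m f(1) by (auto simp: B_def U2_def)
      then show "\<bar>\<Sum>i\<in>T. \<xi> i \<omega>\<bar> \<le> 2 * \<sigma> * sqrt (real (card T) * (8 * L m)) + 2 * c * (8 * L m)"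
        unfolding f(2) using E2(3)[OF m f(1)] b d by blast
    next
      fix m d assume m: "m \<in> {1..p}" and d: "d \<in> sparse_dirs p m"
        and l: "200 * L m \<le> real n * measure \<mu> (wedge_set \<mu> p d d0)"
      have "\<omega> \<in> space M - E3 m" using w m by (auto simp: B_def U3_def)
      then show "real n * measure \<mu> (wedge_set \<mu> p d d0) / 8 \<le> real (card (cell10 (P \<omega> d) (P \<omega> d0))) + real (card (cell01 (P \<omega> d) (P \<omega> d0)))"
        using E3(3)[OF m] d l by blast
    next
      show "real n * a / 2 \<le> real (card (P \<omega> d0))" "real n * a / 2 \<le> real n - real (card (P \<omega> d0))"
        using counts unfolding compl pats[OF w'(1), symmetric] by blast+
    qed (auto intro!: T0 simp: \<T>0_def Xv_pattern P_def)
  qed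
qed

end

section \<open>Rates\<close>

text \<open>Monotonicity of \<open>V * ln (n / V)\<close> up to \<open>n / exp 1\<close>, obtained
  without derivatives from \<open>ln (W / V) \<le> W / V - 1\<close>.\<close>

lemma vc_log_le:
  assumes V: "1 \<le> V" "real V \<le> W" and n: "exp 1 \<le> real n / W"
  shows "vc_log n V \<le> W * ln (real n / W)"
proof -
  have W: "0 < W" using V by linarith
  have n0: "0 < real n" using n W by (metis divide_pos_pos exp_gt_zero not_less_iff_gr_or_eq order_less_le_trans zero_less_divide_iff)
  have "real n / W \<le> real n / real V" using V W by (intro divide_left_mono) auto
  then have "vc_log n V = real V * ln (real n / real V)" using n by (simp add: vc_log_def max_def)
  also have "ln (real n / real V) = ln (real n / W) + ln (W / real V)"
    using V W n0 by (simp add: ln_div)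
  also have "real V * (ln (real n / W) + ln (W / real V)) \<le> real V * (ln (real n / W) + (W / real V - 1))"
    using V W ln_le_minus_one[of "W / real V"] by (intro mult_left_mono) auto
  also have "\<dots> = real V * ln (real n / W) + (W - real V) * 1" using V by (simp add: field_simps)
  also have "\<dots> \<le> real V * ln (real n / W) + (W - real V) * ln (real n / W)"
  proof -
    have "ln (exp 1) \<le> ln (real n / W)" using n n0 W by (subst ln_le_cancel_iff) auto
    then show ?thesis using V by (intro add_left_mono mult_left_mono) auto
  qed
  also have "\<dots> = W * ln (real n / W)" by (simp add: algebra_simps)
  finally show ?thesis .
qed

lemma pen_eq: "pen n p \<delta> E V = vc_log n V * (ln (real p) powr \<delta>) * E / real n"
  by (simp add: pen_def vc_log_def)

text \<open>On a good sample the analysis is deterministic. The condition on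
  \<open>ln (real p) powr \<delta>\<close> is the purpose of this factor in the penalty: with it,
  half the penalty of the selected model exceeds its noise remainder at level
  \<open>8 * L mh\<close>. The condition on \<open>h\<close> keeps the misclassified points below
  half of either side.\<close>

lemma two_shot_bounds:
  fixes x :: "nat \<Rightarrow> nat \<Rightarrow> real" and e y :: "nat \<Rightarrow> real" and p n :: nat
    and \<Omega> :: "(real \<times> real) set" and \<alpha>0 \<beta>0 \<alpha> \<beta> \<delta> E :: real and d0 :: "nat \<Rightarrow> real" and th :: "nat \<Rightarrow> param" and mh :: nat
  defines "P \<equiv> \<lambda>d. hs_pattern n p x d"
    and "L \<equiv> \<lambda>m. vc_log n (V_model p \<Omega> m)"
    and "dh \<equiv> snd (snd (th mh))"
    and "m0 \<equiv> l0norm p d0"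
  defines "Q0 \<equiv> L m0 * (ln (real p) powr \<delta>) * E"
  assumes ts: "two_shot n p \<Omega> \<delta> E x e y th mh (\<alpha>, \<beta>)"
    and y: "\<forall>i<n. y i = f_theta p (\<alpha>0, \<beta>0, d0) (x i) + e i"
    and n: "1 \<le> n" and ab0: "(\<alpha>0, \<beta>0) \<in> \<Omega>" and d0: "d0 \<in> usphere p"
    and g: "0 < g" "\<forall>\<alpha> \<beta>. (\<alpha>, \<beta>) \<in> \<Omega> \<longrightarrow> g \<le> \<alpha> - \<beta>"
    and D: "1 \<le> D" "\<forall>\<alpha> \<beta> \<alpha>' \<beta>'. (\<alpha>, \<beta>) \<in> \<Omega> \<longrightarrow> (\<alpha>', \<beta>') \<in> \<Omega> \<longrightarrow>
      \<bar>\<alpha> - \<alpha>'\<bar> \<le> D \<and> \<bar>\<alpha> - \<beta>'\<bar> \<le> D \<and> \<bar>\<beta> - \<beta>'\<bar> \<le> D"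
    and \<sigma>: "0 < \<sigma>" "\<sigma> \<le> E" and K: "0 < K"
    and lp: "512 * \<sigma> + 128 * D * K \<le> ln (real p) powr \<delta>"
    and good: "good_sample n p \<Omega> \<mu> d0 \<sigma> (K * E) Z h x e"
    and h: "0 < h" "48 * Q0 / g\<^sup>2 < h"
  shows "\<bar>\<alpha> - \<alpha>0\<bar> \<le> 8 * (Z + 2 * (24 * Q0 / g\<^sup>2 + Q0) + D * (24 * Q0 / g\<^sup>2)) / h"
    and "\<bar>\<beta> - \<beta>0\<bar> \<le> 8 * (Z + 2 * (24 * Q0 / g\<^sup>2 + Q0) + D * (24 * Q0 / g\<^sup>2)) / h"
    and "real n * measure \<mu> (wedge_set \<mu> p dh d0) \<le> Q0 / \<sigma>\<^sup>2 + 8 * (24 * Q0 / g\<^sup>2)"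
    and "dh \<in> usphere p"
proof -
  have noise: "\<forall>m\<in>{1..p}. \<forall>d\<in>sparse_dirs p m. \<forall>T\<in>cell_set n (P d) (P d0).
      \<bar>\<Sum>i\<in>T. e i\<bar> \<le> 2 * \<sigma> * sqrt (real (card T) * (8 * L m)) + 2 * (K * E) * (8 * L m)"
    and ghost: "\<forall>m\<in>{1..p}. \<forall>d\<in>sparse_dirs p m.
       200 * L m \<le> real n * measure \<mu> (wedge_set \<mu> p d d0) \<longrightarrow>
       real n * measure \<mu> (wedge_set \<mu> p d d0) / 8 \<le> real (card (cell10 (P d) (P d0))) + real (card (cell01 (P d) (P d0)))"
    and count: "h \<le> real (card (P d0))" "h \<le> real n - real (card (P d0))"
    and side: "\<bar>\<Sum>i\<in>P d0. e i\<bar> \<le> Z" "\<bar>\<Sum>i\<in>{..<n} - P d0. e i\<bar> \<le> Z"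
    using good unfolding good_sample_def P_def L_def by - (elim conjE, assumption)+
  define N where "N = 24 * Q0 / g\<^sup>2"
  obtain \<alpha>1 \<beta>1 where th: "th mh = (\<alpha>1, \<beta>1, dh)" unfolding dh_def by (metis prod.collapse)
  have m0: "m0 \<in> {1..p}" using l0norm_usphere[OF d0] by (simp add: m0_def)
  have fit: "th m \<in> Theta p \<Omega> m" "\<And>\<theta>. \<theta> \<in> Theta p \<Omega> m \<Longrightarrow> emp_loss n p x y (th m) \<le> emp_loss n p x y \<theta>"
    if "m \<in> {1..p}" for m
    using ts that unfolding two_shot_def is_arg_min_def by (auto simp: not_less)
  have mh: "mh \<in> {1..p}" using ts unfolding two_shot_def is_arg_min_def by blast
  have select: "(\<Sum>i<n. H_inf (y i - f_theta p (th mh) (x i)) - H_inf (e i)) / real n + pen n p \<delta> E (V_model p \<Omega> mh)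
     \<le> (\<Sum>i<n. H_inf (y i - f_theta p (th m0) (x i)) - H_inf (e i)) / real n + pen n p \<delta> E (V_model p \<Omega> m0)"
    using ts m0 unfolding two_shot_def is_arg_min_def by (auto simp: not_less)
  have ls: "(\<Sum>i<n. (y i - f_theta p (\<alpha>, \<beta>, dh) (x i))\<^sup>2) \<le> (\<Sum>i<n. (y i - f_theta p (\<alpha>0, \<beta>0, dh) (x i))\<^sup>2)"
    using ts ab0 unfolding two_shot_def is_arg_min_def dh_def by (auto simp: not_less)
  have Th: "(\<alpha>1, \<beta>1) \<in> \<Omega>" "dh \<in> sparse_dirs p mh"
    using fit(1)[OF mh] th by (auto simp: Theta_def sparse_dirs_def)
  then show "dh \<in> usphere p" by (simp add: sparse_dirs_def)
  have th0: "(\<alpha>0, \<beta>0, d0) \<in> Theta p \<Omega> m0" using ab0 d0 by (simp add: Theta_def m0_def)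
  define F where "F = (\<lambda>\<theta>. \<Sum>i<n. (y i - f_theta p \<theta> (x i))\<^sup>2)"
  have loss: "emp_loss n p x y \<theta> = F \<theta> / 2 / real n" for \<theta>
    by (simp add: emp_loss_def H_inf_def F_def sum_divide_distrib[symmetric])
  have crit: "(\<Sum>i<n. H_inf (y i - f_theta p (th m) (x i)) - H_inf (e i)) / real n = F (th m) / 2 / real n - (\<Sum>i<n. H_inf (e i)) / real n" for m
    by (simp add: H_inf_def F_def sum_subtractf sum_divide_distrib[symmetric] diff_divide_distrib)
  define Qh where "Qh = L mh * (ln (real p) powr \<delta>) * E"
  have pen: "real n * pen n p \<delta> E (V_model p \<Omega> mh) = Qh" "real n * pen n p \<delta> E (V_model p \<Omega> m0) = Q0"
    using n by (simp_all add: pen_eq Qh_def Q0_def L_def)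
  \<comment> \<open>Two comparisons are chained: the selected model with the true one, and the fit
    in the true model with the true parameter.\<close>
  have "F (th mh) / 2 / real n + pen n p \<delta> E (V_model p \<Omega> mh) \<le> F (\<alpha>0, \<beta>0, d0) / 2 / real n + pen n p \<delta> E (V_model p \<Omega> m0)"
    using select fit(2)[OF m0 th0] unfolding crit loss by linarith
  then have "real n * (F (th mh) / 2 / real n + pen n p \<delta> E (V_model p \<Omega> mh)) \<le> real n * (F (\<alpha>0, \<beta>0, d0) / 2 / real n + pen n p \<delta> E (V_model p \<Omega> m0))"
    by (intro mult_left_mono) auto
  then have FQ: "F (th mh) / 2 + Qh \<le> F (\<alpha>0, \<beta>0, d0) / 2 + Q0"
    using n by (simp add: distrib_left pen)
  define v where "v = (\<lambda>i. f_theta p (\<alpha>1, \<beta>1, dh) (x i) - f_theta p (\<alpha>0, \<beta>0, d0) (x i))"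
  have "F (th mh) = (\<Sum>i<n. (e i)\<^sup>2 - 2 * (e i * v i) + (v i)\<^sup>2)"
    unfolding F_def th by (intro sum.cong) (auto simp: y v_def power2_eq_square algebra_simps)
  moreover have "F (\<alpha>0, \<beta>0, d0) = (\<Sum>i<n. (e i)\<^sup>2)"
    unfolding F_def by (intro sum.cong) (auto simp: y)
  ultimately have "F (th mh) = F (\<alpha>0, \<beta>0, d0) - 2 * (\<Sum>i<n. e i * v i) + (\<Sum>i<n. (v i)\<^sup>2)"
    by (simp add: sum.distrib sum_subtractf sum_distrib_left)
  then have basic: "(\<Sum>i<n. (v i)\<^sup>2) / 2 - (\<Sum>i<n. e i * v i) + Qh \<le> Q0" using FQ by linarith
  have L0: "0 \<le> L mh" using vc_log_ge[of "V_model p \<Omega> mh" n] by (simp add: L_def)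
  have E0: "0 < E" using \<sigma> by linarith
  \<comment> \<open>One factor \<open>\<sigma>\<close> is exchanged for \<open>E\<close>, which
    makes both terms multiples of \<open>L mh * E\<close>; 512 and 128 are twice
    \<open>32 * 8\<close> and \<open>8 * 8\<close>.\<close>
  have small: "32 * \<sigma>\<^sup>2 * (8 * L mh) + 8 * D * (K * E) * (8 * L mh) \<le> Qh / 2"
  proof -
    have "\<sigma>\<^sup>2 \<le> \<sigma> * E" using \<sigma> by (simp add: power2_eq_square)
    then have "32 * \<sigma>\<^sup>2 * (8 * L mh) \<le> 32 * (\<sigma> * E) * (8 * L mh)" using L0 by (intro mult_right_mono) auto
    then have "32 * \<sigma>\<^sup>2 * (8 * L mh) + 8 * D * (K * E) * (8 * L mh) \<le> (512 * \<sigma> + 128 * D * K) * (L mh * E) / 2"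
      by (simp add: algebra_simps)
    also have "\<dots> \<le> (ln (real p) powr \<delta>) * (L mh * E) / 2"
      using lp L0 E0 by (intro divide_right_mono mult_right_mono) auto
    finally show ?thesis by (simp add: Qh_def algebra_simps)
  qed
  have Q0pos: "0 \<le> Q0" using E0 vc_log_ge[of "V_model p \<Omega> m0" n] by (auto simp: Q0_def L_def intro!: mult_nonneg_nonneg)
  have h24: "24 * Q0 / g\<^sup>2 < h"
  proof -
    have "24 * Q0 / g\<^sup>2 \<le> 48 * Q0 / g\<^sup>2" using Q0pos by (intro divide_right_mono) auto
    then show ?thesis using h(2) by linarith
  qed
  have Ds: "\<bar>\<alpha>1 - \<alpha>0\<bar> \<le> D" "\<bar>\<alpha>1 - \<beta>0\<bar> \<le> D" "\<bar>\<beta>1 - \<alpha>0\<bar> \<le> D" "\<bar>\<beta>1 - \<beta>0\<bar> \<le> D"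
    using D(2)[rule_format, OF Th(1) ab0] D(2)[rule_format, OF ab0 Th(1)] by (auto simp: abs_minus_commute)
  have stage1: "Qh \<le> 2 * Q0" "real (card (cell10 (P dh) (P d0))) + real (card (cell01 (P dh) (P d0))) \<le> N"
    unfolding N_def
    using first_stage[where n = n and p = p and \<alpha> = \<alpha>1 and \<beta> = \<beta>1 and d = dh and x = x and ?\<alpha>0.0 = \<alpha>0 and ?\<beta>0.0 = \<beta>0
        and ?d0.0 = d0 and e = e and Qh = Qh and ?Q0.0 = Q0 and \<sigma> = \<sigma> and t = "8 * L mh" and c = "K * E" and D = D and g = g and h = h,
        folded P_def, OF basic[unfolded v_def] bspec[OF bspec[OF bspec[OF noise mh] Th(2)]] Ds _ _ _ small g(1) g(2)[rule_format, OF Th(1)] g(2)[rule_format, OF ab0] count h24]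
      \<sigma> L0 K E0 by simp_all
  have tL: "256 * \<sigma>\<^sup>2 * L mh + 64 * D * (K * E) * L mh \<le> Q0" using small stage1(1) by (simp add: algebra_simps)
  have nn: "0 \<le> \<sigma>\<^sup>2 * L mh" "0 \<le> K * E * L mh" using L0 K E0 by auto
  have tL1: "\<sigma>\<^sup>2 * (8 * L mh) \<le> Q0 / 32"
  proof -
    have "0 \<le> D * (K * E * L mh)" using nn D by simp
    then have "256 * (\<sigma>\<^sup>2 * L mh) \<le> Q0" using tL by (simp add: mult.assoc)
    then show ?thesis by simp
  qed
  have tL2: "2 * (K * E) * (8 * L mh) \<le> Q0 / 4"
  proof -
    have "1 * (K * E * L mh) \<le> D * (K * E * L mh)" using nn D by (intro mult_right_mono) auto
    moreover have "64 * (D * (K * E * L mh)) \<le> Q0" using tL nn by (simp add: mult.assoc)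
    ultimately show ?thesis by simp
  qed
  \<comment> \<open>The number of misclassified points and the penalty are both controlled by
    \<open>Q0\<close>, so splitting the square root by \<open>2 * u * v \<le> u ^ 2 + v ^ 2\<close>
    loses only a constant.\<close>
  have cell_noise: "\<bar>\<Sum>i\<in>T. e i\<bar> \<le> N + Q0" if T: "T \<in> {cell10 (P dh) (P d0), cell01 (P dh) (P d0)}" for T
  proof -
    have cT: "real (card T) \<le> N" using T stage1(2) by auto
    have "2 * \<sigma> * sqrt (real (card T) * (8 * L mh)) = 2 * sqrt (real (card T)) * (\<sigma> * sqrt (8 * L mh))"
      by (simp add: real_sqrt_mult)
    also have "\<dots> \<le> (sqrt (real (card T)))\<^sup>2 + (\<sigma> * sqrt (8 * L mh))\<^sup>2"
      by (rule sum_squares_bound)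
    also have "\<dots> = real (card T) + \<sigma>\<^sup>2 * (8 * L mh)" using L0 by (simp add: power_mult_distrib)
    finally have "2 * \<sigma> * sqrt (real (card T) * (8 * L mh)) \<le> N + Q0 / 32" using cT tL1 by linarith
    moreover have "\<bar>\<Sum>i\<in>T. e i\<bar> \<le> 2 * \<sigma> * sqrt (real (card T) * (8 * L mh)) + 2 * (K * E) * (8 * L mh)"
      using T by (intro bspec[OF bspec[OF bspec[OF noise mh] Th(2)]]) (auto simp: cell_set_def)
    ultimately show ?thesis using tL2 Q0pos by linarith
  qed
  have ls': "(\<Sum>i<n. (f_theta p (\<alpha>0, \<beta>0, d0) (x i) + e i - f_theta p (\<alpha>, \<beta>, dh) (x i))\<^sup>2) \<le>
      (\<Sum>i<n. (f_theta p (\<alpha>0, \<beta>0, d0) (x i) + e i - f_theta p (\<alpha>0, \<beta>0, dh) (x i))\<^sup>2)"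
    using ls by (simp add: y)
  have Nh: "N \<le> h / 2" using h(2) by (simp add: N_def)
  have D0: "\<bar>\<alpha>0 - \<beta>0\<bar> \<le> D" using D(2)[rule_format, OF ab0 ab0] by simp
  have "\<bar>\<alpha> - \<alpha>0\<bar> \<le> 8 * (Z + 2 * (N + Q0) + D * N) / h \<and> \<bar>\<beta> - \<beta>0\<bar> \<le> 8 * (Z + 2 * (N + Q0) + D * N) / h"
    using second_stage[where n = n and p = p and ?\<alpha>0.0 = \<alpha>0 and ?\<beta>0.0 = \<beta>0 and ?d0.0 = d0 and x = x and e = e and \<alpha> = \<alpha> and \<beta> = \<beta>
        and d = dh and D = D and Z = Z and z = "N + Q0" and N = N and h = h, folded P_def,
        OF ls' D0 side cell_noise cell_noise stage1(2) Nh h(1) count] by simp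
  then show "\<bar>\<alpha> - \<alpha>0\<bar> \<le> 8 * (Z + 2 * (24 * Q0 / g\<^sup>2 + Q0) + D * (24 * Q0 / g\<^sup>2)) / h"
    "\<bar>\<beta> - \<beta>0\<bar> \<le> 8 * (Z + 2 * (24 * Q0 / g\<^sup>2 + Q0) + D * (24 * Q0 / g\<^sup>2)) / h"
    unfolding N_def by blast+
  show "real n * measure \<mu> (wedge_set \<mu> p dh d0) \<le> Q0 / \<sigma>\<^sup>2 + 8 * (24 * Q0 / g\<^sup>2)"
  \<comment> \<open>Below the threshold of the ghost sample bound the wedge is small anyway, since
    \<open>L mh\<close> is controlled by the penalty of the selected model and hence by
    \<open>Q0\<close>.\<close>
  proof (cases "200 * L mh \<le> real n * measure \<mu> (wedge_set \<mu> p dh d0)")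
    case True
    then have "real n * measure \<mu> (wedge_set \<mu> p dh d0) / 8 \<le> N"
      using mp[OF bspec[OF bspec[OF ghost mh] Th(2)]] stage1(2) by linarith
    moreover have "0 \<le> Q0 / \<sigma>\<^sup>2" using Q0pos by simp
    ultimately show ?thesis unfolding N_def by linarith
  next
    case False
    have "200 * L mh \<le> Q0 / \<sigma>\<^sup>2"
    proof -
      have "200 * (\<sigma>\<^sup>2 * L mh) \<le> Q0" using tL1 nn Q0pos by linarith
      then show ?thesis using \<sigma>(1) by (simp add: field_simps)
    qed
    moreover have "0 \<le> 8 * (24 * Q0 / g\<^sup>2)" using Q0pos by simp
    ultimately show ?thesis using False by linarith
  qed
qed

section \<open>Boundedness in probability and the conclusion\<close>

text \<open>With this form one exceptional set can serve all three variables, and no exceedance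
  event has to be estimated directly.\<close>

lemma Op1I:
  assumes meas: "\<forall>\<^sub>F n in sequentially. Z n \<in> borel_measurable (M n)"
    and bad: "\<And>\<epsilon>. 0 < \<epsilon> \<Longrightarrow> \<exists>K. \<forall>\<^sub>F n in sequentially. finite_measure (M n) \<and>
      (\<exists>B\<in>sets (M n). measure (M n) B \<le> \<epsilon> \<and> (\<forall>\<omega>\<in>space (M n) - B. \<bar>Z n \<omega>\<bar> \<le> K))"
  shows "Op1 M Z"
  unfolding Op1_def
proof (intro conjI allI impI meas)
  fix \<epsilon> :: real assume "0 < \<epsilon>"
  then obtain K where K: "\<forall>\<^sub>F n in sequentially. finite_measure (M n) \<and>
      (\<exists>B\<in>sets (M n). measure (M n) B \<le> \<epsilon> \<and> (\<forall>\<omega>\<in>space (M n) - B. \<bar>Z n \<omega>\<bar> \<le> K))"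
    using bad by blast
  have "\<forall>\<^sub>F n in sequentially. measure (M n) {\<omega> \<in> space (M n). \<bar>Z n \<omega>\<bar> > K} \<le> \<epsilon>"
    using K
  proof eventually_elim
    case (elim n)
    then obtain B where B: "B \<in> sets (M n)" "measure (M n) B \<le> \<epsilon>" "\<forall>\<omega>\<in>space (M n) - B. \<bar>Z n \<omega>\<bar> \<le> K" by blast
    have "{\<omega> \<in> space (M n). \<bar>Z n \<omega>\<bar> > K} \<subseteq> B" using B(3) by (auto simp: not_le[symmetric])
    then have "measure (M n) {\<omega> \<in> space (M n). \<bar>Z n \<omega>\<bar> > K} \<le> measure (M n) B"
      using elim B(1) finite_measure.finite_measure_mono by blast
    then show ?case using B(2) by linarith
  qed
  then show "\<exists>K. \<forall>\<^sub>F n in sequentially. measure (M n) {\<omega> \<in> space (M n). \<bar>Z n \<omega>\<bar> > K} \<le> \<epsilon>" by blast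
qed

theorem theorem3p14:
  fixes M :: "nat \<Rightarrow> 'a measure"
    and p s :: "nat \<Rightarrow> nat"
    and \<mu> :: "nat \<Rightarrow> (nat \<Rightarrow> real) measure"
    and \<nu> :: "real measure"
    and X :: "nat \<Rightarrow> nat \<Rightarrow> 'a \<Rightarrow> nat \<Rightarrow> real"
    and \<xi> Y :: "nat \<Rightarrow> nat \<Rightarrow> 'a \<Rightarrow> real"
    and \<Omega> :: "(real \<times> real) set"
    and \<alpha>0 \<beta>0 \<delta> c C1 C2 \<eta> :: real
    and d0 :: "nat \<Rightarrow> nat \<Rightarrow> real"
    and th :: "nat \<Rightarrow> nat \<Rightarrow> 'a \<Rightarrow> param"
    and mh :: "nat \<Rightarrow> 'a \<Rightarrow> nat"
    and ah bh :: "nat \<Rightarrow> 'a \<Rightarrow> real"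
    and dh :: "nat \<Rightarrow> 'a \<Rightarrow> nat \<Rightarrow> real"
    and E r :: "nat \<Rightarrow> real"
  defines "E \<equiv> \<lambda>n. envelope2 (M n) n (\<xi> n)"
    and "r \<equiv> \<lambda>n. rate n (p n) (s n) \<delta> (E n)"
    and "dh \<equiv> \<lambda>n \<omega>. snd (snd (th n (mh n \<omega>) \<omega>))"
  assumes p_large: "(\<lambda>n. real n) \<in> o(\<lambda>n. real (p n))"
    and delta: "\<delta> > 0"
    \<comment> \<open>the model\<close>
    and law_X: "\<And>n. n \<ge> 1 \<Longrightarrow> prob_space (\<mu> n) \<and> sets (\<mu> n) = sets (Rn (p n))"
    and law_xi: "prob_space \<nu>" "sets \<nu> = sets borel"
    and xi_symmetric: "distr \<nu> borel uminus = \<nu>"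
    and xi_second_moment: "integrable \<nu> (\<lambda>x. x\<^sup>2)"
    and sample: "\<And>n. n \<ge> 1 \<Longrightarrow> iid_sample (M n) n (p n) (\<mu> n) \<nu> (X n) (\<xi> n)"
    and response: "\<And>n i \<omega>. n \<ge> 1 \<Longrightarrow> i < n \<Longrightarrow> \<omega> \<in> space (M n) \<Longrightarrow>
        Y n i \<omega> = f_theta (p n) (\<alpha>0, \<beta>0, d0 n) (X n i \<omega>) + \<xi> n i \<omega>"
    \<comment> \<open>(A)\<close>
    and Omega: "compact \<Omega>" "\<And>\<alpha> \<beta>. (\<alpha>, \<beta>) \<in> \<Omega> \<Longrightarrow> \<alpha> > \<beta>"
    and theta0: "(\<alpha>0, \<beta>0) \<in> \<Omega>" "\<And>n. n \<ge> 1 \<Longrightarrow> d0 n \<in> usphere (p n)"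
    \<comment> \<open>(B)\<close>
    and constants: "c > 0" "C1 > 0" "C2 > 0" "\<eta> > 0"
    and wedge: "\<And>n. n \<ge> 1 \<Longrightarrow> wedge_condition c C1 C2 \<eta> (p n) (\<mu> n) (d0 n)"
    \<comment> \<open>(C)\<close>
    and sparsity: "\<And>n. n \<ge> 1 \<Longrightarrow> l0norm (p n) (d0 n) \<le> s n"
    and sparsity_rate:
      "(\<lambda>n. real (s n) * (ln (real (p n))) powr (1 + \<delta>) * E n / real n) \<longlonglongrightarrow> 0"
    \<comment> \<open>the estimator\<close>
    and th_measurable: "\<And>n m. n \<ge> 1 \<Longrightarrow> m \<in> {1..p n} \<Longrightarrow>
        th n m \<in> M n \<rightarrow>\<^sub>M borel \<Otimes>\<^sub>M (borel \<Otimes>\<^sub>M Rn (p n))"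
    and mh_measurable: "\<And>n. n \<ge> 1 \<Longrightarrow> mh n \<in> M n \<rightarrow>\<^sub>M count_space UNIV"
    and abh_measurable: "\<And>n. n \<ge> 1 \<Longrightarrow> ah n \<in> borel_measurable (M n)"
      "\<And>n. n \<ge> 1 \<Longrightarrow> bh n \<in> borel_measurable (M n)"
    and estimator: "\<And>n \<omega>. n \<ge> 1 \<Longrightarrow> \<omega> \<in> space (M n) \<Longrightarrow>
        two_shot n (p n) \<Omega> \<delta> (E n) (\<lambda>i. X n i \<omega>) (\<lambda>i. \<xi> n i \<omega>) (\<lambda>i. Y n i \<omega>)
          (\<lambda>m. th n m \<omega>) (mh n \<omega>) (ah n \<omega>, bh n \<omega>)"
  shows "Op1 M (\<lambda>n \<omega>. min (sqrt (real n)) (r n) * (ah n \<omega> - \<alpha>0)) \<and>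
    Op1 M (\<lambda>n \<omega>. min (sqrt (real n)) (r n) * (bh n \<omega> - \<beta>0)) \<and>
    Op1 M (\<lambda>n \<omega>. r n * dist2 (p n) (dh n \<omega>) (d0 n))"
proof -
  have ne: "\<Omega> \<noteq> {}" using theta0(1) by blast
  \<comment> \<open>Compactness makes the strict inequality between the levels uniform.\<close>
  obtain g where gap: "0 < g" "\<And>\<alpha> \<beta>. (\<alpha>, \<beta>) \<in> \<Omega> \<Longrightarrow> g \<le> \<alpha> - \<beta>"
  proof -
    have "continuous_on \<Omega> (\<lambda>z. fst z - snd z)" by (intro continuous_intros)
    then obtain z where z: "z \<in> \<Omega>" "\<And>w. w \<in> \<Omega> \<Longrightarrow> fst z - snd z \<le> fst w - snd w"
      using continuous_attains_inf[OF Omega(1) ne] by blast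
    have "0 < fst z - snd z" using Omega(2)[of "fst z" "snd z"] z(1) by simp
    then show thesis
    proof (rule that)
      fix \<alpha> \<beta> assume "(\<alpha>, \<beta>) \<in> \<Omega>"
      from z(2)[OF this] show "fst z - snd z \<le> \<alpha> - \<beta>" by simp
    qed
  qed
  obtain D where D: "1 \<le> D" "\<And>\<alpha> \<beta> \<alpha>' \<beta>'. (\<alpha>, \<beta>) \<in> \<Omega> \<Longrightarrow> (\<alpha>', \<beta>') \<in> \<Omega> \<Longrightarrow>
      \<bar>\<alpha> - \<alpha>'\<bar> \<le> D \<and> \<bar>\<alpha> - \<beta>'\<bar> \<le> D \<and> \<bar>\<beta> - \<beta>'\<bar> \<le> D"
  proof -
    obtain b where b: "\<And>z. z \<in> \<Omega> \<Longrightarrow> norm z \<le> b"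
      using compact_imp_bounded[OF Omega(1)] unfolding bounded_iff by blast
    have ab: "\<bar>\<alpha>\<bar> \<le> b \<and> \<bar>\<beta>\<bar> \<le> b" if "(\<alpha>, \<beta>) \<in> \<Omega>" for \<alpha> \<beta>
      using b[OF that] norm_fst_le[of \<alpha> \<beta>] norm_snd_le[of \<beta> \<alpha>] by simp
    show thesis
    proof (rule that)
      show "1 \<le> 2 * b + 1" using ab[OF theta0(1)] by linarith
      fix \<alpha> \<beta> \<alpha>' \<beta>' assume "(\<alpha>, \<beta>) \<in> \<Omega>" "(\<alpha>', \<beta>') \<in> \<Omega>"
      from ab[OF this(1)] ab[OF this(2)]
      show "\<bar>\<alpha> - \<alpha>'\<bar> \<le> 2 * b + 1 \<and> \<bar>\<alpha> - \<beta>'\<bar> \<le> 2 * b + 1 \<and> \<bar>\<beta> - \<beta>'\<bar> \<le> 2 * b + 1" by linarith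
    qed
  qed
  define sig where "sig = sqrt (\<integral>x. x\<^sup>2 \<partial>\<nu>)"
  have sig: "0 \<le> sig" "sig\<^sup>2 = (\<integral>x. x\<^sup>2 \<partial>\<nu>)" by (simp_all add: sig_def)
  have model: "iid_model (M n) n (p n) (\<mu> n) \<nu> (X n) (\<xi> n)" if "1 \<le> n" for n
    using sample[OF that] law_X[OF that] law_xi that
    by (intro iid_model.intro iid_model_axioms.intro) (auto simp: iid_sample_def)
  have E_bounds: "sig \<le> E n" "E n \<le> sig * sqrt (real n)" if "1 \<le> n" for n
    unfolding E_def using iid_model.envelope2_bounds[OF model[OF that] xi_second_moment sig] by auto
  have mh_range: "mh n \<omega> \<in> {1..p n}" "snd (snd (th n (mh n \<omega>) \<omega>)) \<in> usphere (p n)" "(ah n \<omega>, bh n \<omega>) \<in> \<Omega>"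
    if "1 \<le> n" "\<omega> \<in> space (M n)" for n \<omega>
  proof -
    note ts = estimator[OF that]
    show m: "mh n \<omega> \<in> {1..p n}" using ts unfolding two_shot_def is_arg_min_def by blast
    then have "th n (mh n \<omega>) \<omega> \<in> Theta (p n) \<Omega> (mh n \<omega>)" using ts unfolding two_shot_def is_arg_min_def by blast
    then show "snd (snd (th n (mh n \<omega>) \<omega>)) \<in> usphere (p n)" by (auto simp: Theta_def)
    show "(ah n \<omega>, bh n \<omega>) \<in> \<Omega>" using ts unfolding two_shot_def is_arg_min_def by blast
  qed
  have dist_meas: "(\<lambda>\<omega>. dist2 (p n) (dh n \<omega>) (d0 n)) \<in> borel_measurable (M n)" if n: "1 \<le> n" for n
  proof -
    have mh_meas: "mh n \<in> M n \<rightarrow>\<^sub>M count_space {1..p n}"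
      unfolding measurable_count_space_eq_countable[OF countable_finite[OF finite_atLeastAtMost]]
    proof (intro conjI ballI)
      show "mh n \<in> space (M n) \<rightarrow> {1..p n}" by (rule Pi_I) (rule mh_range(1)[OF n])
      show "mh n -` {k} \<inter> space (M n) \<in> sets (M n)" for k by (rule measurable_sets[OF mh_measurable[OF n]]) simp
    qed
    have "(\<lambda>\<omega>. th n (mh n \<omega>) \<omega>) \<in> M n \<rightarrow>\<^sub>M borel \<Otimes>\<^sub>M (borel \<Otimes>\<^sub>M Rn (p n))"
      by (rule measurable_compose_countable'[where f = "th n" and g = "mh n" and I = "{1..p n}", OF _ mh_meas])
        (simp_all only: th_measurable[OF n] countable_finite[OF finite_atLeastAtMost])
    then have "dh n \<in> M n \<rightarrow>\<^sub>M Rn (p n)" unfolding dh_def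
      by (intro measurable_compose[OF measurable_compose[OF _ measurable_snd] measurable_snd])
    moreover have "(\<lambda>d. dist2 (p n) d (d0 n)) \<in> borel_measurable (Rn (p n))"
      unfolding dist2_def L2_set_def Rn_def by measurable
    ultimately show ?thesis by (rule measurable_compose)
  qed
  define a where "a = min C1 C2"
  have a: "0 < a" using constants by (simp add: a_def)
  define c' where "c' = min c (min (c * \<eta> / 2) (C1 / 2))"
  have c': "0 < c'" using constants by (simp add: c'_def)
  have main: "\<exists>K. \<forall>\<^sub>F n in sequentially. finite_measure (M n) \<and>
      (\<exists>B\<in>sets (M n). measure (M n) B \<le> \<epsilon> \<and> (\<forall>\<omega>\<in>space (M n) - B.
        \<bar>min (sqrt (real n)) (r n) * (ah n \<omega> - \<alpha>0)\<bar> \<le> K \<and> \<bar>min (sqrt (real n)) (r n) * (bh n \<omega> - \<beta>0)\<bar> \<le> K \<and>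
        \<bar>r n * dist2 (p n) (dh n \<omega>) (d0 n)\<bar> \<le> K))" (is "\<exists>K. ?P K")
    if \<epsilon>: "0 < \<epsilon>" for \<epsilon> :: real
  proof (cases "sig = 0")
    case True
    have "\<forall>\<^sub>F n in sequentially. (1::nat) \<le> n" by (rule eventually_ge_at_top)
    then have "?P 0"
    proof eventually_elim
      case (elim n)
      \<comment> \<open>division by zero makes the rate vanish if there is no noise\<close>
      have "E n = 0" using E_bounds[OF elim] True by simp
      then have "r n = 0" by (simp add: r_def rate_def)
      moreover have "finite_measure (M n)"
        using model[OF elim] by (simp add: iid_model_def prob_space.finite_measure)
      ultimately show ?case using \<epsilon> by (intro conjI bexI[of _ "{}"]) auto
    qed
    then show ?thesis ..
  next
    case False
    then have sig0: "0 < sig" using sig(1) by simp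
    \<comment> \<open>\<open>K\<close> and \<open>y\<close> leave a quarter of
      \<open>\<epsilon>\<close> to each of the first two failure terms of \<open>good_event\<close>;
      the other two fall below a quarter for large \<open>n\<close>.\<close>
    define K where "K = 2 / sqrt \<epsilon>"
    define y where "y = max 1 (ln (16 / \<epsilon>))"
    \<comment> \<open>\<open>3840 = 48 * 40 * 2\<close>: for \<open>r n > R\<close> the bound
      \<open>Q0 \<le> 40 * real n / r n\<close> gives
      \<open>48 * Q0 / g\<^sup>2 < real n * a / 2\<close>, as the two stages require.\<close>
    define R where "R = 3840 / (g\<^sup>2 * a)"
    define Z0 where "Z0 = 2 * sig * sqrt y + 2 * K * sig * y"
    define C3 where "C3 = 2 * (960 / g\<^sup>2 + 40) + D * (960 / g\<^sup>2)"
    define C4 where "C4 = 40 / sig\<^sup>2 + 7680 / g\<^sup>2"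
    define K' where "K' = R * D + 2 * R + 16 / a * (Z0 + C3) + C4 / c'"
    have K: "0 < K" "1 / K\<^sup>2 = \<epsilon> / 4" using \<epsilon> by (auto simp: K_def power_divide)
    have y: "0 < y" "4 * exp (- y) \<le> \<epsilon> / 4"
    proof -
      show "0 < y" by (simp add: y_def)
      have "exp (- y) \<le> exp (- ln (16 / \<epsilon>))" by (simp add: y_def)
      also have "\<dots> = \<epsilon> / 16" using \<epsilon> by (simp add: exp_minus)
      finally show "4 * exp (- y) \<le> \<epsilon> / 4" by simp
    qed
    have R: "0 < R" using gap(1) a by (simp add: R_def)
    have nn: "0 \<le> Z0" "0 \<le> C3" "0 \<le> C4" using sig0 K y D(1) by (auto simp: Z0_def C3_def C4_def)
    have K'1: "R * D \<le> K'" "2 * R \<le> K'" "16 / a * (Z0 + C3) \<le> K'" "C4 / c' \<le> K'"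
      using nn R D(1) a c' by (auto simp: K'_def intro!: add_nonneg_nonneg add_increasing add_increasing2)
    have ev_n: "\<forall>\<^sub>F n in sequentially. c \<le> real n" for c
      using filterlim_real_sequentially unfolding filterlim_at_top by blast
    have ev_p: "\<forall>\<^sub>F n in sequentially. real n \<le> real (p n)"
      using landau_o.smallD[OF p_large, of 1] by simp
    have ev_ln: "\<forall>\<^sub>F n in sequentially. c \<le> ln (real n)" for c
      using filterlim_compose[OF ln_at_top filterlim_real_sequentially] unfolding filterlim_at_top by blast
    define c5 where "c5 = 512 * sig + 128 * D * K"
    have c5: "0 < c5" using sig0 D(1) K by (auto simp: c5_def intro!: add_pos_pos)
    \<comment> \<open>The threshold ensures that \<open>n\<close> is at least
      \<open>40 * exp 1\<close> times \<open>s * ln p\<close>, so that \<open>vc_log_le\<close>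
      applies to the bound \<open>40 * s * ln p\<close> of the VC dimension.\<close>
    have ev_s: "\<forall>\<^sub>F n in sequentially. real (s n) * (ln (real (p n))) powr (1 + \<delta>) * E n / real n < sig / (40 * exp 1)"
      using sparsity_rate sig0 by (intro order_tendstoD(2)[OF sparsity_rate]) auto
    have "?P K'"
      using ev_n[of 3] ev_p ev_ln[of "max 1 (c5 powr (1 / \<delta>))"] ev_s ev_n[of "160 / \<epsilon>"] ev_n[of "8 * ln (8 / \<epsilon>) / a"]
    proof eventually_elim
      case (elim n)
      have n: "1 \<le> n" and n3: "3 \<le> n" using elim(1) by auto
      interpret iid_model "M n" n "p n" "\<mu> n" \<nu> "X n" "\<xi> n" by (rule model[OF n])
      have p3: "3 \<le> p n" using elim(1,2) by linarith
      define lp where "lp = ln (real (p n)) powr \<delta>"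
      have lnp: "ln (real n) \<le> ln (real (p n))" using elim(2) n by simp
      have lnp1: "1 \<le> ln (real (p n))" using elim(3) lnp by simp
      have lp: "c5 \<le> lp"
      proof -
        have "c5 = (c5 powr (1 / \<delta>)) powr \<delta>" using c5 delta by (simp add: powr_powr)
        also have "\<dots> \<le> lp" unfolding lp_def
          using elim(3) lnp delta by (intro powr_mono2) auto
        finally show ?thesis .
      qed
      have lppos: "0 < lp" using c5 lp by linarith
      have lp1: "ln (real (p n)) powr (1 + \<delta>) = ln (real (p n)) * lp"
        using lnp1 by (simp add: powr_add lp_def)
      have E0: "sig \<le> E n" "E n \<le> sig * sqrt (real n)" using E_bounds[OF n] by auto
      have Epos: "0 < E n" using E0 sig0 by linarith
      note d0S = theta0(2)[OF n]
      have m0: "1 \<le> l0norm (p n) (d0 n)" "l0norm (p n) (d0 n) \<le> p n" using l0norm_usphere[OF d0S] by auto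
      have s1: "1 \<le> s n" using m0 sparsity[OF n] by linarith
      define S where "S = real (s n) * ln (real (p n))"
      have S0: "0 < S" using s1 lnp1 by (simp add: S_def)
      \<comment> \<open>Condition (C) is weakened twice, by \<open>sig \<le> E n\<close> and by
        dropping the power \<open>\<delta>\<close> of a logarithm that is at least 1.\<close>
      have ratio: "40 * exp 1 * S \<le> real n"
      proof -
        have "ln (real (p n)) powr 1 \<le> ln (real (p n)) powr (1 + \<delta>)"
          using lnp1 delta by (intro powr_mono) auto
        then have "real (s n) * ln (real (p n)) * sig \<le> real (s n) * ln (real (p n)) powr (1 + \<delta>) * E n"
          using lnp1 E0 sig0 by (intro mult_mono) auto
        also have "\<dots> < sig / (40 * exp 1) * real n" using elim(4) n by (simp add: field_simps)
        finally have "sig * (40 * exp 1 * S) < sig * real n" by (simp add: S_def field_simps)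
        then show ?thesis using sig0 by simp
      qed
      define \<rho> where "\<rho> = real n / S"
      have rho: "40 * exp 1 \<le> \<rho>" using ratio S0 by (simp add: \<rho>_def field_simps)
      have lnrho: "1 \<le> ln \<rho>"
      proof -
        have "exp 1 \<le> \<rho>" using rho exp_gt_zero[of "1::real"] by linarith
        moreover from this have "0 < \<rho>" using exp_gt_zero[of "1::real"] by linarith
        ultimately show ?thesis by (subst ln_ge_iff) auto
      qed
      have r_eq: "r n = real n / (S * lp * E n * ln \<rho>)"
        unfolding r_def rate_def lp1 by (simp add: S_def \<rho>_def divide_inverse mult.assoc)
      have rpos: "0 < r n" unfolding r_eq using n S0 lppos Epos lnrho by (intro divide_pos_pos mult_pos_pos) auto
      define Q0 where "Q0 = vc_log n (V_model (p n) \<Omega> (l0norm (p n) (d0 n))) * lp * E n"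
      have ab0: "\<beta>0 < \<alpha>0" using Omega(2)[OF theta0(1)] .
      have Q0: "Q0 \<le> 40 * real n / r n"
      proof -
        have "Theta (p n) \<Omega> (l0norm (p n) (d0 n)) \<noteq> {}" using theta0(1) d0S by (auto simp: Theta_def)
        then have "real (V_model (p n) \<Omega> (l0norm (p n) (d0 n))) \<le> 40 * real (l0norm (p n) (d0 n)) * ln (real (p n))"
          using m0 p3 by (intro V_model_le) auto
        also have "\<dots> \<le> 40 * S" using sparsity[OF n] lnp1 by (simp add: S_def)
        finally have V: "real (V_model (p n) \<Omega> (l0norm (p n) (d0 n))) \<le> 40 * S" .
        have "exp 1 \<le> real n / (40 * S)" using ratio S0 by (simp add: field_simps)
        then have "vc_log n (V_model (p n) \<Omega> (l0norm (p n) (d0 n))) \<le> 40 * S * ln (real n / (40 * S))"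
          using le_exp_V_model(1)[OF theta0(1) ab0 m0 p3] V by (intro vc_log_le)
        also have "\<dots> \<le> 40 * S * ln \<rho>"
        proof -
          have "real n / (40 * S) \<le> \<rho>" using S0 by (simp add: \<rho>_def field_simps)
          then show ?thesis using S0 n by (intro mult_left_mono ln_mono) auto
        qed
        finally have "Q0 \<le> 40 * S * ln \<rho> * lp * E n"
          unfolding Q0_def using lppos Epos by (intro mult_right_mono) auto
        also have "\<dots> = 40 * real n / r n" unfolding r_eq using n by (simp add: mult_ac)
        finally show ?thesis .
      qed
      have fin: "finite_measure (M n)" by (rule finite_measure_axioms)
      have dist: "0 \<le> dist2 (p n) (dh n \<omega>) (d0 n)" "dist2 (p n) (dh n \<omega>) (d0 n) \<le> 2" if "\<omega> \<in> space (M n)" for \<omega>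
        using dist2_usphere_le[OF mh_range(2)[OF n that] d0S] by (simp_all add: dh_def dist2_def L2_set_nonneg)
      have mnn: "0 \<le> min (sqrt (real n)) (r n)" using rpos by simp
      show ?case
      \<comment> \<open>The distinction is made for each \<open>n\<close> separately, so
        \<open>r n\<close> need not converge. In the first case the parameter sets are bounded and
        no outcome is excluded.\<close>
      proof (cases "r n \<le> R")
        case True
        have small: "\<bar>min (sqrt (real n)) (r n) * v\<bar> \<le> K'" if "\<bar>v\<bar> \<le> D" for v
        proof -
          have "\<bar>min (sqrt (real n)) (r n) * v\<bar> \<le> R * D"
            unfolding abs_mult using that mnn True R by (intro mult_mono) auto
          then show ?thesis using K'1(1) by linarith
        qed
        have "\<bar>min (sqrt (real n)) (r n) * (ah n \<omega> - \<alpha>0)\<bar> \<le> K' \<and> \<bar>min (sqrt (real n)) (r n) * (bh n \<omega> - \<beta>0)\<bar> \<le> K' \<and>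
          \<bar>r n * dist2 (p n) (dh n \<omega>) (d0 n)\<bar> \<le> K'" if w: "\<omega> \<in> space (M n)" for \<omega>
        proof (intro conjI)
          show "\<bar>min (sqrt (real n)) (r n) * (ah n \<omega> - \<alpha>0)\<bar> \<le> K'" "\<bar>min (sqrt (real n)) (r n) * (bh n \<omega> - \<beta>0)\<bar> \<le> K'"
            using D(2)[OF mh_range(3)[OF n w] theta0(1)] by (auto intro: small)
          have "r n * dist2 (p n) (dh n \<omega>) (d0 n) \<le> R * 2" using True dist[OF w] R by (intro mult_mono) auto
          then show "\<bar>r n * dist2 (p n) (dh n \<omega>) (d0 n)\<bar> \<le> K'" using K'1(2) rpos dist[OF w] by (simp add: abs_mult)
        qed
        then show ?thesis using fin \<epsilon> by (intro conjI bexI[of _ "{}"]) auto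
      next
        case False
        then have rR: "R < r n" by simp
        \<comment> \<open>The wedge condition at \<open>d = d0\<close> bounds the masses of the two
          sides of \<open>d0\<close> from below.\<close>
        have spd: "dist2 (p n) (d0 n) (d0 n) \<le> \<eta>" using constants by (simp add: dist2_def L2_set_def)
        have sides: "a \<le> measure (\<mu> n) {x \<in> space (\<mu> n). dot (p n) x (d0 n) \<le> 0}"
          "a \<le> measure (\<mu> n) {x \<in> space (\<mu> n). 0 < dot (p n) x (d0 n)}"
          using wedge[OF n] d0S spd unfolding wedge_condition_def a_def by (force simp: min_le_iff_disj)+
        obtain B where B: "B \<in> events"
          "prob B \<le> 1 / K\<^sup>2 + 4 * exp (- y) + 2 * exp (- real n * a / 8) + 40 / real (p n)"
          "\<forall>\<omega>\<in>space (M n) - B. good_sample n (p n) \<Omega> (\<mu> n) (d0 n) sig (K * envelope2 (M n) n (\<xi> n))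
            (2 * sig * sqrt (real n * y) + 2 * (K * envelope2 (M n) n (\<xi> n)) * y) (real n * a / 2) (\<lambda>i. X n i \<omega>) (\<lambda>i. \<xi> n i \<omega>)"
          using good_event[OF xi_symmetric xi_second_moment sig0 sig(2) theta0(1) ab0 p3 K(1) y(1) sides less_imp_le[OF a]]
          by (elim bexE conjE)
        have env: "envelope2 (M n) n (\<xi> n) = E n" by (simp add: E_def)
        note B = B[unfolded env]
        have pB: "prob B \<le> \<epsilon>"
        proof -
          have "ln (8 / \<epsilon>) \<le> real n * a / 8" using elim(6) a by (simp add: field_simps)
          then have "exp (- real n * a / 8) \<le> exp (- ln (8 / \<epsilon>))" by simp
          also have "\<dots> = \<epsilon> / 8" using \<epsilon> by (simp add: exp_minus)
          finally have "2 * exp (- real n * a / 8) \<le> \<epsilon> / 4" by simp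
          moreover have "40 / real (p n) \<le> \<epsilon> / 4"
          proof -
            have "160 / \<epsilon> \<le> real (p n)" using elim(2,5) by linarith
            then show ?thesis using \<epsilon> p3 by (simp add: field_simps)
          qed
          ultimately show ?thesis using B(2) K(2) y(2) by linarith
        qed
        define h where "h = real n * a / 2"
        have h0: "0 < h" using n a by (simp add: h_def)
        have hQ: "48 * Q0 / g\<^sup>2 < h"
        proof -
          have "3840 < r n * (g\<^sup>2 * a)" using rR gap(1) a by (simp add: R_def field_simps)
          then have "3840 * real n < r n * (g\<^sup>2 * a) * real n" using n by (intro mult_strict_right_mono) auto
          then have "48 * (40 * real n / r n) / g\<^sup>2 < h" using rpos gap(1) by (simp add: h_def field_simps)
          moreover have "48 * Q0 / g\<^sup>2 \<le> 48 * (40 * real n / r n) / g\<^sup>2"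
            using Q0 gap(1) by (intro divide_right_mono mult_left_mono) auto
          ultimately show ?thesis by linarith
        qed
        define Z where "Z = 2 * sig * sqrt (real n * y) + 2 * (K * E n) * y"
        \<comment> \<open>The envelope norm is at most \<open>sig * sqrt n\<close>, so the
          truncation part is also of order \<open>sqrt n\<close>; this term is responsible for the
          parametric rate.\<close>
        have Zle: "Z \<le> sqrt (real n) * Z0"
        proof -
          have "2 * (K * E n) * y \<le> 2 * (K * (sig * sqrt (real n))) * y"
            using E0(2) K(1) y(1) by (intro mult_right_mono mult_left_mono) auto
          then show ?thesis by (simp add: Z_def Z0_def real_sqrt_mult algebra_simps)
        qed
        have rem: "2 * (24 * Q0 / g\<^sup>2 + Q0) + D * (24 * Q0 / g\<^sup>2) \<le> C3 * (real n / r n)"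
        proof -
          have "2 * (24 * Q0 / g\<^sup>2 + Q0) + D * (24 * Q0 / g\<^sup>2) = (2 * (24 / g\<^sup>2 + 1) + D * (24 / g\<^sup>2)) * Q0"
            by (simp add: algebra_simps)
          also have "\<dots> \<le> (2 * (24 / g\<^sup>2 + 1) + D * (24 / g\<^sup>2)) * (40 * real n / r n)"
            using D(1) by (intro mult_left_mono Q0) auto
          also have "\<dots> = C3 * (real n / r n)" by (simp add: C3_def algebra_simps)
          finally show ?thesis .
        qed
        \<comment> \<open>The minimum is replaced by \<open>sqrt n\<close> against the noise term
          and by \<open>r n\<close> against the misclassification term.\<close>
        have final: "min (sqrt (real n)) (r n) * (8 * (Z + 2 * (24 * Q0 / g\<^sup>2 + Q0) + D * (24 * Q0 / g\<^sup>2)) / h) \<le> K'"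
        proof -
          let ?m = "min (sqrt (real n)) (r n)"
          have "?m * (8 * (Z + 2 * (24 * Q0 / g\<^sup>2 + Q0) + D * (24 * Q0 / g\<^sup>2)) / h) \<le> ?m * (8 * (sqrt (real n) * Z0 + C3 * (real n / r n)) / h)"
            using Zle rem h0 mnn by (intro mult_left_mono divide_right_mono) auto
          also have "\<dots> = 16 / a * (?m * sqrt (real n) / real n * Z0 + ?m / r n * C3)"
            using n a rpos by (simp add: h_def field_simps)
          also have "\<dots> \<le> 16 / a * (1 * Z0 + 1 * C3)"
          proof -
            have "?m * sqrt (real n) \<le> sqrt (real n) * sqrt (real n)" by (intro mult_right_mono) auto
            then have "?m * sqrt (real n) / real n \<le> 1" using n by (simp add: field_simps)
            moreover have "?m / r n \<le> 1" using rpos by simp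
            ultimately show ?thesis using a nn by (intro mult_left_mono add_mono mult_right_mono) auto
          qed
          finally show ?thesis using K'1(3) by simp
        qed
        have good: "\<bar>min (sqrt (real n)) (r n) * (ah n \<omega> - \<alpha>0)\<bar> \<le> K' \<and> \<bar>min (sqrt (real n)) (r n) * (bh n \<omega> - \<beta>0)\<bar> \<le> K' \<and>
          \<bar>r n * dist2 (p n) (dh n \<omega>) (d0 n)\<bar> \<le> K'" if w: "\<omega> \<in> space (M n) - B" for \<omega>
        proof -
          have ws: "\<omega> \<in> space (M n)" using w by blast
          have resp: "\<forall>i<n. Y n i \<omega> = f_theta (p n) (\<alpha>0, \<beta>0, d0 n) (X n i \<omega>) + \<xi> n i \<omega>"
            using response[OF n _ ws] by blast
          have gap': "\<forall>\<alpha> \<beta>. (\<alpha>, \<beta>) \<in> \<Omega> \<longrightarrow> g \<le> \<alpha> - \<beta>" using gap(2) by blast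
          have D': "\<forall>\<alpha> \<beta> \<alpha>' \<beta>'. (\<alpha>, \<beta>) \<in> \<Omega> \<longrightarrow> (\<alpha>', \<beta>') \<in> \<Omega> \<longrightarrow>
              \<bar>\<alpha> - \<alpha>'\<bar> \<le> D \<and> \<bar>\<alpha> - \<beta>'\<bar> \<le> D \<and> \<bar>\<beta> - \<beta>'\<bar> \<le> D"
            by (intro allI impI, rule D(2))
          note tsb = two_shot_bounds[OF estimator[OF n ws] resp n theta0(1) d0S gap(1) gap' D(1) D' sig0 E0(1) K(1)
              lp[unfolded c5_def lp_def] bspec[OF B(3) w, folded h_def Z_def] h0 hQ[unfolded Q0_def lp_def],
              folded lp_def, folded Q0_def]
          have scale: "\<bar>min (sqrt (real n)) (r n) * v\<bar> \<le> K'"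
            if "\<bar>v\<bar> \<le> 8 * (Z + 2 * (24 * Q0 / g\<^sup>2 + Q0) + D * (24 * Q0 / g\<^sup>2)) / h" for v
            using mult_left_mono[OF that mnn] final mnn by (simp add: abs_mult)
          \<comment> \<open>No prior consistency of the direction is required, because the wedge
            condition has been made global.\<close>
          have "c' * dist2 (p n) (dh n \<omega>) (d0 n) \<le> measure (\<mu> n) (wedge_set (\<mu> n) (p n) (dh n \<omega>) (d0 n))"
            unfolding c'_def dh_def using law_X[OF n] d0S tsb(4) constants
            by (intro wedge_condition_global[OF wedge[OF n]]) auto
          then have "real n * (c' * dist2 (p n) (dh n \<omega>) (d0 n)) \<le> real n * measure (\<mu> n) (wedge_set (\<mu> n) (p n) (dh n \<omega>) (d0 n))"
            by (intro mult_left_mono) auto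
          also have "\<dots> \<le> Q0 / sig\<^sup>2 + 8 * (24 * Q0 / g\<^sup>2)" unfolding dh_def by (rule tsb(3))
          also have "\<dots> = (1 / sig\<^sup>2 + 192 / g\<^sup>2) * Q0" by (simp add: algebra_simps)
          also have "\<dots> \<le> (1 / sig\<^sup>2 + 192 / g\<^sup>2) * (40 * real n / r n)" by (intro mult_left_mono Q0) auto
          also have "\<dots> = real n * (C4 / r n)" by (simp add: C4_def add_divide_distrib algebra_simps)
          finally have "c' * dist2 (p n) (dh n \<omega>) (d0 n) \<le> C4 / r n"
            by (rule mult_left_le_imp_le) (use n in simp)
          then have "r n * dist2 (p n) (dh n \<omega>) (d0 n) \<le> C4 / c'" using rpos c' by (simp add: field_simps)
          then have "\<bar>r n * dist2 (p n) (dh n \<omega>) (d0 n)\<bar> \<le> K'"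
            using K'1(4) rpos dist[OF ws] by (simp add: abs_mult)
          then show ?thesis using scale[OF tsb(1)] scale[OF tsb(2)] by blast
        qed
        show ?thesis using fin B(1) pB good by blast
      qed
    qed
    then show ?thesis ..
  qed
  have ev1: "\<forall>\<^sub>F n in sequentially. (1::nat) \<le> n" by (rule eventually_ge_at_top)
  have meas: "\<forall>\<^sub>F n in sequentially. (\<lambda>\<omega>. min (sqrt (real n)) (r n) * (ah n \<omega> - \<alpha>0)) \<in> borel_measurable (M n)"
    "\<forall>\<^sub>F n in sequentially. (\<lambda>\<omega>. min (sqrt (real n)) (r n) * (bh n \<omega> - \<beta>0)) \<in> borel_measurable (M n)"
    "\<forall>\<^sub>F n in sequentially. (\<lambda>\<omega>. r n * dist2 (p n) (dh n \<omega>) (d0 n)) \<in> borel_measurable (M n)"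
    using ev1 by (eventually_elim, use abh_measurable dist_meas in \<open>auto intro!: borel_measurable_times borel_measurable_diff\<close>)+
  show ?thesis
  proof (intro conjI)
    show "Op1 M (\<lambda>n \<omega>. min (sqrt (real n)) (r n) * (ah n \<omega> - \<alpha>0))"
    proof (rule Op1I[OF meas(1)], goal_cases)
      case (1 \<epsilon>)
      show ?case using main[OF 1] by (elim exE, intro exI, elim eventually_mono) blast
    qed
    show "Op1 M (\<lambda>n \<omega>. min (sqrt (real n)) (r n) * (bh n \<omega> - \<beta>0))"
    proof (rule Op1I[OF meas(2)], goal_cases)
      case (1 \<epsilon>)
      show ?case using main[OF 1] by (elim exE, intro exI, elim eventually_mono) blast
    qed
    show "Op1 M (\<lambda>n \<omega>. r n * dist2 (p n) (dh n \<omega>) (d0 n))"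
    proof (rule Op1I[OF meas(3)], goal_cases)
      case (1 \<epsilon>)
      show ?case using main[OF 1] by (elim exE, intro exI, elim eventually_mono) blast
    qed
  qed
qed

end
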